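(* The shift automorphism $\widetilde\sigma:\mathcal H_n^{\Lambda}(q,\zeta)\to\mathcal H_n^{\Lambda}(q,\zeta)$ is homogeneous with respect to the $\mathbb Z$-grading on $\mathcal H_n^{\Lambda}(q,\zeta)$ transported from $\mathcal R_n^{\Lambda}(\Gamma)$ through the isomorphism $f$. Moreover, the subalgebra $\mathcal H_{p,n}^{\Lambda}(q)$ (embedded via $\phi$) is a graded subalgebra of $\mathcal H_n^{\Lambda}(q,\zeta)$.
   Context: **Parameters.** $d,p,n$ are positive integers, $n\ge2$, $r=dp$. $F$ is a field containing a primitive $p$-th root of unity $\zeta$. $q\in F\setminus\{0,1\}$ has order $e\in\mathbb N_{\ge2}\cup\{\infty\}$ in $F^\times$; $I=\mathbb Z/e\mathbb Z$ if $e<\infty$ and $I=\mathbb Z$ if $e=\infty$. $p'=\min\{m\ge1:\zeta^m\in\langle q\rangle\}$, $J'=\{1,\dots,p'\}$, $\omega=p/p'$, and $\eta\in I$ is the unique element with $\zeta^{p'}=q^\eta$. $K=I\times J'$. $\Lambda=(\Lambda_i)_{i\in I}$ is a finitely supported tuple of non-negative integers with $\sum_i\Lambda_i=\omega d$ and $\Lambda_i=\Lambda_{i+\eta}$ for all $i\in I$; put $\Lambda_{(i,j)}=\Lambda_i$ for $(i,j)\in K$. **Hecke algebras.** $\mathcal H_n^{\Lambda}(q,\zeta)$ is the unital associative $F$-algebra generated by $S,T_1,\dots,T_{n-1}$ with relations $\prod_{i\in I}\prod_{j\in J'}(S-\zeta^jq^i)^{\Lambda_i}=0$, $(T_a+1)(T_a-q)=0$,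 $ST_1ST_1=T_1ST_1S$, $ST_a=T_aS$ if $a>1$, $T_aT_b=T_bT_a$ if $|a-b|>1$, $T_aT_{a+1}T_a=T_{a+1}T_aT_{a+1}$. Put $X_1=S$, $qX_{a+1}=T_aX_aT_a$. The shift automorphism $\widetilde\sigma$ is the algebra automorphism with $\widetilde\sigma(S)=\zeta S$, $\widetilde\sigma(T_a)=T_a$. Choose a tuple $\mathsf L=(\mathsf L_i)_{i\in I}$ of non-negative integers with sum $d$ such that $\Lambda_i=\sum_{i'\in i+\eta I}\mathsf L_{i'}$ for all $i$ (one exists; the algebra below does not depend on the choice). $\mathcal H_{p,n}^{\Lambda}(q)$ is the unital associative $F$-algebra generated by $s,t_1',t_1,\dots,t_{n-1}$ with relations $\prod_{i\in I}(s-q^{pi})^{\mathsf L_i}=0$; $(t_1'+1)(t_1'-q)=(t_a+1)(t_a-q)=0$; $t_1't_2t_1'=t_2t_1't_2$; $t_at_{a+1}t_a=t_{a+1}t_at_{a+1}$; $(t_1't_1t_2)^2=(t_2t_1't_1)^2$; $t_1't_a=t_at_1'$ for $a\ge3$; $t_at_b=t_bt_a$ if $|a-b|>1$; $st_a=t_as$ for $a\ge2$; $st_1't_1=t_1't_1s$; and $\underbrace{st_1't_1t_1't_1\cdots}_{p+1}=\underbrace{t_1st_1't_1t_1'\cdots}_{p+1}$. By a theorem of Ariki, $\phi:\mathcal H_{p,n}^{\Lambda}(q)\to\mathcal H_n^{\Lambda}(q,\zeta)$, $\phi(s)=S^p$, $\phi(t_1')=S^{-1}T_1S$, $\phi(t_a)=T_a$,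 is a well-defined injective algebra homomorphism. **Quiver.** $\Gamma$ has vertex set $V=\{\zeta^jq^i\}_{i\in I,j\in J'}$, identified with $K$ via $(i,j)\leftrightarrow\zeta^jq^i$ (a bijection), with one directed edge $v\to qv$ for each $v\in V$. For $k,k'\in K$: $k\nleftrightarrow k'$ means $k\ne k'$ and neither $(k,k')$ nor $(k',k)$ is an edge; $k\to k'$ means $(k,k')$ is an edge and $(k',k)$ is not; $k\leftarrow k'$ means $k'\to k$; $k\leftrightarrows k'$ means both are edges. **Graded quiver Hecke algebra.** A $K$-composition $\alpha$ of $n$ is a finitely supported tuple $(\alpha_k)_{k\in K}$ of non-negative integers with sum $n$; $K^\alpha\subset K^n$ is the set of tuples with exactly $\alpha_k$ components equal to $k$ for each $k$. $\mathfrak S_n$ acts on $K^n$ by place permutations, $s_a=(a,a+1)$. $\mathcal R_\alpha^\Lambda(\Gamma)$ is the unital associative $F$-algebra generated by $e(\boldsymbol k)$ ($\boldsymbol k\in K^\alpha$), $y_1,\dots,y_n$, $\psi_1,\dots,\psi_{n-1}$ with relations: $\sum_{\boldsymbol k}e(\boldsymbol k)=1$; $e(\boldsymbol k)e(\boldsymbol k')=\delta_{\boldsymbol k,\boldsymbol k'}e(\boldsymbol k)$; $y_ae(\boldsymbol k)=e(\boldsymbol k)y_a$; $\psi_ae(\boldsymbol k)=e(s_a\cdot\boldsymbol k)\psi_a$; $y_ay_b=y_by_a$; $\psi_ay_b=y_b\psi_a$ if $b\ne a,a+1$; $\psi_a\psi_b=\psi_b\psi_a$ if $|a-b|>1$;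 $\psi_ay_{a+1}e(\boldsymbol k)=(y_a\psi_a+\delta_{k_a,k_{a+1}})e(\boldsymbol k)$; $y_{a+1}\psi_ae(\boldsymbol k)=(\psi_ay_a+\delta_{k_a,k_{a+1}})e(\boldsymbol k)$; $\psi_a^2e(\boldsymbol k)=0$, $e(\boldsymbol k)$, $(y_{a+1}-y_a)e(\boldsymbol k)$, $(y_a-y_{a+1})e(\boldsymbol k)$, $(y_{a+1}-y_a)(y_a-y_{a+1})e(\boldsymbol k)$ according as $k_a=k_{a+1}$, $k_a\nleftrightarrow k_{a+1}$, $k_a\to k_{a+1}$, $k_a\leftarrow k_{a+1}$, $k_a\leftrightarrows k_{a+1}$; $\psi_{a+1}\psi_a\psi_{a+1}e(\boldsymbol k)=(\psi_a\psi_{a+1}\psi_a+c)e(\boldsymbol k)$ with $c=-1$ if $k_{a+2}=k_a\to k_{a+1}$, $c=1$ if $k_{a+2}=k_a\leftarrow k_{a+1}$, $c=2y_{a+1}-y_a-y_{a+2}$ if $k_{a+2}=k_a\leftrightarrows k_{a+1}$, $c=0$ otherwise; and $y_1^{\Lambda_{k_1}}e(\boldsymbol k)=0$. $\mathcal R_n^\Lambda(\Gamma)=\bigoplus_\alpha\mathcal R_\alpha^\Lambda(\Gamma)$ (finitely many summands are non-zero). It is $\mathbb Z$-graded by $\deg e(\boldsymbol k)=0$, $\deg y_ae(\boldsymbol k)=2$, and $\deg\psi_ae(\boldsymbol k)=-2,0,1,1,2$ according as $k_a=k_{a+1}$, $k_a\nleftrightarrow k_{a+1}$, $k_a\to k_{a+1}$,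 $k_a\leftarrow k_{a+1}$, $k_a\leftrightarrows k_{a+1}$. **The isomorphism $f$.** The $y_a$ are nilpotent in $\mathcal R_n^\Lambda(\Gamma)$, so power series in them make sense. For $\boldsymbol k\in K^n$ with $k_a=(i_a,j_a)$ put $y_a(\boldsymbol k)=\zeta^{j_a}q^{i_a}(1-y_a)$; $P_a(\boldsymbol k)=1$ if $k_a=k_{a+1}$ and $P_a(\boldsymbol k)=(1-q)(1-y_a(\boldsymbol k)y_{a+1}(\boldsymbol k)^{-1})^{-1}$ otherwise; $Q_a(\boldsymbol k)=1-q+qy_{a+1}-y_a$ if $k_a=k_{a+1}$, $Q_a(\boldsymbol k)=\frac{1-P_a(\boldsymbol k)}{y_{a+1}-y_a}$ (an element of $F[[y_a,y_{a+1}]]$) if $k_a\leftarrow k_{a+1}$ or $k_a\leftrightarrows k_{a+1}$, and $Q_a(\boldsymbol k)=1-P_a(\boldsymbol k)$ otherwise. $f:\mathcal H_n^\Lambda(q,\zeta)\to\mathcal R_n^\Lambda(\Gamma)$ is the algebra isomorphism with $f(X_a)=\sum_{\boldsymbol k\in K^n}y_a(\boldsymbol k)e(\boldsymbol k)$ and $f(T_a)=\sum_{\boldsymbol k\in K^n}(\psi_aQ_a(\boldsymbol k)-P_a(\boldsymbol k))e(\boldsymbol k)$. "Homogeneous" for the automorphism means degree-preserving; a graded subalgebra is a subalgebra that is the direct sum of its intersections with the homogeneous components.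
   Formalization: In Q_a(k) for k_a ← k_{a+1} the printed sign makes f fail the quadratic relation in general (e.g. F=ℚ, q=2, p=1, n=2, Λ_0=Λ_1=1); the theorem is stated for f with Q_a(k)=±(1−P_a(k))/(y_{a+1}−y_a) in that case, covering both the printed and the corrected sign. *)

theory Defs
  imports
    "HOL-Algebra.QuotRing"
    "HOL-Algebra.Module"
    "HOL-Algebra.Subrings"
    "HOL-Library.Poly_Mapping"
    "HOL-Library.FuncSet"
    "HOL-Computational_Algebra.Polynomial"
    "HOL-Computational_Algebra.Formal_Power_Series"
    "HOL-Combinatorics.Transposition"
begin

section \<open>Associative algebras by generators and relations\<close>

datatype 'g fmonoid = Word (letters: "'g list")

instantiation fmonoid :: (type) monoid_add
begin

definition zero_fmonoid :: "'a fmonoid" where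
  "zero_fmonoid = Word []"

definition plus_fmonoid :: "'a fmonoid \<Rightarrow> 'a fmonoid \<Rightarrow> 'a fmonoid" where
  "plus_fmonoid v w = Word (letters v @ letters w)"

instance
  by standard (simp_all add: zero_fmonoid_def plus_fmonoid_def)

end

text \<open>
  The free monoid is written additively because \<^typ>\<open>'a \<Rightarrow>\<^sub>0 'f\<close> carries the
  convolution product with respect to addition on \<^typ>\<open>'a\<close>; thus the type below is
  the free associative unital algebra over \<open>'f\<close> on the type \<open>'g\<close>.
\<close>
type_synonym ('g, 'f) free_algebra = "'g fmonoid \<Rightarrow>\<^sub>0 'f"

definition gen :: "'g \<Rightarrow> ('g, 'f::field) free_algebra" where
  "gen g = Poly_Mapping.single (Word [g]) 1"

definition const :: "'f::field \<Rightarrow> ('g, 'f) free_algebra" where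
  "const c = Poly_Mapping.single 0 c"

definition free_alg :: "'g set \<Rightarrow> ('g, 'f::field) free_algebra ring" where
  "free_alg G =
     \<lparr>carrier = {x. \<forall>w \<in> Poly_Mapping.keys x. set (letters w) \<subseteq> G},
      monoid.mult = (*), monoid.one = 1, ring.zero = 0, ring.add = (+)\<rparr>"

text \<open>Relations are pairs (left hand side, right hand side).\<close>

definition rel_ideal ::
  "'g set \<Rightarrow> (('g, 'f::field) free_algebra \<times> ('g, 'f) free_algebra) set
    \<Rightarrow> ('g, 'f) free_algebra set" where
  "rel_ideal G E = Idl\<^bsub>free_alg G\<^esub> {l - r | l r. (l, r) \<in> E}"

definition pclass ::
  "'g set \<Rightarrow> (('g, 'f::field) free_algebra \<times> ('g, 'f) free_algebra) set
    \<Rightarrow> ('g, 'f) free_algebra \<Rightarrow> ('g, 'f) free_algebra set" where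
  "pclass G E x = rel_ideal G E +>\<^bsub>free_alg G\<^esub> x"

definition presented ::
  "'g set \<Rightarrow> (('g, 'f::field) free_algebra \<times> ('g, 'f) free_algebra) set
    \<Rightarrow> ('f, ('g, 'f) free_algebra set) module" where
  "presented G E =
     (let Q = free_alg G Quot rel_ideal G E in
      \<lparr>carrier = carrier Q, monoid.mult = monoid.mult Q, monoid.one = \<one>\<^bsub>Q\<^esub>,
       ring.zero = \<zero>\<^bsub>Q\<^esub>, ring.add = ring.add Q,
       module.smult = (\<lambda>c x. pclass G E (const c) \<otimes>\<^bsub>Q\<^esub> x)\<rparr>)"

text \<open>
  The module record of the library carries the scalar multiplication by all of \<open>'f\<close>.  Its locale
  \<open>algebra\<close> is for commutative algebras only, whence the following notions.
\<close>

definition alg_hom :: "('f, 'a) module \<Rightarrow> ('f, 'b) module \<Rightarrow> ('a \<Rightarrow> 'b) \<Rightarrow> bool" where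
  "alg_hom A B h \<longleftrightarrow> h \<in> ring_hom A B \<and>
     (\<forall>c. \<forall>x \<in> carrier A. h (c \<odot>\<^bsub>A\<^esub> x) = c \<odot>\<^bsub>B\<^esub> h x)"

definition alg_iso :: "('f, 'a) module \<Rightarrow> ('f, 'b) module \<Rightarrow> ('a \<Rightarrow> 'b) \<Rightarrow> bool" where
  "alg_iso A B h \<longleftrightarrow> alg_hom A B h \<and> bij_betw h (carrier A) (carrier B)"

definition direct_sum_alg :: "'i set \<Rightarrow> ('i \<Rightarrow> ('f, 'a) module) \<Rightarrow> ('f, 'i \<Rightarrow> 'a) module" where
  "direct_sum_alg J R =
     \<lparr>carrier = {x \<in> Pi\<^sub>E J (\<lambda>i. carrier (R i)). finite {i \<in> J. x i \<noteq> \<zero>\<^bsub>R i\<^esub>}},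
      monoid.mult = (\<lambda>x y. \<lambda>i\<in>J. x i \<otimes>\<^bsub>R i\<^esub> y i),
      monoid.one = (\<lambda>i\<in>J. \<one>\<^bsub>R i\<^esub>),
      ring.zero = (\<lambda>i\<in>J. \<zero>\<^bsub>R i\<^esub>),
      ring.add = (\<lambda>x y. \<lambda>i\<in>J. x i \<oplus>\<^bsub>R i\<^esub> y i),
      module.smult = (\<lambda>c x. \<lambda>i\<in>J. c \<odot>\<^bsub>R i\<^esub> x i)\<rparr>"

text \<open>
  \<open>C m\<close> is the homogeneous component of degree \<open>m\<close> of \<open>A\<close>: the subalgebra \<open>B\<close> is required to be
  the internal direct sum of the \<open>B \<inter> C m\<close>.
\<close>
definition graded_subalgebra :: "('f, 'a) module \<Rightarrow> (int \<Rightarrow> 'a set) \<Rightarrow> 'a set \<Rightarrow> bool" where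
  "graded_subalgebra A C B \<longleftrightarrow>
     subring B A \<and> (\<forall>c. \<forall>x \<in> B. c \<odot>\<^bsub>A\<^esub> x \<in> B) \<and>
     (\<forall>x \<in> B. \<exists>!h. (\<forall>m. h m \<in> B \<inter> C m) \<and> finite {m. h m \<noteq> \<zero>\<^bsub>A\<^esub>} \<and>
        x = (\<Oplus>\<^bsub>A\<^esub>m\<in>{m. h m \<noteq> \<zero>\<^bsub>A\<^esub>}. h m))"

text \<open>A commutative polynomial evaluated at an element of the free algebra.\<close>
definition poly_at :: "'f::field poly \<Rightarrow> ('g, 'f) free_algebra \<Rightarrow> ('g, 'f) free_algebra" where
  "poly_at P x = (\<Sum>m\<le>degree P. const (coeff P m) * x ^ m)"


section \<open>Parameters\<close>

definition primitive_root_of_unity :: "nat \<Rightarrow> 'f::field \<Rightarrow> bool" where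
  "primitive_root_of_unity p \<zeta> \<longleftrightarrow> p > 0 \<and> \<zeta> ^ p = 1 \<and> (\<forall>m. 0 < m \<and> m < p \<longrightarrow> \<zeta> ^ m \<noteq> 1)"

text \<open>Infinite order is encoded as 0; recall that \<open>i mod 0 = i\<close>.\<close>
definition mult_order :: "'f::field \<Rightarrow> nat" where
  "mult_order q = (if \<exists>m>0. q ^ m = 1 then LEAST m. m > 0 \<and> q ^ m = 1 else 0)"

text \<open>
  \<open>\<int>/e\<int>\<close> is represented by the canonical representatives modulo \<open>e\<close>, i.e. by \<open>{0..<e}\<close> for
  finite \<open>e\<close> and by all of \<open>\<int>\<close> otherwise.
\<close>
definition index_set :: "'f::field \<Rightarrow> int set" where
  "index_set q = {i. i mod int (mult_order q) = i}"

definition p_prime :: "'f::field \<Rightarrow> 'f \<Rightarrow> nat" where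
  "p_prime q \<zeta> = (LEAST m. m \<ge> 1 \<and> \<zeta> ^ m \<in> range (\<lambda>i::int. q powi i))"

definition eta :: "'f::field \<Rightarrow> 'f \<Rightarrow> int" where
  "eta q \<zeta> = (THE i. i \<in> index_set q \<and> \<zeta> ^ p_prime q \<zeta> = q powi i)"

type_synonym vertex = "int \<times> nat"

definition vertices :: "'f::field \<Rightarrow> 'f \<Rightarrow> vertex set" where
  "vertices q \<zeta> = index_set q \<times> {1..p_prime q \<zeta>}"

definition vval :: "'f::field \<Rightarrow> 'f \<Rightarrow> vertex \<Rightarrow> 'f" where
  "vval q \<zeta> k = \<zeta> ^ snd k * q powi fst k"

definition edge :: "'f::field \<Rightarrow> 'f \<Rightarrow> vertex \<Rightarrow> vertex \<Rightarrow> bool" where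
  "edge q \<zeta> k k' \<longleftrightarrow> vval q \<zeta> k' = q * vval q \<zeta> k"

definition no_edge :: "'f::field \<Rightarrow> 'f \<Rightarrow> vertex \<Rightarrow> vertex \<Rightarrow> bool" where
  "no_edge q \<zeta> k k' \<longleftrightarrow> k \<noteq> k' \<and> \<not> edge q \<zeta> k k' \<and> \<not> edge q \<zeta> k' k"

definition to_edge :: "'f::field \<Rightarrow> 'f \<Rightarrow> vertex \<Rightarrow> vertex \<Rightarrow> bool" where
  "to_edge q \<zeta> k k' \<longleftrightarrow> edge q \<zeta> k k' \<and> \<not> edge q \<zeta> k' k"

definition from_edge :: "'f::field \<Rightarrow> 'f \<Rightarrow> vertex \<Rightarrow> vertex \<Rightarrow> bool" where
  "from_edge q \<zeta> k k' \<longleftrightarrow> to_edge q \<zeta> k' k"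

definition both_edges :: "'f::field \<Rightarrow> 'f \<Rightarrow> vertex \<Rightarrow> vertex \<Rightarrow> bool" where
  "both_edges q \<zeta> k k' \<longleftrightarrow> edge q \<zeta> k k' \<and> edge q \<zeta> k' k"

text \<open>Only the values on \<^const>\<open>index_set\<close> of a weight matter.\<close>

definition weight_supp :: "'f::field \<Rightarrow> (int \<Rightarrow> nat) \<Rightarrow> int set" where
  "weight_supp q \<Lambda> = {i \<in> index_set q. \<Lambda> i \<noteq> 0}"

definition shift_invariant_weight :: "'f::field \<Rightarrow> 'f \<Rightarrow> nat \<Rightarrow> nat \<Rightarrow> (int \<Rightarrow> nat) \<Rightarrow> bool" where
  "shift_invariant_weight q \<zeta> p d \<Lambda> \<longleftrightarrow>
     finite (weight_supp q \<Lambda>) \<and>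
     (\<Sum>i\<in>weight_supp q \<Lambda>. \<Lambda> i) = (p div p_prime q \<zeta>) * d \<and>
     (\<forall>i\<in>index_set q. \<Lambda> i = \<Lambda> ((i + eta q \<zeta>) mod int (mult_order q)))"

definition weight_lift :: "'f::field \<Rightarrow> 'f \<Rightarrow> nat \<Rightarrow> (int \<Rightarrow> nat) \<Rightarrow> (int \<Rightarrow> nat) \<Rightarrow> bool" where
  "weight_lift q \<zeta> d \<Lambda> L \<longleftrightarrow>
     finite (weight_supp q L) \<and> (\<Sum>i\<in>weight_supp q L. L i) = d \<and>
     (\<forall>i\<in>index_set q.
        \<Lambda> i = (\<Sum>i' \<in> weight_supp q L \<inter>
                  {(i + eta q \<zeta> * t) mod int (mult_order q) | t. t \<in> index_set q}. L i'))"


section \<open>The Hecke algebras\<close>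

datatype hgen = HS | HT nat

definition hecke_gens :: "nat \<Rightarrow> hgen set" where
  "hecke_gens n = {HS} \<union> HT ` {1..<n}"

definition hecke_rels ::
  "'f::field \<Rightarrow> 'f \<Rightarrow> nat \<Rightarrow> (int \<Rightarrow> nat) \<Rightarrow> ((hgen, 'f) free_algebra \<times> (hgen, 'f) free_algebra) set"
where
  "hecke_rels q \<zeta> n \<Lambda> =
     (let S = gen HS; T = (\<lambda>a. gen (HT a)) in
        {(poly_at (\<Prod>i\<in>weight_supp q \<Lambda>. \<Prod>j\<in>{1..p_prime q \<zeta>}.
             [:- (\<zeta> ^ j * q powi i), 1:] ^ \<Lambda> i) S, 0)}
      \<union> {((T a + 1) * (T a - const q), 0) | a. 1 \<le> a \<and> a < n}
      \<union> {(S * T 1 * S * T 1, T 1 * S * T 1 * S)}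
      \<union> {(S * T a, T a * S) | a. 1 < a \<and> a < n}
      \<union> {(T a * T b, T b * T a) | a b.
            1 \<le> a \<and> a < n \<and> 1 \<le> b \<and> b < n \<and> \<bar>int a - int b\<bar> > 1}
      \<union> {(T a * T (a + 1) * T a, T (a + 1) * T a * T (a + 1)) | a. 1 \<le> a \<and> a + 1 < n})"

definition hecke :: "'f::field \<Rightarrow> 'f \<Rightarrow> nat \<Rightarrow> (int \<Rightarrow> nat) \<Rightarrow> ('f, (hgen, 'f) free_algebra set) module"
where
  "hecke q \<zeta> n \<Lambda> = presented (hecke_gens n) (hecke_rels q \<zeta> n \<Lambda>)"

definition hcl ::
  "'f::field \<Rightarrow> 'f \<Rightarrow> nat \<Rightarrow> (int \<Rightarrow> nat) \<Rightarrow> (hgen, 'f) free_algebra \<Rightarrow> (hgen, 'f) free_algebra set"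
where
  "hcl q \<zeta> n \<Lambda> = pclass (hecke_gens n) (hecke_rels q \<zeta> n \<Lambda>)"

fun hX :: "'f::field \<Rightarrow> nat \<Rightarrow> (hgen, 'f) free_algebra" where
  "hX q (Suc 0) = gen HS"
| "hX q (Suc (Suc a)) = const (inverse q) * gen (HT (Suc a)) * hX q (Suc a) * gen (HT (Suc a))"

text \<open>\<open>PT' \<close> stands for the additional generator \<open>t'\<^sub>1\<close>.\<close>
datatype pgen = PS | PT' | PT nat

definition phecke_gens :: "nat \<Rightarrow> pgen set" where
  "phecke_gens n = {PS, PT'} \<union> PT ` {1..<n}"

text \<open>The product \<open>x y x y \<dots>\<close> with \<open>m\<close> factors.\<close>
primrec alt_prod :: "nat \<Rightarrow> 'a::monoid_mult \<Rightarrow> 'a \<Rightarrow> 'a" where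
  "alt_prod 0 x y = 1"
| "alt_prod (Suc m) x y = x * alt_prod m y x"

definition phecke_rels ::
  "'f::field \<Rightarrow> nat \<Rightarrow> nat \<Rightarrow> (int \<Rightarrow> nat) \<Rightarrow> ((pgen, 'f) free_algebra \<times> (pgen, 'f) free_algebra) set"
where
  "phecke_rels q p n L =
     (let s = gen PS; t' = gen PT'; t = (\<lambda>a. gen (PT a)) in
        {(poly_at (\<Prod>i\<in>weight_supp q L. [:- (q powi (int p * i)), 1:] ^ L i) s, 0)}
      \<union> {((t' + 1) * (t' - const q), 0)}
      \<union> {((t a + 1) * (t a - const q), 0) | a. 1 \<le> a \<and> a < n}
      \<union> {(t' * t a * t', t a * t' * t a) | a. a = 2 \<and> a < n}
      \<union> {(t a * t (a + 1) * t a, t (a + 1) * t a * t (a + 1)) | a. 1 \<le> a \<and> a + 1 < n}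
      \<union> {((t' * t 1 * t a) ^ 2, (t a * t' * t 1) ^ 2) | a. a = 2 \<and> a < n}
      \<union> {(t' * t a, t a * t') | a. 3 \<le> a \<and> a < n}
      \<union> {(t a * t b, t b * t a) | a b.
            1 \<le> a \<and> a < n \<and> 1 \<le> b \<and> b < n \<and> \<bar>int a - int b\<bar> > 1}
      \<union> {(s * t a, t a * s) | a. 2 \<le> a \<and> a < n}
      \<union> {(s * t' * t 1, t' * t 1 * s)}
      \<union> {(s * alt_prod p t' (t 1), t 1 * s * alt_prod (p - 1) t' (t 1))})"

definition phecke :: "'f::field \<Rightarrow> nat \<Rightarrow> nat \<Rightarrow> (int \<Rightarrow> nat) \<Rightarrow> ('f, (pgen, 'f) free_algebra set) module"
where
  "phecke q p n L = presented (phecke_gens n) (phecke_rels q p n L)"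

definition pcl ::
  "'f::field \<Rightarrow> nat \<Rightarrow> nat \<Rightarrow> (int \<Rightarrow> nat) \<Rightarrow> (pgen, 'f) free_algebra \<Rightarrow> (pgen, 'f) free_algebra set"
where
  "pcl q p n L = pclass (phecke_gens n) (phecke_rels q p n L)"

definition is_shift ::
  "'f::field \<Rightarrow> 'f \<Rightarrow> nat \<Rightarrow> (int \<Rightarrow> nat)
    \<Rightarrow> ((hgen, 'f) free_algebra set \<Rightarrow> (hgen, 'f) free_algebra set) \<Rightarrow> bool" where
  "is_shift q \<zeta> n \<Lambda> \<sigma> \<longleftrightarrow>
     (let H = hecke q \<zeta> n \<Lambda>; c = hcl q \<zeta> n \<Lambda> in
      alg_iso H H \<sigma> \<and>
      \<sigma> (c (gen HS)) = \<zeta> \<odot>\<^bsub>H\<^esub> c (gen HS) \<and>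
      (\<forall>a\<in>{1..<n}. \<sigma> (c (gen (HT a))) = c (gen (HT a))))"

definition is_ariki_embedding ::
  "'f::field \<Rightarrow> 'f \<Rightarrow> nat \<Rightarrow> nat \<Rightarrow> (int \<Rightarrow> nat) \<Rightarrow> (int \<Rightarrow> nat)
    \<Rightarrow> ((pgen, 'f) free_algebra set \<Rightarrow> (hgen, 'f) free_algebra set) \<Rightarrow> bool" where
  "is_ariki_embedding q \<zeta> p n \<Lambda> L \<phi> \<longleftrightarrow>
     (let H = hecke q \<zeta> n \<Lambda>; P = phecke q p n L;
          S = hcl q \<zeta> n \<Lambda> (gen HS); T = (\<lambda>a. hcl q \<zeta> n \<Lambda> (gen (HT a))) in
      alg_hom P H \<phi> \<and> inj_on \<phi> (carrier P) \<and>
      \<phi> (pcl q p n L (gen PS)) = S [^]\<^bsub>H\<^esub> p \<and>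
      \<phi> (pcl q p n L (gen PT')) = inv\<^bsub>H\<^esub> S \<otimes>\<^bsub>H\<^esub> T 1 \<otimes>\<^bsub>H\<^esub> S \<and>
      (\<forall>a\<in>{1..<n}. \<phi> (pcl q p n L (gen (PT a))) = T a))"


section \<open>The cyclotomic quiver Hecke algebra\<close>

definition compositions :: "'f::field \<Rightarrow> 'f \<Rightarrow> nat \<Rightarrow> (vertex \<Rightarrow> nat) set" where
  "compositions q \<zeta> n =
     {\<alpha>. finite {k. \<alpha> k \<noteq> 0} \<and> {k. \<alpha> k \<noteq> 0} \<subseteq> vertices q \<zeta> \<and> (\<Sum>k | \<alpha> k \<noteq> 0. \<alpha> k) = n}"

type_synonym vtuple = "nat \<Rightarrow> vertex"

definition tuples :: "'f::field \<Rightarrow> 'f \<Rightarrow> nat \<Rightarrow> (vertex \<Rightarrow> nat) \<Rightarrow> vtuple set" where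
  "tuples q \<zeta> n \<alpha> =
     {k \<in> {1..n} \<rightarrow>\<^sub>E vertices q \<zeta>. \<forall>v\<in>vertices q \<zeta>. card {a \<in> {1..n}. k a = v} = \<alpha> v}"

text \<open>Place permutation by the simple transposition \<open>s\<^sub>a\<close>.\<close>
definition swap_at :: "nat \<Rightarrow> vtuple \<Rightarrow> vtuple" where
  "swap_at a k = k \<circ> transpose a (a + 1)"

datatype qgen = QE vtuple | QY nat | QPsi nat

definition qh_gens :: "'f::field \<Rightarrow> 'f \<Rightarrow> nat \<Rightarrow> (vertex \<Rightarrow> nat) \<Rightarrow> qgen set" where
  "qh_gens q \<zeta> n \<alpha> = QE ` tuples q \<zeta> n \<alpha> \<union> QY ` {1..n} \<union> QPsi ` {1..<n}"

definition psi_square :: "'f::field \<Rightarrow> 'f \<Rightarrow> nat \<Rightarrow> vtuple \<Rightarrow> (qgen, 'f) free_algebra" where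
  "psi_square q \<zeta> a k =
     (let y = gen (QY a); y' = gen (QY (a + 1)) in
      if k a = k (a + 1) then 0
      else if no_edge q \<zeta> (k a) (k (a + 1)) then 1
      else if to_edge q \<zeta> (k a) (k (a + 1)) then y' - y
      else if from_edge q \<zeta> (k a) (k (a + 1)) then y - y'
      else (y' - y) * (y - y'))"

definition braid_error :: "'f::field \<Rightarrow> 'f \<Rightarrow> nat \<Rightarrow> vtuple \<Rightarrow> (qgen, 'f) free_algebra" where
  "braid_error q \<zeta> a k =
     (if k (a + 2) = k a \<and> to_edge q \<zeta> (k a) (k (a + 1)) then - 1
      else if k (a + 2) = k a \<and> from_edge q \<zeta> (k a) (k (a + 1)) then 1
      else if k (a + 2) = k a \<and> both_edges q \<zeta> (k a) (k (a + 1))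
        then 2 * gen (QY (a + 1)) - gen (QY a) - gen (QY (a + 2))
      else 0)"

definition qh_rels ::
  "'f::field \<Rightarrow> 'f \<Rightarrow> nat \<Rightarrow> (int \<Rightarrow> nat) \<Rightarrow> (vertex \<Rightarrow> nat)
    \<Rightarrow> ((qgen, 'f) free_algebra \<times> (qgen, 'f) free_algebra) set" where
  "qh_rels q \<zeta> n \<Lambda> \<alpha> =
     (let K = tuples q \<zeta> n \<alpha>; e = (\<lambda>k. gen (QE k)); y = (\<lambda>a. gen (QY a));
          \<psi> = (\<lambda>a. gen (QPsi a)) in
        {(\<Sum>k\<in>K. e k, 1)}
      \<union> {(e k * e k', if k = k' then e k else 0) | k k'. k \<in> K \<and> k' \<in> K}
      \<union> {(y a * e k, e k * y a) | a k. 1 \<le> a \<and> a \<le> n \<and> k \<in> K}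
      \<union> {(\<psi> a * e k, e (swap_at a k) * \<psi> a) | a k. 1 \<le> a \<and> a < n \<and> k \<in> K}
      \<union> {(y a * y b, y b * y a) | a b. 1 \<le> a \<and> a \<le> n \<and> 1 \<le> b \<and> b \<le> n}
      \<union> {(\<psi> a * y b, y b * \<psi> a) | a b.
            1 \<le> a \<and> a < n \<and> 1 \<le> b \<and> b \<le> n \<and> b \<noteq> a \<and> b \<noteq> a + 1}
      \<union> {(\<psi> a * \<psi> b, \<psi> b * \<psi> a) | a b.
            1 \<le> a \<and> a < n \<and> 1 \<le> b \<and> b < n \<and> \<bar>int a - int b\<bar> > 1}
      \<union> {(\<psi> a * y (a + 1) * e k, (y a * \<psi> a + (if k a = k (a + 1) then 1 else 0)) * e k) | a k.
            1 \<le> a \<and> a < n \<and> k \<in> K}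
      \<union> {(y (a + 1) * \<psi> a * e k, (\<psi> a * y a + (if k a = k (a + 1) then 1 else 0)) * e k) | a k.
            1 \<le> a \<and> a < n \<and> k \<in> K}
      \<union> {(\<psi> a ^ 2 * e k, psi_square q \<zeta> a k * e k) | a k. 1 \<le> a \<and> a < n \<and> k \<in> K}
      \<union> {(\<psi> (a + 1) * \<psi> a * \<psi> (a + 1) * e k,
            (\<psi> a * \<psi> (a + 1) * \<psi> a + braid_error q \<zeta> a k) * e k) | a k.
            1 \<le> a \<and> a + 1 < n \<and> k \<in> K}
      \<union> {(y 1 ^ \<Lambda> (fst (k 1)) * e k, 0) | k. k \<in> K})"

definition qh_block ::
  "'f::field \<Rightarrow> 'f \<Rightarrow> nat \<Rightarrow> (int \<Rightarrow> nat) \<Rightarrow> (vertex \<Rightarrow> nat) \<Rightarrow> ('f, (qgen, 'f) free_algebra set) module"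
where
  "qh_block q \<zeta> n \<Lambda> \<alpha> = presented (qh_gens q \<zeta> n \<alpha>) (qh_rels q \<zeta> n \<Lambda> \<alpha>)"

definition qcl ::
  "'f::field \<Rightarrow> 'f \<Rightarrow> nat \<Rightarrow> (int \<Rightarrow> nat) \<Rightarrow> (vertex \<Rightarrow> nat)
    \<Rightarrow> (qgen, 'f) free_algebra \<Rightarrow> (qgen, 'f) free_algebra set" where
  "qcl q \<zeta> n \<Lambda> \<alpha> = pclass (qh_gens q \<zeta> n \<alpha>) (qh_rels q \<zeta> n \<Lambda> \<alpha>)"

definition psi_degree :: "'f::field \<Rightarrow> 'f \<Rightarrow> vertex \<Rightarrow> vertex \<Rightarrow> int" where
  "psi_degree q \<zeta> v w =
     (if v = w then - 2
      else if no_edge q \<zeta> v w then 0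
      else if to_edge q \<zeta> v w then 1
      else if from_edge q \<zeta> v w then 1
      else 2)"

text \<open>
  The grading determined by the degrees of the \<open>e(k)\<close>, \<open>y\<^sub>a e(k)\<close>, \<open>\<psi>\<^sub>a e(k)\<close>: these elements
  generate the block, and the component of degree \<open>m\<close> is the linear span of their products of
  total degree \<open>m\<close>.
\<close>
inductive qh_homogeneous ::
  "'f::field \<Rightarrow> 'f \<Rightarrow> nat \<Rightarrow> (int \<Rightarrow> nat) \<Rightarrow> (vertex \<Rightarrow> nat)
    \<Rightarrow> int \<Rightarrow> (qgen, 'f) free_algebra set \<Rightarrow> bool"
  for q \<zeta> n \<Lambda> \<alpha> where
  idem: "k \<in> tuples q \<zeta> n \<alpha> \<Longrightarrow>
    qh_homogeneous q \<zeta> n \<Lambda> \<alpha> 0 (qcl q \<zeta> n \<Lambda> \<alpha> (gen (QE k)))"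
| dot: "k \<in> tuples q \<zeta> n \<alpha> \<Longrightarrow> 1 \<le> a \<Longrightarrow> a \<le> n \<Longrightarrow>
    qh_homogeneous q \<zeta> n \<Lambda> \<alpha> 2 (qcl q \<zeta> n \<Lambda> \<alpha> (gen (QY a) * gen (QE k)))"
| crossing: "k \<in> tuples q \<zeta> n \<alpha> \<Longrightarrow> 1 \<le> a \<Longrightarrow> a < n \<Longrightarrow>
    qh_homogeneous q \<zeta> n \<Lambda> \<alpha> (psi_degree q \<zeta> (k a) (k (a + 1)))
      (qcl q \<zeta> n \<Lambda> \<alpha> (gen (QPsi a) * gen (QE k)))"
| product: "qh_homogeneous q \<zeta> n \<Lambda> \<alpha> m x \<Longrightarrow> qh_homogeneous q \<zeta> n \<Lambda> \<alpha> m' x' \<Longrightarrow>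
    qh_homogeneous q \<zeta> n \<Lambda> \<alpha> (m + m') (x \<otimes>\<^bsub>qh_block q \<zeta> n \<Lambda> \<alpha>\<^esub> x')"
| zero: "qh_homogeneous q \<zeta> n \<Lambda> \<alpha> m \<zero>\<^bsub>qh_block q \<zeta> n \<Lambda> \<alpha>\<^esub>"
| sum: "qh_homogeneous q \<zeta> n \<Lambda> \<alpha> m x \<Longrightarrow> qh_homogeneous q \<zeta> n \<Lambda> \<alpha> m x' \<Longrightarrow>
    qh_homogeneous q \<zeta> n \<Lambda> \<alpha> m (x \<oplus>\<^bsub>qh_block q \<zeta> n \<Lambda> \<alpha>\<^esub> x')"
| scalar: "qh_homogeneous q \<zeta> n \<Lambda> \<alpha> m x \<Longrightarrow>
    qh_homogeneous q \<zeta> n \<Lambda> \<alpha> m (c \<odot>\<^bsub>qh_block q \<zeta> n \<Lambda> \<alpha>\<^esub> x)"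

definition quiver_hecke ::
  "'f::field \<Rightarrow> 'f \<Rightarrow> nat \<Rightarrow> (int \<Rightarrow> nat)
    \<Rightarrow> ('f, (vertex \<Rightarrow> nat) \<Rightarrow> (qgen, 'f) free_algebra set) module" where
  "quiver_hecke q \<zeta> n \<Lambda> = direct_sum_alg (compositions q \<zeta> n) (qh_block q \<zeta> n \<Lambda>)"

definition quiver_hecke_component ::
  "'f::field \<Rightarrow> 'f \<Rightarrow> nat \<Rightarrow> (int \<Rightarrow> nat) \<Rightarrow> int
    \<Rightarrow> ((vertex \<Rightarrow> nat) \<Rightarrow> (qgen, 'f) free_algebra set) set" where
  "quiver_hecke_component q \<zeta> n \<Lambda> m =
     {x \<in> carrier (quiver_hecke q \<zeta> n \<Lambda>).
        \<forall>\<alpha>\<in>compositions q \<zeta> n. qh_homogeneous q \<zeta> n \<Lambda> \<alpha> m (x \<alpha>)}"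


section \<open>The isomorphism\<close>

text \<open>
  \<open>F[[u,v]]\<close> is \<^typ>\<open>'f fps fps\<close> with \<open>u\<close> the inner and \<open>v\<close> the outer variable; they stand for
  \<open>y\<^sub>a\<close> and \<open>y\<^sub>a\<^sub>+\<^sub>1\<close>.  The function \<^const>\<open>inverse\<close> on this type is the inverse on power
  series whose coefficient at \<open>u\<^sup>0 v\<^sup>0\<close> is nonzero.
\<close>

definition ps_const :: "'f::field \<Rightarrow> 'f fps fps" where
  "ps_const c = fps_const (fps_const c)"

definition ps_u :: "'f::field fps fps" where
  "ps_u = fps_const fps_X"

definition ps_v :: "'f::field fps fps" where
  "ps_v = fps_X"

text \<open>
  Evaluation at commuting nilpotent elements \<open>x\<close>, \<open>y\<close>: only finitely many of the monomials are
  nonzero, so that the sum is finite.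
\<close>
definition ps_eval :: "('f::field, 'a) module \<Rightarrow> 'a \<Rightarrow> 'a \<Rightarrow> 'f fps fps \<Rightarrow> 'a" where
  "ps_eval A x y g =
     (\<Oplus>\<^bsub>A\<^esub>lm\<in>{(l, m). x [^]\<^bsub>A\<^esub> (l::nat) \<otimes>\<^bsub>A\<^esub> y [^]\<^bsub>A\<^esub> (m::nat) \<noteq> \<zero>\<^bsub>A\<^esub>}.
        fps_nth (fps_nth g (snd lm)) (fst lm) \<odot>\<^bsub>A\<^esub> (x [^]\<^bsub>A\<^esub> fst lm \<otimes>\<^bsub>A\<^esub> y [^]\<^bsub>A\<^esub> snd lm))"

definition P_series :: "'f::field \<Rightarrow> 'f \<Rightarrow> vertex \<Rightarrow> vertex \<Rightarrow> 'f fps fps" where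
  "P_series q \<zeta> k k' =
     (if k = k' then 1
      else ps_const (1 - q) *
        inverse (1 - ps_const (vval q \<zeta> k) * (1 - ps_u) *
                     inverse (ps_const (vval q \<zeta> k') * (1 - ps_v))))"

text \<open>
  The exact quotient of \<open>1 - P\<close> by \<open>v - u\<close> in the domain \<open>F[[u,v]]\<close>; division on nested power
  series does not compute it, as \<open>v - u\<close> has the nonunit \<open>- u\<close> as its constant coefficient.
\<close>
definition PQ_quotient :: "'f::field \<Rightarrow> 'f \<Rightarrow> vertex \<Rightarrow> vertex \<Rightarrow> 'f fps fps" where
  "PQ_quotient q \<zeta> k k' = (THE g. g * (ps_v - ps_u) = 1 - P_series q \<zeta> k k')"

text \<open>
  The sign \<open>\<epsilon>\<close> in the case of a single edge \<open>k \<leftarrow> k'\<close> is a parameter, ranging over \<open>1\<close>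
  and \<open>- 1\<close>.  The formula \<open>(1 - P) / (y\<^sub>a\<^sub>+\<^sub>1 - y\<^sub>a)\<close> is \<open>\<epsilon> = 1\<close>.  If \<open>k\<^sub>a \<rightarrow> k\<^sub>a\<^sub>+\<^sub>1\<close>, then
  the quadratic relation for the image of \<open>T\<^sub>a\<close> amounts to
  \<open>\<psi>\<^sub>a\<^sup>2 e(k) = \<epsilon> (y\<^sub>a - y\<^sub>a\<^sub>+\<^sub>1) e(k)\<close>; hence the sign that goes with \<open>psi_square\<close> is
  \<open>\<epsilon> = - 1\<close>, and with \<open>\<epsilon> = 1\<close> there is in general no homomorphism unless the
  characteristic is 2 or \<open>q = - 1\<close>.
\<close>
definition Q_series :: "'f::field \<Rightarrow> 'f \<Rightarrow> 'f \<Rightarrow> vertex \<Rightarrow> vertex \<Rightarrow> 'f fps fps" where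
  "Q_series \<epsilon> q \<zeta> k k' =
     (if k = k' then ps_const (1 - q) + ps_const q * ps_v - ps_u
      else if from_edge q \<zeta> k k' then ps_const \<epsilon> * PQ_quotient q \<zeta> k k'
      else if both_edges q \<zeta> k k' then PQ_quotient q \<zeta> k k'
      else 1 - P_series q \<zeta> k k')"

text \<open>
  The images of \<open>X\<^sub>a\<close> and \<open>T\<^sub>a\<close>; the sum over all of \<open>K\<^sup>n\<close> has as its component at \<open>\<alpha>\<close> the finite
  sum over \<open>K\<^sup>\<alpha>\<close>.
\<close>

definition image_X ::
  "'f::field \<Rightarrow> 'f \<Rightarrow> nat \<Rightarrow> (int \<Rightarrow> nat) \<Rightarrow> nat \<Rightarrow> (vertex \<Rightarrow> nat) \<Rightarrow> (qgen, 'f) free_algebra set"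
where
  "image_X q \<zeta> n \<Lambda> a =
     (\<lambda>\<alpha>\<in>compositions q \<zeta> n.
        \<Oplus>\<^bsub>qh_block q \<zeta> n \<Lambda> \<alpha>\<^esub>k\<in>tuples q \<zeta> n \<alpha>.
          qcl q \<zeta> n \<Lambda> \<alpha> (const (vval q \<zeta> (k a)) * (1 - gen (QY a)) * gen (QE k)))"

definition image_T ::
  "'f::field \<Rightarrow> 'f \<Rightarrow> 'f \<Rightarrow> nat \<Rightarrow> (int \<Rightarrow> nat) \<Rightarrow> nat \<Rightarrow> (vertex \<Rightarrow> nat)
    \<Rightarrow> (qgen, 'f) free_algebra set"
where
  "image_T \<epsilon> q \<zeta> n \<Lambda> a =
     (\<lambda>\<alpha>\<in>compositions q \<zeta> n.
        let R = qh_block q \<zeta> n \<Lambda> \<alpha>; c = qcl q \<zeta> n \<Lambda> \<alpha>;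
            ev = ps_eval R (c (gen (QY a))) (c (gen (QY (a + 1)))) in
        \<Oplus>\<^bsub>R\<^esub>k\<in>tuples q \<zeta> n \<alpha>.
          (c (gen (QPsi a)) \<otimes>\<^bsub>R\<^esub> ev (Q_series \<epsilon> q \<zeta> (k a) (k (a + 1)))
             \<ominus>\<^bsub>R\<^esub> ev (P_series q \<zeta> (k a) (k (a + 1)))) \<otimes>\<^bsub>R\<^esub> c (gen (QE k)))"

definition is_bk_isomorphism ::
  "'f::field \<Rightarrow> 'f \<Rightarrow> 'f \<Rightarrow> nat \<Rightarrow> (int \<Rightarrow> nat)
    \<Rightarrow> ((hgen, 'f) free_algebra set \<Rightarrow> (vertex \<Rightarrow> nat) \<Rightarrow> (qgen, 'f) free_algebra set) \<Rightarrow> bool"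
where
  "is_bk_isomorphism \<epsilon> q \<zeta> n \<Lambda> f \<longleftrightarrow>
     alg_iso (hecke q \<zeta> n \<Lambda>) (quiver_hecke q \<zeta> n \<Lambda>) f \<and>
     (\<forall>a\<in>{1..n}. f (hcl q \<zeta> n \<Lambda> (hX q a)) = image_X q \<zeta> n \<Lambda> a) \<and>
     (\<forall>a\<in>{1..<n}. f (hcl q \<zeta> n \<Lambda> (gen (HT a))) = image_T \<epsilon> q \<zeta> n \<Lambda> a)"

definition hecke_component ::
  "'f::field \<Rightarrow> 'f \<Rightarrow> nat \<Rightarrow> (int \<Rightarrow> nat)
    \<Rightarrow> ((hgen, 'f) free_algebra set \<Rightarrow> (vertex \<Rightarrow> nat) \<Rightarrow> (qgen, 'f) free_algebra set)
    \<Rightarrow> int \<Rightarrow> (hgen, 'f) free_algebra set set"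
where
  "hecke_component q \<zeta> n \<Lambda> f m =
     {x \<in> carrier (hecke q \<zeta> n \<Lambda>). f x \<in> quiver_hecke_component q \<zeta> n \<Lambda> m}"

end

theory Submission
  imports Defs "HOL-Algebra.UnivPoly"
begin

text \<open>
  Multiplication by \<open>\<zeta>\<^sup>-\<^sup>1\<close> is an automorphism \<open>\<tau>\<close> of the quiver that preserves the weight.  Renaming
  \<open>e(k)\<close> to \<open>e(\<tau> k)\<close> gives a degree-preserving automorphism of the quiver Hecke algebra, and since
  \<open>P\<close> and \<open>Q\<close> depend only on ratios of vertices, it corresponds to the shift under \<open>f\<close>.
  The image of \<open>\<phi>\<close> is the algebra of fixed points of the shift, because
  \<open>S\<^sup>-\<^sup>1 T\<^sub>1' S = T\<^sub>1' T\<^sub>1 T\<^sub>1'\<^sup>-\<^sup>1\<close> for \<open>T\<^sub>1' = S\<^sup>-\<^sup>1 T\<^sub>1 S\<close>, so that the powers of \<open>S\<close> span the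
  Hecke algebra over the image.  The fixed points of a degree-preserving automorphism are closed
  under taking homogeneous components.
\<close>

section \<open>Free algebras and presentations\<close>

text \<open>The components are spans of products of generators, which gives spanning but says
  nothing about directness. As \<open>graded_subalgebra\<close> asks for unique decompositions, the
  relations themselves must be shown to be homogeneous. The obstacle is that \<psi>_a has no degree,
  only its products with the idempotents do, and several relations are stated only after right
  multiplication by e(k). Degrees are therefore checked on one tuple k at a time, together with the
  tuple to which an element moves it. The rotation \<tau> changes the multiplicities of the vertices
  and so permutes the blocks: the automorphism is a family of maps between different blocks,
  compared with the shift block by block on S and the T_a. Its factor is \<zeta>^-1, not \<zeta>:
  e(k) goes to e(\<tau> k) while its coefficient in the image of S is kept, so v(k_1) has to equal
  \<zeta> v(\<tau> k_1). Uniqueness of decompositions serves twice: it is part of the claim, and it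
  shows that the components of a fixed point are fixed.\<close>

lemma carrier_free_alg: "x \<in> carrier (free_alg G) \<longleftrightarrow> (\<forall>w \<in> Poly_Mapping.keys x. set (letters w) \<subseteq> G)"
  by (simp add: free_alg_def)

lemma free_alg_ops [simp]:
  "x \<otimes>\<^bsub>free_alg G\<^esub> y = x * y" "x \<oplus>\<^bsub>free_alg G\<^esub> y = x + y"
  "\<one>\<^bsub>free_alg G\<^esub> = 1" "\<zero>\<^bsub>free_alg G\<^esub> = 0"
  by (simp_all add: free_alg_def)

lemma const_simps:
  "const 0 = 0" "const 1 = 1" "const (a + b) = const a + const b" "const (a * b) = const a * const b"
  "const (- a) = - const a" "const (a - b) = const a - const b"
  by (simp_all add: const_def single_add mult_single single_uminus single_diff)

lemma free_alg_closed [simp]: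
  "0 \<in> carrier (free_alg G)" "1 \<in> carrier (free_alg G)" "const c \<in> carrier (free_alg G)"
  "gen g \<in> carrier (free_alg G) \<longleftrightarrow> g \<in> G"
  by (auto simp: carrier_free_alg gen_def const_def zero_fmonoid_def keys_one)

lemma free_alg_add_closed [simp]:
  "x \<in> carrier (free_alg G) \<Longrightarrow> y \<in> carrier (free_alg G) \<Longrightarrow> x + y \<in> carrier (free_alg G)"
  using keys_add[of x y] by (fastforce simp: carrier_free_alg)

lemma free_alg_uminus_closed [simp]:
  "x \<in> carrier (free_alg G) \<Longrightarrow> - x \<in> carrier (free_alg G)"
  by (simp add: carrier_free_alg)

lemma free_alg_diff_closed [simp]:
  "x \<in> carrier (free_alg G) \<Longrightarrow> y \<in> carrier (free_alg G) \<Longrightarrow> x - y \<in> carrier (free_alg G)"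
  using free_alg_add_closed[of x G "- y"] by simp

lemma free_alg_mult_closed [simp]:
  "x \<in> carrier (free_alg G) \<Longrightarrow> y \<in> carrier (free_alg G) \<Longrightarrow> x * y \<in> carrier (free_alg G)"
  using keys_mult[of x y] by (fastforce simp: carrier_free_alg plus_fmonoid_def)

lemma free_alg_power_closed [simp]:
  "x \<in> carrier (free_alg G) \<Longrightarrow> x ^ m \<in> carrier (free_alg G)"
  by (induction m) auto

lemma free_alg_numeral_closed [simp]: "numeral m \<in> carrier (free_alg G)"
  by (induction m) (simp_all only: numeral.simps free_alg_closed free_alg_add_closed)

lemma free_alg_sum_closed [simp]:
  "(\<And>i. i \<in> A \<Longrightarrow> f i \<in> carrier (free_alg G)) \<Longrightarrow> sum f A \<in> carrier (free_alg G)"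
  by (induction A rule: infinite_finite_induct) auto

lemma ring_free_alg: "ring (free_alg G)"
proof (intro ringI abelian_groupI monoidI)
  fix x assume "x \<in> carrier (free_alg G)"
  then show "\<exists>y\<in>carrier (free_alg G). y \<oplus>\<^bsub>free_alg G\<^esub> x = \<zero>\<^bsub>free_alg G\<^esub>"
    by (intro bexI[of _ "- x"]) auto
qed (auto simp: algebra_simps)

lemma free_alg_uminus [simp]:
  fixes x :: "('g, 'f::field) free_algebra"
  assumes "x \<in> carrier (free_alg G)"
  shows "\<ominus>\<^bsub>free_alg G\<^esub> x = - x"
proof -
  interpret ring "free_alg G :: ('g, 'f) free_algebra ring" by (rule ring_free_alg)
  show ?thesis by (rule minus_equality) (use assms in auto)
qed

lemma free_alg_minus [simp]:
  assumes "y \<in> carrier (free_alg G)"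
  shows "x \<ominus>\<^bsub>free_alg G\<^esub> y = x - y"
  using assms by (simp add: a_minus_def)

lemma poly_mapping_eq_sum_single:
  "x = (\<Sum>w\<in>Poly_Mapping.keys x. Poly_Mapping.single w (Poly_Mapping.lookup x w))"
  by (rule poly_mapping_eqI)
     (auto simp: lookup_sum lookup_single when_def not_in_keys_iff_lookup_eq_zero)

lemma single_Nil: "Poly_Mapping.single (Word []) c = const c"
  by (simp add: const_def zero_fmonoid_def)

lemma single_Cons:
  "Poly_Mapping.single (Word (g # ws)) c = gen g * Poly_Mapping.single (Word ws) c"
  by (simp add: gen_def mult_single plus_fmonoid_def)

lemma free_alg_induct [consumes 1, case_names const gen add mult]:
  assumes "x \<in> carrier (free_alg G)"
    and "\<And>c. P (const c)" and gen: "\<And>g. g \<in> G \<Longrightarrow> P (gen g)"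
    and add: "\<And>x y. x \<in> carrier (free_alg G) \<Longrightarrow> y \<in> carrier (free_alg G) \<Longrightarrow> P x \<Longrightarrow> P y \<Longrightarrow> P (x + y)"
    and mult: "\<And>x y. x \<in> carrier (free_alg G) \<Longrightarrow> y \<in> carrier (free_alg G) \<Longrightarrow> P x \<Longrightarrow> P y \<Longrightarrow> P (x * y)"
  shows "P x"
proof -
  have P0: "P 0" using assms(2)[of 0] by (simp add: const_simps)
  have single: "Poly_Mapping.single (Word ws) c \<in> carrier (free_alg G) \<and> P (Poly_Mapping.single (Word ws) c)"
    if "set ws \<subseteq> G" for ws c
    using that by (induction ws) (auto simp: single_Nil single_Cons assms(2) intro!: mult gen)
  have "sum f A \<in> carrier (free_alg G) \<and> P (sum f A)"
    if "\<And>w. w \<in> A \<Longrightarrow> f w \<in> carrier (free_alg G) \<and> P (f w)" for f and A :: "'a fmonoid set"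
    using that by (induction A rule: infinite_finite_induct) (auto simp: P0 intro!: add)
  from this[of "Poly_Mapping.keys x" "\<lambda>w. Poly_Mapping.single w (Poly_Mapping.lookup x w)"]
  show ?thesis
    unfolding poly_mapping_eq_sum_single[of x, symmetric]
    using single assms(1) by (metis carrier_free_alg fmonoid.collapse)
qed

lemma const_central: "const c * x = x * const c"
proof -
  have "x \<in> carrier (free_alg UNIV)"
    by (simp add: carrier_free_alg)
  then show ?thesis
  proof (induction rule: free_alg_induct)
    case (mult x y)
    then show ?case by (metis mult.assoc)
  qed (simp_all add: algebra_simps gen_def const_def mult_single)
qed

text \<open>The target is a type of class \<open>ring_1\<close>, so a quotient given by a carrier of
  cosets cannot be the target. The maps built here end in a free algebra or in Laurent polynomials
  over one, and the relation ideals are tracked separately. The parameter \<kappa> embeds the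
  scalars in either target.\<close>

locale central_hom =
  fixes \<kappa> :: "'f::field \<Rightarrow> 'r::ring_1"
  assumes hom_add: "\<kappa> (a + b) = \<kappa> a + \<kappa> b" and hom_mult: "\<kappa> (a * b) = \<kappa> a * \<kappa> b"
    and hom_one: "\<kappa> 1 = 1" and central: "\<kappa> a * z = z * \<kappa> a"
begin

lemma hom_zero: "\<kappa> 0 = 0"
  using hom_add[of 0 0] by simp

definition free_lift :: "('g \<Rightarrow> 'r) \<Rightarrow> ('g, 'f) free_algebra \<Rightarrow> 'r" where
  "free_lift \<rho> x =
     (\<Sum>w\<in>Poly_Mapping.keys x. \<kappa> (Poly_Mapping.lookup x w) * prod_list (map \<rho> (letters w)))"

lemma free_lift_superset:
  assumes "finite A" "Poly_Mapping.keys x \<subseteq> A"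
  shows "free_lift \<rho> x = (\<Sum>w\<in>A. \<kappa> (Poly_Mapping.lookup x w) * prod_list (map \<rho> (letters w)))"
  unfolding free_lift_def using assms
  by (intro sum.mono_neutral_left) (auto simp: hom_zero not_in_keys_iff_lookup_eq_zero)

lemma free_lift_zero [simp]: "free_lift \<rho> 0 = 0"
  by (simp add: free_lift_def)

lemma free_lift_add: "free_lift \<rho> (x + y) = free_lift \<rho> x + free_lift \<rho> y"
  by (simp add: free_lift_superset[of "Poly_Mapping.keys x \<union> Poly_Mapping.keys y"] keys_add
      lookup_add hom_add distrib_right sum.distrib)

lemma free_lift_diff: "free_lift \<rho> (x - y) = free_lift \<rho> x - free_lift \<rho> y"
  using free_lift_add[of \<rho> "x - y" y] by simp

lemma free_lift_sum: "free_lift \<rho> (sum f A) = (\<Sum>i\<in>A. free_lift \<rho> (f i))"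
  by (induction A rule: infinite_finite_induct) (auto simp: free_lift_add)

lemma free_lift_single:
  "free_lift \<rho> (Poly_Mapping.single w c) = \<kappa> c * prod_list (map \<rho> (letters w))"
  by (simp add: free_lift_def hom_zero)

lemma free_lift_const: "free_lift \<rho> (const c) = \<kappa> c"
  by (simp add: const_def free_lift_single zero_fmonoid_def)

lemma free_lift_one [simp]: "free_lift \<rho> 1 = 1"
  using free_lift_const[of \<rho> 1] by (simp add: const_simps hom_one)

lemma free_lift_gen: "free_lift \<rho> (gen g) = \<rho> g"
  by (simp add: gen_def free_lift_single hom_one)

lemma free_lift_mult: "free_lift \<rho> (x * y) = free_lift \<rho> x * free_lift \<rho> y"
proof -
  have single: "free_lift \<rho> (Poly_Mapping.single v a * Poly_Mapping.single w b) =
    free_lift \<rho> (Poly_Mapping.single v a) * free_lift \<rho> (Poly_Mapping.single w b)" for v w a b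
    by (simp add: mult_single free_lift_single plus_fmonoid_def hom_mult mult.assoc)
       (metis central mult.assoc)
  have "free_lift \<rho> (x * y) =
    (\<Sum>v\<in>Poly_Mapping.keys x. \<Sum>w\<in>Poly_Mapping.keys y.
       free_lift \<rho> (Poly_Mapping.single v (Poly_Mapping.lookup x v)) *
       free_lift \<rho> (Poly_Mapping.single w (Poly_Mapping.lookup y w)))"
    by (subst poly_mapping_eq_sum_single[of x], subst poly_mapping_eq_sum_single[of y])
       (simp add: sum_product free_lift_sum single)
  also have "\<dots> = free_lift \<rho> x * free_lift \<rho> y"
    by (subst (3) poly_mapping_eq_sum_single[of x], subst (3) poly_mapping_eq_sum_single[of y])
       (simp add: sum_product free_lift_sum)
  finally show ?thesis .
qed

end

locale assoc_algebra = ring R for R :: "('f::field, 'a) module" (structure) +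
  assumes smult_closed [simp]: "x \<in> carrier R \<Longrightarrow> c \<odot> x \<in> carrier R"
    and smult_add_left: "x \<in> carrier R \<Longrightarrow> (b + c) \<odot> x = b \<odot> x \<oplus> c \<odot> x"
    and smult_add_right: "x \<in> carrier R \<Longrightarrow> y \<in> carrier R \<Longrightarrow> c \<odot> (x \<oplus> y) = c \<odot> x \<oplus> c \<odot> y"
    and smult_smult: "x \<in> carrier R \<Longrightarrow> b \<odot> (c \<odot> x) = (b * c) \<odot> x"
    and smult_one [simp]: "x \<in> carrier R \<Longrightarrow> 1 \<odot> x = x"
    and smult_mult_left: "x \<in> carrier R \<Longrightarrow> y \<in> carrier R \<Longrightarrow> (c \<odot> x) \<otimes> y = c \<odot> (x \<otimes> y)"
    and smult_mult_right: "x \<in> carrier R \<Longrightarrow> y \<in> carrier R \<Longrightarrow> x \<otimes> (c \<odot> y) = c \<odot> (x \<otimes> y)"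
begin

lemma smult_zero_left [simp]: "x \<in> carrier R \<Longrightarrow> 0 \<odot> x = \<zero>"
  using smult_add_left[of x 0 0] by (metis add.r_cancel_one smult_closed add_0)

lemma smult_minus_left: "x \<in> carrier R \<Longrightarrow> (- c) \<odot> x = \<ominus> (c \<odot> x)"
  using smult_add_left[of x "- c" c] by (intro minus_equality[symmetric]) auto

end

section \<open>Algebras presented by generators and relations\<close>

locale presentation =
  fixes G :: "'g set" and E :: "(('g, 'f::field) free_algebra \<times> ('g, 'f) free_algebra) set"
  assumes rels_closed: "(l, r) \<in> E \<Longrightarrow> l \<in> carrier (free_alg G) \<and> r \<in> carrier (free_alg G)"
begin

abbreviation "A \<equiv> free_alg G"
abbreviation "J \<equiv> rel_ideal G E"
abbreviation "Q \<equiv> presented G E"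
abbreviation "cl \<equiv> pclass G E"

lemma ideal_rel_ideal: "ideal J A"
proof -
  interpret ring A by (rule ring_free_alg)
  show ?thesis unfolding rel_ideal_def
    by (rule genideal_ideal) (use rels_closed in auto)
qed

sublocale rel: ideal J A
  by (rule ideal_rel_ideal)

lemma rel_ideal_closed:
  "x \<in> J \<Longrightarrow> x \<in> carrier A" "0 \<in> J" "x \<in> J \<Longrightarrow> y \<in> J \<Longrightarrow> x + y \<in> J"
  "x \<in> J \<Longrightarrow> - x \<in> J" "x \<in> J \<Longrightarrow> y \<in> J \<Longrightarrow> x - y \<in> J"
  "a \<in> carrier A \<Longrightarrow> x \<in> J \<Longrightarrow> a * x \<in> J" "a \<in> carrier A \<Longrightarrow> x \<in> J \<Longrightarrow> x * a \<in> J"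
proof -
  show x: "x \<in> J \<Longrightarrow> x \<in> carrier A" for x by (rule rel.a_Hcarr)
  show "0 \<in> J" using additive_subgroup.zero_closed[OF rel.is_additive_subgroup] by simp
  show a: "x \<in> J \<Longrightarrow> y \<in> J \<Longrightarrow> x + y \<in> J" for x y using additive_subgroup.a_closed[OF rel.is_additive_subgroup, of x y] by simp
  show m: "x \<in> J \<Longrightarrow> - x \<in> J" for x using rel.I_l_closed[of x "- 1"] by simp
  show "x \<in> J \<Longrightarrow> y \<in> J \<Longrightarrow> x - y \<in> J" using a[of x "- y"] m[of y] by simp
  show "a \<in> carrier A \<Longrightarrow> x \<in> J \<Longrightarrow> a * x \<in> J" using rel.I_l_closed[of x a] by simp
  show "a \<in> carrier A \<Longrightarrow> x \<in> J \<Longrightarrow> x * a \<in> J" using rel.I_r_closed[of x a] by simp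
qed

lemma rel_ideal_sum_closed: "(\<And>i. i \<in> S \<Longrightarrow> f i \<in> J) \<Longrightarrow> sum f S \<in> J"
  by (induction S rule: infinite_finite_induct) (auto simp: rel_ideal_closed)

lemma rels_in_ideal: "(l, r) \<in> E \<Longrightarrow> l - r \<in> J"
  unfolding rel_ideal_def by (rule subsetD[OF ring.genideal_self]) (use rels_closed ring_free_alg in auto)

text \<open>The elements of the carrier with property P form a two-sided ideal containing every l -
  r, and \<open>rel_ideal\<close> is the least such ideal. It serves to show that a map defined on
  the free algebra sends one relation ideal into another.\<close>

lemma rel_ideal_induct [consumes 1, case_names rel zero add minus mult_left mult_right]:
  assumes "x \<in> J" and rel: "\<And>l r. (l, r) \<in> E \<Longrightarrow> P (l - r)"
    and zero: "P 0" and add: "\<And>x y. P x \<Longrightarrow> P y \<Longrightarrow> P (x + y)" and minus: "\<And>x. P x \<Longrightarrow> P (- x)"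
    and left: "\<And>a x. a \<in> carrier A \<Longrightarrow> x \<in> carrier A \<Longrightarrow> P x \<Longrightarrow> P (a * x)"
    and right: "\<And>a x. a \<in> carrier A \<Longrightarrow> x \<in> carrier A \<Longrightarrow> P x \<Longrightarrow> P (x * a)"
  shows "P x"
proof -
  interpret ring A by (rule ring_free_alg)
  have "ideal {x \<in> carrier A. P x} A"
  proof (rule idealI[OF ring_free_alg])
    show "subgroup {x \<in> carrier A. P x} (add_monoid A)"
    proof (rule add.subgroupI)
      fix x assume "x \<in> {x \<in> carrier A. P x}"
      then show "\<ominus>\<^bsub>A\<^esub> x \<in> {x \<in> carrier A. P x}"
        using minus by simp
    qed (use zero add in auto)
  qed (use left right in auto)
  then have "J \<subseteq> {x \<in> carrier A. P x}"
    unfolding rel_ideal_def using rel rels_closed by (intro genideal_minimal) auto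
  then show ?thesis using assms(1) by auto
qed

lemma presented_simps:
  "carrier Q = cl ` carrier A" "\<one>\<^bsub>Q\<^esub> = cl 1" "c \<odot>\<^bsub>Q\<^esub> x = cl (const c) \<otimes>\<^bsub>Q\<^esub> x"
  by (auto simp: presented_def FactRing_def A_RCOSETS_def' a_r_coset_def pclass_def Let_def)

lemma cl_zero: "cl 0 = \<zero>\<^bsub>Q\<^esub>"
  using rel.a_rcos_const[of 0] rel_ideal_closed(2)
  by (simp add: presented_def FactRing_def pclass_def Let_def)

lemma cl_add:
  "x \<in> carrier A \<Longrightarrow> y \<in> carrier A \<Longrightarrow> cl (x + y) = cl x \<oplus>\<^bsub>Q\<^esub> cl y"
  using rel.a_rcos_sum[of x y] by (simp add: presented_def FactRing_def pclass_def Let_def)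

lemma cl_mult:
  "x \<in> carrier A \<Longrightarrow> y \<in> carrier A \<Longrightarrow> cl (x * y) = cl x \<otimes>\<^bsub>Q\<^esub> cl y"
  using rel.rcoset_mult_add[of x y] by (simp add: presented_def FactRing_def pclass_def Let_def)

lemma cl_eq_iff:
  assumes "x \<in> carrier A" "y \<in> carrier A"
  shows "cl x = cl y \<longleftrightarrow> x - y \<in> J"
  using rel.quotient_eq_iff_same_a_r_cos[OF ideal_rel_ideal assms] assms
  by (simp add: pclass_def)

lemma cl_rel: "(l, r) \<in> E \<Longrightarrow> cl l = cl r"
  using rels_closed rels_in_ideal cl_eq_iff by blast

lemma cl_closed [simp]: "x \<in> carrier A \<Longrightarrow> cl x \<in> carrier Q"
  by (simp add: presented_simps)

lemma ring_presented: "ring Q"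
proof -
  interpret F: ring "A Quot J" by (rule rel.quotient_is_ring)
  show ?thesis
  proof (intro ringI abelian_groupI monoidI)
    fix x assume "x \<in> carrier Q"
    then show "\<exists>y\<in>carrier Q. y \<oplus>\<^bsub>Q\<^esub> x = \<zero>\<^bsub>Q\<^esub>"
      using F.l_neg[of x] F.a_inv_closed[of x] by (auto simp: presented_def Let_def)
  qed (simp_all add: presented_def Let_def F.m_assoc F.a_ac F.l_distr F.r_distr)
qed

lemma smult_cl: "x \<in> carrier A \<Longrightarrow> c \<odot>\<^bsub>Q\<^esub> cl x = cl (const c * x)"
  by (simp add: presented_simps cl_mult)

lemma assoc_algebra_presented: "assoc_algebra Q"
proof -
  interpret ring Q by (rule ring_presented)
  show ?thesis
  proof
    fix x y b c
    assume x: "x \<in> carrier Q"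
    then obtain x' where x': "x = cl x'" "x' \<in> carrier A" by (auto simp: presented_simps)
    show "c \<odot>\<^bsub>Q\<^esub> x \<in> carrier Q"
      using x by (simp add: presented_simps(3))
    show "(b + c) \<odot>\<^bsub>Q\<^esub> x = b \<odot>\<^bsub>Q\<^esub> x \<oplus>\<^bsub>Q\<^esub> c \<odot>\<^bsub>Q\<^esub> x"
      using x by (simp add: presented_simps(3) const_simps cl_add l_distr)
    show "b \<odot>\<^bsub>Q\<^esub> (c \<odot>\<^bsub>Q\<^esub> x) = (b * c) \<odot>\<^bsub>Q\<^esub> x"
      using x by (simp add: presented_simps(3) const_simps cl_mult m_assoc)
    show "1 \<odot>\<^bsub>Q\<^esub> x = x"
      using x by (simp add: presented_simps(3) const_simps presented_simps(2)[symmetric])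
    assume y: "y \<in> carrier Q"
    then obtain y' where y': "y = cl y'" "y' \<in> carrier A" by (auto simp: presented_simps)
    show "c \<odot>\<^bsub>Q\<^esub> (x \<oplus>\<^bsub>Q\<^esub> y) = c \<odot>\<^bsub>Q\<^esub> x \<oplus>\<^bsub>Q\<^esub> c \<odot>\<^bsub>Q\<^esub> y"
      using x y by (simp add: presented_simps(3) r_distr)
    show "(c \<odot>\<^bsub>Q\<^esub> x) \<otimes>\<^bsub>Q\<^esub> y = c \<odot>\<^bsub>Q\<^esub> (x \<otimes>\<^bsub>Q\<^esub> y)"
      using x y by (simp add: presented_simps(3) m_assoc)
    have "x' * (const c * y') = const c * (x' * y')"
      by (metis const_central mult.assoc)
    then show "x \<otimes>\<^bsub>Q\<^esub> (c \<odot>\<^bsub>Q\<^esub> y) = c \<odot>\<^bsub>Q\<^esub> (x \<otimes>\<^bsub>Q\<^esub> y)"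
      using x' y' by (simp add: smult_cl cl_mult[symmetric])
  qed
qed

sublocale assoc_algebra Q
  by (rule assoc_algebra_presented)

lemma cl_diff: "x \<in> carrier A \<Longrightarrow> y \<in> carrier A \<Longrightarrow> cl (x - y) = cl x \<ominus>\<^bsub>Q\<^esub> cl y"
  using cl_add[of "x - y" y]
  by (metis add.inv_solve_right cl_closed diff_add_cancel free_alg_diff_closed a_minus_def)

lemma cl_sum:
  assumes "finite S" "\<And>i. i \<in> S \<Longrightarrow> f i \<in> carrier A"
  shows "cl (sum f S) = (\<Oplus>\<^bsub>Q\<^esub>i\<in>S. cl (f i))"
  using assms by (induction S rule: finite_induct) (simp_all add: cl_zero cl_add Pi_def)

text \<open>Generators and scalars suffice because every class has a representative that is a sum of
  scaled words. This is how two homomorphisms out of a presented algebra are compared.\<close>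

lemma presented_induct [consumes 1, case_names scalar gen add mult]:
  assumes "x \<in> carrier Q"
    and "\<And>c. P (c \<odot>\<^bsub>Q\<^esub> \<one>\<^bsub>Q\<^esub>)" and "\<And>g. g \<in> G \<Longrightarrow> P (cl (gen g))"
    and "\<And>x y. x \<in> carrier Q \<Longrightarrow> y \<in> carrier Q \<Longrightarrow> P x \<Longrightarrow> P y \<Longrightarrow> P (x \<oplus>\<^bsub>Q\<^esub> y)"
    and "\<And>x y. x \<in> carrier Q \<Longrightarrow> y \<in> carrier Q \<Longrightarrow> P x \<Longrightarrow> P y \<Longrightarrow> P (x \<otimes>\<^bsub>Q\<^esub> y)"
  shows "P x"
proof -
  obtain x' where x': "x = cl x'" "x' \<in> carrier A" using assms(1) by (auto simp: presented_simps)
  have "P (cl x')" using x'(2)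
  proof (induction rule: free_alg_induct)
    case (const c)
    then show ?case using assms(2)[of c] by (simp add: presented_simps(2) smult_cl)
  qed (simp_all add: assms cl_add cl_mult)
  then show ?thesis using x' by simp
qed

end

section \<open>The blocks of the quiver Hecke algebra\<close>

lemma qh_rels_cases [consumes 1, case_names unit orthogonal dot_idem crossing_idem dots crossing_dot
    crossings crossing_dot_right dot_crossing_right quadratic braid cyclotomic]:
  assumes "(l, r) \<in> qh_rels q \<zeta> n \<Lambda> \<alpha>"
  obtains "l = (\<Sum>k\<in>tuples q \<zeta> n \<alpha>. gen (QE k))" "r = 1"
  | k k' where "k \<in> tuples q \<zeta> n \<alpha>" "k' \<in> tuples q \<zeta> n \<alpha>"
      "l = gen (QE k) * gen (QE k')" "r = (if k = k' then gen (QE k) else 0)"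
  | a k where "1 \<le> a" "a \<le> n" "k \<in> tuples q \<zeta> n \<alpha>"
      "l = gen (QY a) * gen (QE k)" "r = gen (QE k) * gen (QY a)"
  | a k where "1 \<le> a" "a < n" "k \<in> tuples q \<zeta> n \<alpha>"
      "l = gen (QPsi a) * gen (QE k)" "r = gen (QE (swap_at a k)) * gen (QPsi a)"
  | a b where "1 \<le> a" "a \<le> n" "1 \<le> b" "b \<le> n"
      "l = gen (QY a) * gen (QY b)" "r = gen (QY b) * gen (QY a)"
  | a b where "1 \<le> a" "a < n" "1 \<le> b" "b \<le> n" "b \<noteq> a" "b \<noteq> a + 1"
      "l = gen (QPsi a) * gen (QY b)" "r = gen (QY b) * gen (QPsi a)"
  | a b where "1 \<le> a" "a < n" "1 \<le> b" "b < n" "\<bar>int a - int b\<bar> > 1"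
      "l = gen (QPsi a) * gen (QPsi b)" "r = gen (QPsi b) * gen (QPsi a)"
  | a k where "1 \<le> a" "a < n" "k \<in> tuples q \<zeta> n \<alpha>"
      "l = gen (QPsi a) * gen (QY (a + 1)) * gen (QE k)"
      "r = (gen (QY a) * gen (QPsi a) + (if k a = k (a + 1) then 1 else 0)) * gen (QE k)"
  | a k where "1 \<le> a" "a < n" "k \<in> tuples q \<zeta> n \<alpha>"
      "l = gen (QY (a + 1)) * gen (QPsi a) * gen (QE k)"
      "r = (gen (QPsi a) * gen (QY a) + (if k a = k (a + 1) then 1 else 0)) * gen (QE k)"
  | a k where "1 \<le> a" "a < n" "k \<in> tuples q \<zeta> n \<alpha>"
      "l = gen (QPsi a) ^ 2 * gen (QE k)" "r = psi_square q \<zeta> a k * gen (QE k)"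
  | a k where "1 \<le> a" "a + 1 < n" "k \<in> tuples q \<zeta> n \<alpha>"
      "l = gen (QPsi (a + 1)) * gen (QPsi a) * gen (QPsi (a + 1)) * gen (QE k)"
      "r = (gen (QPsi a) * gen (QPsi (a + 1)) * gen (QPsi a) + braid_error q \<zeta> a k) * gen (QE k)"
  | k where "k \<in> tuples q \<zeta> n \<alpha>" "l = gen (QY 1) ^ \<Lambda> (fst (k 1)) * gen (QE k)" "r = 0"
  using assms unfolding qh_rels_def Let_def Un_iff mem_Collect_eq singleton_iff prod.inject
  by (elim disjE exE conjE) (rule that; assumption)+

text \<open>The twelve parts stand in the order of the cases of \<open>qh_rels_cases\<close>; later
  references by number follow this order.\<close>

lemma qh_rels_intros:
  fixes q \<zeta> \<Lambda> n \<alpha>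
  defines "K \<equiv> tuples q \<zeta> n \<alpha>" and "E \<equiv> qh_rels q \<zeta> n \<Lambda> \<alpha>"
  shows "((\<Sum>k\<in>K. gen (QE k)), 1) \<in> E"
    "k \<in> K \<Longrightarrow> k' \<in> K \<Longrightarrow> (gen (QE k) * gen (QE k'), if k = k' then gen (QE k) else 0) \<in> E"
    "1 \<le> a \<Longrightarrow> a \<le> n \<Longrightarrow> k \<in> K \<Longrightarrow> (gen (QY a) * gen (QE k), gen (QE k) * gen (QY a)) \<in> E"
    "1 \<le> a \<Longrightarrow> a < n \<Longrightarrow> k \<in> K \<Longrightarrow>
       (gen (QPsi a) * gen (QE k), gen (QE (swap_at a k)) * gen (QPsi a)) \<in> E"
    "1 \<le> a \<Longrightarrow> a \<le> n \<Longrightarrow> 1 \<le> b \<Longrightarrow> b \<le> n \<Longrightarrow>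
       (gen (QY a) * gen (QY b), gen (QY b) * gen (QY a)) \<in> E"
    "1 \<le> a \<Longrightarrow> a < n \<Longrightarrow> 1 \<le> b \<Longrightarrow> b \<le> n \<Longrightarrow> b \<noteq> a \<Longrightarrow> b \<noteq> a + 1 \<Longrightarrow>
       (gen (QPsi a) * gen (QY b), gen (QY b) * gen (QPsi a)) \<in> E"
    "1 \<le> a \<Longrightarrow> a < n \<Longrightarrow> 1 \<le> b \<Longrightarrow> b < n \<Longrightarrow> \<bar>int a - int b\<bar> > 1 \<Longrightarrow>
       (gen (QPsi a) * gen (QPsi b), gen (QPsi b) * gen (QPsi a)) \<in> E"
    "1 \<le> a \<Longrightarrow> a < n \<Longrightarrow> k \<in> K \<Longrightarrow>
       (gen (QPsi a) * gen (QY (a + 1)) * gen (QE k),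
        (gen (QY a) * gen (QPsi a) + (if k a = k (a + 1) then 1 else 0)) * gen (QE k)) \<in> E"
    "1 \<le> a \<Longrightarrow> a < n \<Longrightarrow> k \<in> K \<Longrightarrow>
       (gen (QY (a + 1)) * gen (QPsi a) * gen (QE k),
        (gen (QPsi a) * gen (QY a) + (if k a = k (a + 1) then 1 else 0)) * gen (QE k)) \<in> E"
    "1 \<le> a \<Longrightarrow> a < n \<Longrightarrow> k \<in> K \<Longrightarrow>
       (gen (QPsi a) ^ 2 * gen (QE k), psi_square q \<zeta> a k * gen (QE k)) \<in> E"
    "1 \<le> a \<Longrightarrow> a + 1 < n \<Longrightarrow> k \<in> K \<Longrightarrow>
       (gen (QPsi (a + 1)) * gen (QPsi a) * gen (QPsi (a + 1)) * gen (QE k),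
        (gen (QPsi a) * gen (QPsi (a + 1)) * gen (QPsi a) + braid_error q \<zeta> a k) * gen (QE k)) \<in> E"
    "k \<in> K \<Longrightarrow> (gen (QY 1) ^ \<Lambda> (fst (k 1)) * gen (QE k), 0) \<in> E"
  unfolding K_def E_def qh_rels_def Let_def
  by (rule singletonI
      | rule UnI2, rule CollectI, (rule exI)+, intro conjI, rule refl, assumption+
      | rule UnI1)+

lemma tuplesD: "k \<in> tuples q \<zeta> n \<alpha> \<Longrightarrow> a \<in> {1..n} \<Longrightarrow> k a \<in> vertices q \<zeta>"
  by (auto simp: tuples_def PiE_def)

lemma swap_at_swap_at [simp]: "swap_at a (swap_at a k) = k"
  by (auto simp: swap_at_def fun_eq_iff)

text \<open>Exchanging two places keeps all multiplicities, so the idempotent e(s_a k) in the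
  relation for \<psi>_a e(k) belongs to the same block.\<close>

lemma swap_at_tuples:
  assumes "k \<in> tuples q \<zeta> n \<alpha>" "1 \<le> a" "a < n"
  shows "swap_at a k \<in> tuples q \<zeta> n \<alpha>"
proof -
  let ?t = "transpose a (a + 1)"
  have t: "?t i \<in> {1..n} \<longleftrightarrow> i \<in> {1..n}" for i
    using assms by (auto simp: transpose_def)
  have "card {b \<in> {1..n}. swap_at a k b = v} = card {b \<in> {1..n}. k b = v}" for v
  proof -
    have "{b \<in> {1..n}. swap_at a k b = v} = ?t ` {b \<in> {1..n}. k b = v}"
    proof (intro subset_antisym subsetI)
      fix b assume "b \<in> {b \<in> {1..n}. swap_at a k b = v}"
      then have "?t b \<in> {b \<in> {1..n}. k b = v}"
        using t[of b] by (simp add: swap_at_def)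
      then show "b \<in> ?t ` {b \<in> {1..n}. k b = v}"
        by (intro image_eqI[of _ _ "?t b"]) simp_all
    next
      fix b assume "b \<in> ?t ` {b \<in> {1..n}. k b = v}"
      then obtain b' where "b = ?t b'" "b' \<in> {1..n}" "k b' = v" by blast
      then show "b \<in> {b \<in> {1..n}. swap_at a k b = v}"
        using t[of b'] by (simp add: swap_at_def)
    qed
    then show ?thesis by (simp add: card_image)
  qed
  moreover have "swap_at a k \<in> {1..n} \<rightarrow>\<^sub>E vertices q \<zeta>"
  proof (rule PiE_I)
    fix i assume "i \<in> {1..n}"
    then show "swap_at a k i \<in> vertices q \<zeta>"
      using assms t[of i] by (auto simp: swap_at_def intro!: tuplesD)
  next
    fix i assume "i \<notin> {1..n}"
    \<comment> \<open>Outside {1..n} a tuple has the value \<open>undefined\<close>, and the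
      transposition of two places inside leaves these places alone.\<close>
    then have "i \<notin> {1..n}" "i \<noteq> a" "i \<noteq> a + 1"
      using assms by auto
    then show "swap_at a k i = undefined"
      using assms(1) by (auto simp: swap_at_def tuples_def PiE_def extensional_def)
  qed
  ultimately show ?thesis
    using assms(1) by (simp add: tuples_def)
qed

text \<open>For q of infinite order there are infinitely many vertices, but the entries of a tuple
  all lie in the finite support of \<alpha>.\<close>

lemma finite_tuples:
  assumes "\<alpha> \<in> compositions q \<zeta> n"
  shows "finite (tuples q \<zeta> n \<alpha>)"
proof (rule finite_subset)
  show "tuples q \<zeta> n \<alpha> \<subseteq> {1..n} \<rightarrow>\<^sub>E {v. \<alpha> v \<noteq> 0}"
  proof
    fix k assume k: "k \<in> tuples q \<zeta> n \<alpha>"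
    have "\<alpha> (k a) \<noteq> 0" if a: "a \<in> {1..n}" for a
    proof -
      have "a \<in> {b \<in> {1..n}. k b = k a}" using a by simp
      then have "card {b \<in> {1..n}. k b = k a} \<noteq> 0" by (subst card_eq_0_iff) auto
      moreover have "card {b \<in> {1..n}. k b = k a} = \<alpha> (k a)"
        using k tuplesD[OF k a] unfolding tuples_def mem_Collect_eq by blast
      ultimately show ?thesis by metis
    qed
    then show "k \<in> {1..n} \<rightarrow>\<^sub>E {v. \<alpha> v \<noteq> 0}" using k by (auto simp: tuples_def PiE_def)
  qed
  show "finite ({1..n} \<rightarrow>\<^sub>E {v. \<alpha> v \<noteq> 0})"
    using assms by (intro finite_PiE) (auto simp: compositions_def)
qed

locale qh_data =
  fixes q \<zeta> :: "'f::field" and n :: nat and \<Lambda> :: "int \<Rightarrow> nat" and \<alpha> :: "vertex \<Rightarrow> nat"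
  assumes comp: "\<alpha> \<in> compositions q \<zeta> n" and n_pos: "n \<ge> 1"
    and q: "q \<noteq> 0" "q \<noteq> 1" and \<zeta>: "\<zeta> \<noteq> 0"
begin

abbreviation "K \<equiv> tuples q \<zeta> n \<alpha>"

sublocale presentation "qh_gens q \<zeta> n \<alpha>" "qh_rels q \<zeta> n \<Lambda> \<alpha>"
proof
  fix l r assume "(l, r) \<in> qh_rels q \<zeta> n \<Lambda> \<alpha>"
  then show "l \<in> carrier (free_alg (qh_gens q \<zeta> n \<alpha>)) \<and> r \<in> carrier (free_alg (qh_gens q \<zeta> n \<alpha>))"
    by (cases rule: qh_rels_cases)
       (use n_pos in \<open>auto simp: qh_gens_def swap_at_tuples psi_square_def braid_error_def Let_def\<close>)
qed

lemma finite_K [simp]: "finite K"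
  by (rule finite_tuples[OF comp])

text \<open>
  The grading is read off from the homomorphism \<open>\<Delta>\<close> into Laurent polynomials which multiplies
  elements of degree \<open>m\<close> by \<open>t\<^sup>m\<close>.  As \<open>\<psi>\<^sub>a\<close> itself is not homogeneous, it is first split
  into the elements \<open>\<psi>\<^sub>a e(k)\<close>.
\<close>

abbreviation "lau \<equiv> (\<lambda>m x. Poly_Mapping.single m x :: int \<Rightarrow>\<^sub>0 (qgen, 'f) free_algebra)"

lemma poly_mapping_single_central:
  assumes "\<And>y. x * y = y * x"
  shows "Poly_Mapping.single 0 x * X = X * (Poly_Mapping.single 0 x :: int \<Rightarrow>\<^sub>0 (qgen, 'f) free_algebra)"
  by (subst (1 2) poly_mapping_eq_sum_single[of X])
     (simp add: sum_distrib_left sum_distrib_right mult_single assms)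

sublocale graded: central_hom "\<lambda>c. lau 0 (const c)"
proof
  show "lau 0 (const c) * X = X * lau 0 (const c)" for c X
    by (rule poly_mapping_single_central) (rule const_central)
qed (simp_all add: const_simps single_add mult_single)

definition grade_gen :: "qgen \<Rightarrow> int \<Rightarrow>\<^sub>0 (qgen, 'f) free_algebra" where
  "grade_gen g = (case g of
     QE k \<Rightarrow> lau 0 (gen (QE k))
   | QY a \<Rightarrow> lau 2 (gen (QY a))
   | QPsi a \<Rightarrow> (\<Sum>k\<in>K. lau (psi_degree q \<zeta> (k a) (k (a + 1))) (gen (QPsi a) * gen (QE k))))"

definition \<Delta> :: "(qgen, 'f) free_algebra \<Rightarrow> int \<Rightarrow>\<^sub>0 (qgen, 'f) free_algebra" where
  "\<Delta> = graded.free_lift grade_gen"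

definition U :: "(int \<Rightarrow>\<^sub>0 (qgen, 'f) free_algebra) set" where
  "U = {X. \<forall>m. Poly_Mapping.lookup X m \<in> carrier A}"

text \<open>Laurent polynomials over the quotient cannot be formed as a type, since the quotient is
  a carrier of cosets. Congruence modulo \<open>JJ\<close> inside \<open>U\<close> takes their
  place.\<close>

definition JJ :: "(int \<Rightarrow>\<^sub>0 (qgen, 'f) free_algebra) set" where
  "JJ = {X. \<forall>m. Poly_Mapping.lookup X m \<in> J}"

lemma JJ_closed:
  "0 \<in> JJ" "X \<in> JJ \<Longrightarrow> Y \<in> JJ \<Longrightarrow> X + Y \<in> JJ" "X \<in> JJ \<Longrightarrow> - X \<in> JJ"
  "X \<in> JJ \<Longrightarrow> Y \<in> JJ \<Longrightarrow> X - Y \<in> JJ" "(\<And>i. i \<in> S \<Longrightarrow> F i \<in> JJ) \<Longrightarrow> sum F S \<in> JJ"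
  by (auto simp: JJ_def lookup_add lookup_minus lookup_sum rel_ideal_closed rel_ideal_sum_closed)

lemma lau_JJ [simp]: "lau m x \<in> JJ \<longleftrightarrow> x \<in> J"
  by (auto simp: JJ_def lookup_single when_def rel_ideal_closed split: if_splits)

lemma lau_U [simp]: "lau m x \<in> U \<longleftrightarrow> x \<in> carrier A"
  by (auto simp: U_def lookup_single when_def split: if_splits)

lemma U_closed:
  "0 \<in> U" "X \<in> U \<Longrightarrow> Y \<in> U \<Longrightarrow> X + Y \<in> U" "(\<And>i. i \<in> S \<Longrightarrow> F i \<in> U) \<Longrightarrow> sum F S \<in> U"
  by (auto simp: U_def lookup_add lookup_sum)

lemma mult_eq_sum:
  fixes X Y :: "int \<Rightarrow>\<^sub>0 (qgen, 'f) free_algebra"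
  shows "X * Y = (\<Sum>m\<in>Poly_Mapping.keys X. \<Sum>m'\<in>Poly_Mapping.keys Y.
    lau (m + m') (Poly_Mapping.lookup X m * Poly_Mapping.lookup Y m'))"
  by (subst poly_mapping_eq_sum_single[of X], subst poly_mapping_eq_sum_single[of Y])
     (simp add: sum_product mult_single)

lemma mult_closed:
  assumes "X \<in> U"
  shows "Y \<in> U \<Longrightarrow> X * Y \<in> U" "Y \<in> JJ \<Longrightarrow> X * Y \<in> JJ" "Y \<in> JJ \<Longrightarrow> Y * X \<in> JJ"
proof -
  have X: "Poly_Mapping.lookup X m \<in> carrier A" for m
    using assms by (simp add: U_def)
  show "X * Y \<in> U" if "Y \<in> U"
    unfolding mult_eq_sum[of X] using X that[unfolded U_def] by (intro U_closed) simp
  show "X * Y \<in> JJ" if "Y \<in> JJ"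
    unfolding mult_eq_sum[of X] using X that[unfolded JJ_def]
    by (intro JJ_closed) (simp add: rel_ideal_closed)
  show "Y * X \<in> JJ" if "Y \<in> JJ"
    unfolding mult_eq_sum[of Y] using X that[unfolded JJ_def]
    by (intro JJ_closed) (simp add: rel_ideal_closed)
qed

lemma qh_gens_simps [simp]:
  "QE k \<in> qh_gens q \<zeta> n \<alpha> \<longleftrightarrow> k \<in> K" "QY a \<in> qh_gens q \<zeta> n \<alpha> \<longleftrightarrow> a \<in> {1..n}"
  "QPsi a \<in> qh_gens q \<zeta> n \<alpha> \<longleftrightarrow> a \<in> {1..<n}"
  by (auto simp: qh_gens_def)

lemma \<Delta>_simps:
  "\<Delta> (x + y) = \<Delta> x + \<Delta> y" "\<Delta> (x - y) = \<Delta> x - \<Delta> y" "\<Delta> (x * y) = \<Delta> x * \<Delta> y"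
  "\<Delta> 0 = 0" "\<Delta> 1 = 1" "\<Delta> (sum f S) = (\<Sum>i\<in>S. \<Delta> (f i))" "\<Delta> (const c) = lau 0 (const c)"
  "\<Delta> (gen (QE k)) = lau 0 (gen (QE k))" "\<Delta> (gen (QY a)) = lau 2 (gen (QY a))"
  "\<Delta> (gen (QPsi a)) = (\<Sum>k\<in>K. lau (psi_degree q \<zeta> (k a) (k (a + 1))) (gen (QPsi a) * gen (QE k)))"
  by (simp_all add: \<Delta>_def graded.free_lift_add graded.free_lift_diff graded.free_lift_mult
      graded.free_lift_sum graded.free_lift_const graded.free_lift_gen grade_gen_def)

lemma \<Delta>_closed [simp]: "x \<in> carrier A \<Longrightarrow> \<Delta> x \<in> U"
proof (induction rule: free_alg_induct)
  case (gen g)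
  then show ?case
    by (auto simp: qh_gens_def \<Delta>_simps intro!: U_closed)
qed (auto simp: \<Delta>_simps U_closed mult_closed)

text \<open>
  Modulo the relations, \<open>x\<close> maps the part at \<open>k\<close> to the part at \<open>k'\<close> and raises degrees by \<open>m\<close>.
\<close>
definition steps :: "(qgen, 'f) free_algebra \<Rightarrow> vtuple \<Rightarrow> int \<Rightarrow> vtuple \<Rightarrow> bool" where
  "steps x k m k' \<longleftrightarrow> x \<in> carrier A \<and> k \<in> K \<and> k' \<in> K \<and>
     \<Delta> x * lau 0 (gen (QE k)) - lau m (x * gen (QE k)) \<in> JJ \<and>
     x * gen (QE k) - gen (QE k') * x \<in> J"

lemma steps_mult:
  assumes "steps x k m k'" "steps y k' m' k''"
  shows "steps (y * x) k (m + m') k''"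
proof -
  let ?e = "\<lambda>k. gen (QE k)" and ?E = "\<lambda>k. lau 0 (gen (QE k))"
  note xy = assms[unfolded steps_def]
  \<comment> \<open>The four terms are the errors in the chain, with t^m for \<open>lau m\<close>:
    \<Delta>(y x) e_k, then \<Delta>(y) t^m x e_k, then \<Delta>(y) e_k' t^m x, then t^(m+m') y e_k'
    x, then t^(m+m') y x e_k.\<close>
  have "\<Delta> y * (\<Delta> x * ?E k - lau m (x * ?e k)) \<in> JJ" "\<Delta> y * lau m (x * ?e k - ?e k' * x) \<in> JJ"
    "(\<Delta> y * ?E k' - lau m' (y * ?e k')) * lau m x \<in> JJ" "lau (m + m') (y * (x * ?e k - ?e k' * x)) \<in> JJ"
    using xy by (auto intro: mult_closed rel_ideal_closed)
  then have "\<Delta> y * (\<Delta> x * ?E k - lau m (x * ?e k)) + \<Delta> y * lau m (x * ?e k - ?e k' * x)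
      + (\<Delta> y * ?E k' - lau m' (y * ?e k')) * lau m x - lau (m + m') (y * (x * ?e k - ?e k' * x)) \<in> JJ"
    by (intro JJ_closed)
  moreover have "\<Delta> y * (\<Delta> x * ?E k - lau m (x * ?e k)) + \<Delta> y * lau m (x * ?e k - ?e k' * x)
      + (\<Delta> y * ?E k' - lau m' (y * ?e k')) * lau m x - lau (m + m') (y * (x * ?e k - ?e k' * x))
     = \<Delta> (y * x) * ?E k - lau (m + m') (y * x * ?e k)"
  proof -
    have "\<Delta> y * ?E k' * lau m x = \<Delta> y * lau m (?e k' * x)"
      and "lau m' (y * ?e k') * lau m x = lau (m + m') (y * ?e k' * x)"
      by (simp_all add: mult_single mult.assoc add.commute)
    then show ?thesis
      by (simp add: \<Delta>_simps(3) left_diff_distrib right_diff_distrib single_diff mult.assoc)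
  qed
  moreover have "y * (x * ?e k - ?e k' * x) + (y * ?e k' - ?e k'' * y) * x \<in> J"
    using xy by (auto intro: rel_ideal_closed)
  moreover have "y * (x * ?e k - ?e k' * x) + (y * ?e k' - ?e k'' * y) * x = y * x * ?e k - ?e k'' * (y * x)"
    by (simp add: left_diff_distrib right_diff_distrib mult.assoc)
  ultimately show ?thesis
    using xy unfolding steps_def by (metis free_alg_mult_closed)
qed

lemma steps_add:
  assumes "steps x k m k'" "steps y k m k'"
  shows "steps (x + y) k m k'"
proof -
  note xy = assms[unfolded steps_def]
  show ?thesis
    using xy JJ_closed(2)[of "\<Delta> x * lau 0 (gen (QE k)) - lau m (x * gen (QE k))"
        "\<Delta> y * lau 0 (gen (QE k)) - lau m (y * gen (QE k))"]
      rel_ideal_closed(3)[of "x * gen (QE k) - gen (QE k') * x" "y * gen (QE k) - gen (QE k') * y"]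
    by (simp add: steps_def \<Delta>_simps algebra_simps single_add)
qed

lemma steps_zero: "k \<in> K \<Longrightarrow> k' \<in> K \<Longrightarrow> steps 0 k m k'"
  by (simp add: steps_def \<Delta>_simps JJ_closed rel_ideal_closed)

lemma steps_const: "k \<in> K \<Longrightarrow> steps (const c) k 0 k"
  by (simp add: steps_def \<Delta>_simps JJ_closed rel_ideal_closed mult_single const_central[of c "gen (QE k)"])

lemma steps_one: "k \<in> K \<Longrightarrow> steps 1 k 0 k"
  using steps_const[of k 1] by (simp add: const_simps)

lemma steps_diff:
  assumes "steps x k m k'" "steps y k m k'"
  shows "steps (x - y) k m k'"
proof -
  have "k' \<in> K" using assms by (simp add: steps_def)
  from steps_mult[OF assms(2) steps_const[OF this, of "- 1"]]
  have "steps (- y) k m k'" by (simp add: const_simps)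
  from steps_add[OF assms(1) this] show ?thesis by simp
qed

lemma steps_E:
  assumes "k \<in> K" "k0 \<in> K" shows "steps (gen (QE k0)) k 0 k"
proof -
  \<comment> \<open>The two Kronecker terms are equal to each other, so orthogonality alone makes
    the idempotents commute modulo \<open>J\<close>.\<close>
  have "gen (QE k0) * gen (QE k) - gen (QE k) * gen (QE k0) =
      (gen (QE k0) * gen (QE k) - (if k0 = k then gen (QE k0) else 0)) -
      (gen (QE k) * gen (QE k0) - (if k = k0 then gen (QE k) else 0))"
    by simp
  also have "\<dots> \<in> J"
    using assms by (intro rel_ideal_closed rels_in_ideal qh_rels_intros)
  finally show ?thesis using assms by (simp add: steps_def \<Delta>_simps JJ_closed mult_single)
qed

lemma steps_Y:
  assumes "k \<in> K" "a \<in> {1..n}" shows "steps (gen (QY a)) k 2 k"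
  using assms rels_in_ideal[OF qh_rels_intros(3)[of a n k q \<zeta> \<alpha> \<Lambda>]]
  by (simp add: steps_def \<Delta>_simps JJ_closed mult_single)

lemma E_orth: "k \<in> K \<Longrightarrow> k0 \<in> K \<Longrightarrow> gen (QE k) * gen (QE k0) - (if k = k0 then gen (QE k0) else 0) \<in> J"
  using rels_in_ideal[OF qh_rels_intros(2)[of k q \<zeta> n \<alpha> k0 \<Lambda>]] by (simp cong: if_cong)

text \<open>Multiplication by e(k) picks from the sum defining \<Delta> of \<psi>_a the one summand
  with index k, and with it the degree that \<psi>_a has at k; orthogonality kills the others modulo
  \<open>J\<close>.\<close>

lemma steps_Psi:
  assumes "k \<in> K" "a \<in> {1..<n}"
  shows "steps (gen (QPsi a)) k (psi_degree q \<zeta> (k a) (k (a + 1))) (swap_at a k)"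
proof -
  let ?d = "\<lambda>k. psi_degree q \<zeta> (k a) (k (a + 1))" and ?e = "\<lambda>k. gen (QE k)"
  have "\<Delta> (gen (QPsi a)) * lau 0 (?e k) - lau (?d k) (gen (QPsi a) * ?e k)
    = (\<Sum>k'\<in>K. lau (?d k') (gen (QPsi a) * (?e k' * ?e k - (if k' = k then ?e k else 0))))"
    using assms
    by (simp add: \<Delta>_simps sum_distrib_right mult_single right_diff_distrib single_diff sum_subtractf
        if_distrib[of "\<lambda>x. gen (QPsi a) * x"] if_distrib[of "\<lambda>x. lau _ x"] mult.assoc cong: if_cong)
  also have "\<dots> \<in> JJ"
    using assms E_orth[of _ k] by (intro JJ_closed) (simp add: rel_ideal_closed)
  finally show ?thesis
    using assms rels_in_ideal[OF qh_rels_intros(4)[of a n k q \<zeta> \<alpha> \<Lambda>]]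
    by (simp add: steps_def swap_at_tuples)
qed

lemma single_sum: "lau m (sum f S) = (\<Sum>i\<in>S. lau m (f i))"
  by (induction S rule: infinite_finite_induct) (auto simp: single_add)

text \<open>Both sides are multiplied by the same power of t, so the difference of the images is t^m
  times an element of the ideal, up to \<open>JJ\<close>.\<close>

lemma \<Delta>_rel_right:
  assumes "steps l k m k'" "steps r k m k''" "l * gen (QE k) - r * gen (QE k) \<in> J"
  shows "\<Delta> (l * gen (QE k)) - \<Delta> (r * gen (QE k)) \<in> JJ"
proof -
  let ?e = "gen (QE k)"
  have "(\<Delta> l * lau 0 ?e - lau m (l * ?e)) - (\<Delta> r * lau 0 ?e - lau m (r * ?e)) + lau m (l * ?e - r * ?e) \<in> JJ"
    using assms by (auto intro!: JJ_closed(2,4) simp: steps_def)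
  then show ?thesis by (simp add: \<Delta>_simps single_diff algebra_simps)
qed

text \<open>This is for relations stated without an idempotent on the right: they are cut into their
  parts at all k and reassembled by the relation that the sum of the e(k) is 1. The degree may
  depend on k.\<close>

lemma \<Delta>_rel_total:
  assumes "\<And>k. k \<in> K \<Longrightarrow> \<exists>m k' k''. steps l k m k' \<and> steps r k m k''" "l - r \<in> J"
    and lr: "l \<in> carrier A" "r \<in> carrier A"
  shows "\<Delta> l - \<Delta> r \<in> JJ"
proof -
  have "(l - r) * gen (QE k) \<in> J" if "k \<in> K" for k
    using assms(2) that by (auto intro: rel_ideal_closed)
  then have "\<Delta> (l * gen (QE k)) - \<Delta> (r * gen (QE k)) \<in> JJ" if "k \<in> K" for k
    using assms(1)[OF that] \<Delta>_rel_right that by (metis left_diff_distrib)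
  then have 1: "(\<Sum>k\<in>K. \<Delta> (l * gen (QE k)) - \<Delta> (r * gen (QE k))) \<in> JJ"
    by (intro JJ_closed(5))
  have 2: "(\<Delta> l - \<Delta> r) * lau 0 ((\<Sum>k\<in>K. gen (QE k)) - 1) \<in> JJ"
    using rels_in_ideal[OF qh_rels_intros(1)[of q \<zeta> n \<alpha> \<Lambda>]] lr
    by (intro mult_closed(2)) (auto simp flip: \<Delta>_simps(2))
  have 3: "(\<Sum>k\<in>K. \<Delta> (l * gen (QE k)) - \<Delta> (r * gen (QE k))) -
      (\<Delta> l - \<Delta> r) * lau 0 ((\<Sum>k\<in>K. gen (QE k)) - 1) = \<Delta> l - \<Delta> r"
  proof -
    have "lau 0 ((\<Sum>k\<in>K. gen (QE k)) - 1) = (\<Sum>k\<in>K. lau 0 (gen (QE k))) - 1"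
      by (simp add: single_diff single_sum)
    moreover have "(\<Sum>k\<in>K. \<Delta> (l * gen (QE k)) - \<Delta> (r * gen (QE k))) =
        (\<Delta> l - \<Delta> r) * (\<Sum>k\<in>K. lau 0 (gen (QE k)))"
      by (simp add: \<Delta>_simps(3,8) sum_distrib_left left_diff_distrib)
    ultimately show ?thesis
      by (simp add: right_diff_distrib)
  qed
  from JJ_closed(4)[OF 1 2] show ?thesis unfolding 3 .
qed

lemma psi_degree_sym: "psi_degree q \<zeta> v w = psi_degree q \<zeta> w v"
  by (auto simp: psi_degree_def no_edge_def to_edge_def from_edge_def)

lemma psi_degree_cases:
  "v = w \<Longrightarrow> psi_degree q \<zeta> v w = -2"
  "v \<noteq> w \<Longrightarrow> no_edge q \<zeta> v w \<Longrightarrow> psi_degree q \<zeta> v w = 0"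
  "v \<noteq> w \<Longrightarrow> to_edge q \<zeta> v w \<Longrightarrow> psi_degree q \<zeta> v w = 1"
  "v \<noteq> w \<Longrightarrow> from_edge q \<zeta> v w \<Longrightarrow> psi_degree q \<zeta> v w = 1"
  "v \<noteq> w \<Longrightarrow> both_edges q \<zeta> v w \<Longrightarrow> psi_degree q \<zeta> v w = 2"
  by (auto simp: psi_degree_def no_edge_def to_edge_def from_edge_def both_edges_def)

text \<open>A loop would force q = 1, as the values of vertices are nonzero. Hence the braid error
  is 0 when three equal vertices meet.\<close>

lemma no_loop: "\<not> edge q \<zeta> v v"
  using q \<zeta> by (simp add: edge_def vval_def)

lemma edge_cases:
  obtains "v = w" | "v \<noteq> w" "no_edge q \<zeta> v w" | "v \<noteq> w" "to_edge q \<zeta> v w" | "v \<noteq> w" "from_edge q \<zeta> v w"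
  | "v \<noteq> w" "both_edges q \<zeta> v w"
  by (auto simp: no_edge_def to_edge_def from_edge_def both_edges_def)

text \<open>Twice the degree of the crossing is 0 for the value 1, 2 for a difference of dots and 4
  for a product of two differences. For equal vertices it is -4, which fits because the value is 0
  and 0 has every degree.\<close>

lemma steps_psi_square:
  assumes "k \<in> K" "a \<in> {1..<n}"
  shows "steps (psi_square q \<zeta> a k) k (2 * psi_degree q \<zeta> (k a) (k (a + 1))) k"
proof -
  have Y: "steps (gen (QY a)) k 2 k" "steps (gen (QY (a + 1))) k 2 k"
    using assms by (auto intro!: steps_Y)
  note D = steps_diff[OF Y] steps_diff[OF Y(2) Y(1)]
  have D': "steps ((gen (QY (a + 1)) - gen (QY a)) * (gen (QY a) - gen (QY (a + 1)))) k 4 k"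
    using steps_mult[OF D(1) D(2)] by simp
  show ?thesis
    by (cases rule: edge_cases[of "k a" "k (a + 1)"])
       (use assms D D' psi_degree_cases[of "k a" "k (a + 1)"] in
         \<open>auto simp: psi_square_def steps_zero steps_one no_edge_def to_edge_def from_edge_def both_edges_def Let_def\<close>)
qed

text \<open>If the outer vertices agree, the sum is 2d - 2 with d the degree of the first crossing:
  0 for a single arrow, where the error is a sign, and 2 for a double one, where it is linear in the
  dots. Otherwise the error is 0, which fits every degree and every target tuple.\<close>

lemma steps_braid_error:
  assumes "k \<in> K" "a \<ge> 1" "a + 1 < n"
    and "k' \<in> K" "k (a + 2) = k a \<Longrightarrow> k' = k"
  shows "steps (braid_error q \<zeta> a k) k (psi_degree q \<zeta> (k a) (k (a + 1)) +
    psi_degree q \<zeta> (k a) (k (a + 2)) + psi_degree q \<zeta> (k (a + 1)) (k (a + 2))) k'"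
proof (cases "k (a + 2) = k a")
  case True
  have Y: "steps (gen (QY a)) k 2 k" "steps (gen (QY (a + 1))) k 2 k" "steps (gen (QY (a + 2))) k 2 k"
    using assms by (auto intro!: steps_Y)
  have "steps (2 * gen (QY (a + 1)) - gen (QY a) - gen (QY (a + 2))) k 2 k"
    using steps_diff[OF steps_diff[OF steps_add[OF Y(2) Y(2)] Y(1)] Y(3)] by (simp only: mult_2)
  moreover have "steps (- 1) k 0 k"
    using steps_const[OF assms(1), of "- 1"] by (simp add: const_simps)
  ultimately have "steps (braid_error q \<zeta> a k) k (psi_degree q \<zeta> (k a) (k (a + 1)) +
    psi_degree q \<zeta> (k a) (k (a + 2)) + psi_degree q \<zeta> (k (a + 1)) (k (a + 2))) k"
    by (cases rule: edge_cases[of "k a" "k (a + 1)"])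
       (use True assms psi_degree_cases[of "k a" "k (a + 1)"] psi_degree_sym[of "k (a + 1)" "k a"]
          psi_degree_cases(1)[of "k a" "k a"] no_loop[of "k a"] in
         \<open>auto simp: braid_error_def steps_zero steps_one no_edge_def to_edge_def from_edge_def both_edges_def\<close>)
  then show ?thesis using True assms(5) by simp
next
  case False
  then show ?thesis by (simp add: braid_error_def steps_zero assms)
qed

text \<open>The relations among idempotents and for a dot with an idempotent involve a single power
  of t and are checked directly. The other relations without an idempotent on the right, and the one
  for \<psi>_a e(k), go through \<open>\<Delta>_rel_total\<close>, the rest through
  \<open>\<Delta>_rel_right\<close>.\<close>

lemma \<Delta>_rel:
  assumes "(l, r) \<in> qh_rels q \<zeta> n \<Lambda> \<alpha>"
  shows "\<Delta> l - \<Delta> r \<in> JJ"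
proof -
  note lr = rels_closed[OF assms] and J = rels_in_ideal[OF assms]
  from assms show ?thesis
  proof (cases rule: qh_rels_cases)
    case unit
    then have "\<Delta> l - \<Delta> r = lau 0 (l - r)"
      by (simp add: \<Delta>_simps single_diff single_sum)
    then show ?thesis using J by simp
  next
    case (orthogonal k0 k1)
    then have "\<Delta> l - \<Delta> r = lau 0 (l - r)"
      by (auto simp: \<Delta>_simps single_diff mult_single)
    then show ?thesis using J by simp
  next
    case (dot_idem a k0)
    then have "\<Delta> l - \<Delta> r = lau 2 (l - r)"
      by (auto simp: \<Delta>_simps single_diff mult_single)
    then show ?thesis using J by simp
  next
    case (crossing_idem a k0)
    show ?thesis
    proof (rule \<Delta>_rel_total)
      fix k assume k: "k \<in> K"
      have s: "swap_at a k \<in> K" "swap_at a k0 \<in> K"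
        using crossing_idem k by (simp_all add: swap_at_tuples)
      have P: "steps (gen (QPsi a)) k (psi_degree q \<zeta> (k a) (k (a + 1))) (swap_at a k)"
        using crossing_idem k by (intro steps_Psi) auto
      show "\<exists>m k' k''. steps l k m k' \<and> steps r k m k''"
        using steps_mult[OF steps_E[OF k] P, of k0] steps_mult[OF P steps_E[OF s]] crossing_idem
        by (metis add.commute)
    qed (use lr J in auto)
  next
    case (dots a b)
    show ?thesis
    proof (rule \<Delta>_rel_total)
      fix k assume k: "k \<in> K"
      have Y: "steps (gen (QY a)) k 2 k" "steps (gen (QY b)) k 2 k"
        using dots k by (auto intro!: steps_Y)
      show "\<exists>m k' k''. steps l k m k' \<and> steps r k m k''"
        using steps_mult[OF Y] steps_mult[OF Y(2) Y(1)] dots by blast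
    qed (use lr J in auto)
  next
    case (crossing_dot a b)
    show ?thesis
    proof (rule \<Delta>_rel_total)
      fix k assume k: "k \<in> K"
      have Y: "steps (gen (QY b)) k 2 k" "steps (gen (QY b)) (swap_at a k) 2 (swap_at a k)"
        using crossing_dot k by (auto intro!: steps_Y swap_at_tuples)
      have P: "steps (gen (QPsi a)) k (psi_degree q \<zeta> (k a) (k (a + 1))) (swap_at a k)"
        using crossing_dot k by (intro steps_Psi) auto
      show "\<exists>m k' k''. steps l k m k' \<and> steps r k m k''"
        using steps_mult[OF Y(1) P] steps_mult[OF P Y(2)] crossing_dot by (metis add.commute)
    qed (use lr J in auto)
  next
    case (crossings a b)
    show ?thesis
    proof (rule \<Delta>_rel_total)
      fix k assume k: "k \<in> K"
      have P: "steps (gen (QPsi c)) k (psi_degree q \<zeta> (k c) (k (c + 1))) (swap_at c k)"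
        if "k \<in> K" "c \<in> {a, b}" for k c
        using crossings that by (intro steps_Psi) auto
      have s: "swap_at a k \<in> K" "swap_at b k \<in> K"
        using crossings k by (auto intro!: swap_at_tuples)
      \<comment> \<open>Distant crossings do not change each other's vertices, hence not each
        other's degrees.\<close>
      have "swap_at a k b = k b" "swap_at a k (b + 1) = k (b + 1)" "swap_at b k a = k a"
          "swap_at b k (a + 1) = k (a + 1)"
        using crossings by (auto simp: swap_at_def transpose_def)
      then show "\<exists>m k' k''. steps l k m k' \<and> steps r k m k''"
        using steps_mult[OF P[OF k, of a] P[OF s(1), of b]] steps_mult[OF P[OF k, of b] P[OF s(2), of a]] crossings
        by (auto simp: add.commute)
    qed (use lr J in auto)
  next
    case (crossing_dot_right a k)
    let ?d = "psi_degree q \<zeta> (k a) (k (a + 1))"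
    have a: "a \<in> {1..<n}" "k \<in> K" "a \<in> {1..n}" "a + 1 \<in> {1..n}" "swap_at a k \<in> K"
      using crossing_dot_right by (auto intro: swap_at_tuples)
    \<comment> \<open>For equal vertices the degree is -2 + 2 = 0, that of the constant 1, and the
      exchange fixes k; otherwise the term is 0.\<close>
    have "steps (if k a = k (a + 1) then 1 else 0) k (?d + 2) (swap_at a k)"
    proof (cases "k a = k (a + 1)")
      case True
      then have "swap_at a k = k" by (auto simp: swap_at_def transpose_def fun_eq_iff)
      then show ?thesis using True a by (simp add: psi_degree_cases steps_one)
    qed (use a in \<open>simp add: steps_zero\<close>)
    then show ?thesis
      using crossing_dot_right J a steps_mult[OF steps_Y[OF a(2,4)] steps_Psi[OF a(2,1)]]
        steps_mult[OF steps_Psi[OF a(2,1)] steps_Y[OF a(5,3)]]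
      by (auto intro!: \<Delta>_rel_right steps_add simp: add.commute)
  next
    case (dot_crossing_right a k)
    let ?d = "psi_degree q \<zeta> (k a) (k (a + 1))"
    have a: "a \<in> {1..<n}" "k \<in> K" "a \<in> {1..n}" "a + 1 \<in> {1..n}" "swap_at a k \<in> K"
      using dot_crossing_right by (auto intro: swap_at_tuples)
    have "steps (if k a = k (a + 1) then 1 else 0) k (?d + 2) (swap_at a k)"
    proof (cases "k a = k (a + 1)")
      case True
      then have "swap_at a k = k" by (auto simp: swap_at_def transpose_def fun_eq_iff)
      then show ?thesis using True a by (simp add: psi_degree_cases steps_one)
    qed (use a in \<open>simp add: steps_zero\<close>)
    then show ?thesis
      using dot_crossing_right J a steps_mult[OF steps_Y[OF a(2,3)] steps_Psi[OF a(2,1)]]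
        steps_mult[OF steps_Psi[OF a(2,1)] steps_Y[OF a(5,4)]]
      by (auto intro!: \<Delta>_rel_right steps_add simp: add.commute)
  next
    case (quadratic a k)
    have a: "a \<in> {1..<n}" "k \<in> K" "swap_at a k \<in> K"
      using quadratic by (auto intro: swap_at_tuples)
    have "swap_at a k a = k (a + 1)" "swap_at a k (a + 1) = k a"
      by (simp_all add: swap_at_def)
    then have "steps (gen (QPsi a) ^ 2) k (2 * psi_degree q \<zeta> (k a) (k (a + 1))) k"
      using steps_mult[OF steps_Psi[OF a(2,1)] steps_Psi[OF a(3,1)]] psi_degree_sym[of "k (a + 1)" "k a"]
      by (simp add: power2_eq_square)
    then show ?thesis
      using quadratic J steps_psi_square[OF a(2,1)] by (auto intro: \<Delta>_rel_right)
  next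
    case (braid a k)
    define b where "b = a + 1"
    have a: "a \<in> {1..<n}" "b \<in> {1..<n}" "k \<in> K" using braid by (auto simp: b_def)
    let ?s = swap_at and ?x = "k a" and ?y = "k (a + 1)" and ?z = "k (a + 2)" and ?d = "psi_degree q \<zeta>"
    have s: "?s b k \<in> K" "?s a (?s b k) \<in> K" "?s a k \<in> K" "?s b (?s a k) \<in> K" "?s a (?s b (?s a k)) \<in> K"
      using a by (auto intro!: swap_at_tuples)
    \<comment> \<open>On both sides of the braid relation each of the three pairs of entries crosses
      exactly once, only in a different order, so the degrees add up to the same sum.\<close>
    have v: "?s b k a = ?x" "?s b k (a + 1) = ?z" "?s a (?s b k) b = ?x" "?s a (?s b k) (b + 1) = ?y"
      "?s a k b = ?x" "?s a k (b + 1) = ?z" "?s b (?s a k) a = ?y" "?s b (?s a k) (a + 1) = ?z"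
      "k b = ?y" "k (b + 1) = ?z"
      by (simp_all add: swap_at_def transpose_def b_def)
    have braid_perm: "?s b (?s a (?s b k)) = ?s a (?s b (?s a k))"
      by (auto simp: swap_at_def transpose_def b_def fun_eq_iff)
    have "?s a (?s b (?s a k)) = k" if "?z = ?x"
      using that by (auto simp: swap_at_def transpose_def b_def fun_eq_iff)
    then have e: "steps (braid_error q \<zeta> a k) k (?d ?x ?y + ?d ?x ?z + ?d ?y ?z) (?s a (?s b (?s a k)))"
      using braid s by (intro steps_braid_error) auto
    have l: "steps (gen (QPsi b) * (gen (QPsi a) * gen (QPsi b))) k (?d ?x ?y + ?d ?x ?z + ?d ?y ?z)
        (?s a (?s b (?s a k)))"
      using steps_mult[OF steps_mult[OF steps_Psi[OF a(3,2)] steps_Psi[OF s(1) a(1)]] steps_Psi[OF s(2) a(2)]]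
      by (simp only: v braid_perm) (simp only: add_ac)
    have r: "steps (gen (QPsi a) * (gen (QPsi b) * gen (QPsi a))) k (?d ?x ?y + ?d ?x ?z + ?d ?y ?z)
        (?s a (?s b (?s a k)))"
      using steps_mult[OF steps_mult[OF steps_Psi[OF a(3,1)] steps_Psi[OF s(3) a(2)]] steps_Psi[OF s(4) a(1)]]
      by (simp only: v)
    have "steps (gen (QPsi (a + 1)) * gen (QPsi a) * gen (QPsi (a + 1))) k
        (?d ?x ?y + ?d ?x ?z + ?d ?y ?z) (?s a (?s b (?s a k)))"
      using l by (simp only: mult.assoc b_def)
    moreover have "steps (gen (QPsi a) * gen (QPsi (a + 1)) * gen (QPsi a) + braid_error q \<zeta> a k) k
        (?d ?x ?y + ?d ?x ?z + ?d ?y ?z) (?s a (?s b (?s a k)))"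
      using steps_add[OF r e] by (simp only: mult.assoc b_def)
    ultimately show ?thesis
      using J unfolding braid(4,5) by (rule \<Delta>_rel_right)
  next
    case (cyclotomic k)
    have Y: "steps (gen (QY 1)) k 2 k"
      using cyclotomic n_pos by (auto intro: steps_Y)
    have Y_power: "steps (gen (QY 1) ^ j) k (2 * int j) k" for j
    proof (induction j)
      case (Suc j)
      from steps_mult[OF this Y] show ?case by (simp add: algebra_simps)
    qed (use cyclotomic in \<open>simp add: steps_one\<close>)
    show ?thesis
      using cyclotomic J \<Delta>_rel_right[OF Y_power[of "\<Lambda> (fst (k 1))"] steps_zero[of k k]] by simp
  qed
qed

lemma \<Delta>_ideal: "x \<in> J \<Longrightarrow> \<Delta> x \<in> JJ"
proof (induction rule: rel_ideal_induct)
  case (rel l r)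
  then show ?case using \<Delta>_rel by (simp add: \<Delta>_simps)
next
  case (minus x)
  have "\<Delta> (- x) = - \<Delta> x" using \<Delta>_simps(2)[of 0 x] by (simp add: \<Delta>_simps)
  with minus show ?case by (simp add: JJ_closed)
qed (simp_all add: \<Delta>_simps JJ_closed mult_closed)

abbreviation "homogeneous \<equiv> qh_homogeneous q \<zeta> n \<Lambda> \<alpha>"

text \<open>Homogeneous elements are eigenvectors of \<Delta> for t^m, up to the relations. The
  basic elements are by the computations above, and the property passes to products, sums and scalar
  multiples.\<close>

lemma homogeneous_lift:
  assumes "homogeneous m X"
  shows "\<exists>x \<in> carrier A. X = cl x \<and> \<Delta> x - lau m x \<in> JJ"
  using assms
proof (induction rule: qh_homogeneous.induct)
  case (idem k)
  then show ?case
    by (intro bexI[of _ "gen (QE k)"]) (auto simp: qcl_def \<Delta>_simps JJ_closed)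
next
  case (dot k a)
  then show ?case
    by (intro bexI[of _ "gen (QY a) * gen (QE k)"]) (auto simp: qcl_def \<Delta>_simps JJ_closed mult_single)
next
  case (crossing k a)
  then have "steps (gen (QPsi a)) k (psi_degree q \<zeta> (k a) (k (a + 1))) (swap_at a k)"
    by (intro steps_Psi) auto
  with crossing show ?case
    by (intro bexI[of _ "gen (QPsi a) * gen (QE k)"])
       (auto simp: qcl_def steps_def \<Delta>_simps(3) \<Delta>_simps(8))
next
  case (product m X m' X')
  then obtain x x' where x: "x \<in> carrier A" "X = cl x" "\<Delta> x - lau m x \<in> JJ"
    "x' \<in> carrier A" "X' = cl x'" "\<Delta> x' - lau m' x' \<in> JJ" by blast
  have "(\<Delta> x - lau m x) * \<Delta> x' + lau m x * (\<Delta> x' - lau m' x') \<in> JJ"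
    using x by (intro JJ_closed(2) mult_closed(2)[OF lau_U[THEN iffD2]] mult_closed(3)[OF \<Delta>_closed])
  then have "\<Delta> (x * x') - lau (m + m') (x * x') \<in> JJ"
    by (simp add: \<Delta>_simps(3) left_diff_distrib right_diff_distrib mult_single)
  with x show ?case
    by (intro bexI[of _ "x * x'"]) (auto simp: qh_block_def cl_mult)
next
  case (zero m)
  show ?case by (intro bexI[of _ 0]) (auto simp: qh_block_def cl_zero \<Delta>_simps JJ_closed)
next
  case (sum m X X')
  then obtain x x' where x: "x \<in> carrier A" "X = cl x" "\<Delta> x - lau m x \<in> JJ"
    "x' \<in> carrier A" "X' = cl x'" "\<Delta> x' - lau m x' \<in> JJ" by blast
  have "(\<Delta> x - lau m x) + (\<Delta> x' - lau m x') \<in> JJ"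
    using x by (intro JJ_closed(2))
  then have "\<Delta> (x + x') - lau m (x + x') \<in> JJ"
    by (simp add: \<Delta>_simps(1) single_add algebra_simps)
  with x show ?case
    by (intro bexI[of _ "x + x'"]) (auto simp: qh_block_def cl_add)
next
  case (scalar m X c)
  then obtain x where x: "x \<in> carrier A" "X = cl x" "\<Delta> x - lau m x \<in> JJ" by blast
  have "lau 0 (const c) * (\<Delta> x - lau m x) \<in> JJ"
    using x by (intro mult_closed(2)) auto
  then have "\<Delta> (const c * x) - lau m (const c * x) \<in> JJ"
    by (simp add: \<Delta>_simps(3,7) right_diff_distrib mult_single)
  with x show ?case
    by (intro bexI[of _ "const c * x"]) (auto simp: qh_block_def smult_cl)
qed

lemma homogeneous_closed: "homogeneous m X \<Longrightarrow> X \<in> carrier Q"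
  by (auto dest!: homogeneous_lift)

text \<open>With representatives x_m, the sum of the x_m lies in \<open>J\<close>; applying \<Delta>
  puts the sum of the t^m x_m in \<open>JJ\<close>, and its coefficient at t^m is x_m.\<close>

lemma homogeneous_independent:
  assumes "finite M" "\<And>m. m \<in> M \<Longrightarrow> homogeneous m (g m)" "(\<Oplus>\<^bsub>Q\<^esub>m\<in>M. g m) = \<zero>\<^bsub>Q\<^esub>" "m \<in> M"
  shows "g m = \<zero>\<^bsub>Q\<^esub>"
proof -
  have "\<forall>m\<in>M. \<exists>x. x \<in> carrier A \<and> g m = cl x \<and> \<Delta> x - lau m x \<in> JJ"
    using homogeneous_lift[OF assms(2)] by auto
  from bchoice[OF this] obtain x
    where x: "\<And>m. m \<in> M \<Longrightarrow> x m \<in> carrier A \<and> g m = cl (x m) \<and> \<Delta> (x m) - lau m (x m) \<in> JJ"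
    by blast
  have "cl (\<Sum>m\<in>M. x m) = (\<Oplus>\<^bsub>Q\<^esub>m\<in>M. cl (x m))"
    using x assms(1) by (intro cl_sum) auto
  also have "\<dots> = (\<Oplus>\<^bsub>Q\<^esub>m\<in>M. g m)"
    using x by (intro finsum_cong') auto
  finally have "(\<Sum>m\<in>M. x m) \<in> J"
    using assms(3) cl_eq_iff[of "\<Sum>m\<in>M. x m" 0] x by (simp add: cl_zero)
  from \<Delta>_ideal[OF this] have "(\<Sum>m\<in>M. \<Delta> (x m)) \<in> JJ"
    by (simp add: \<Delta>_simps)
  moreover have "(\<Sum>m\<in>M. \<Delta> (x m) - lau m (x m)) \<in> JJ"
    using x by (intro JJ_closed(5)) blast
  ultimately have "(\<Sum>m\<in>M. \<Delta> (x m)) - (\<Sum>m\<in>M. \<Delta> (x m) - lau m (x m)) \<in> JJ"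
    by (rule JJ_closed(4))
  then have "(\<Sum>m\<in>M. lau m (x m)) \<in> JJ" by (simp add: sum_subtractf)
  then have "Poly_Mapping.lookup (\<Sum>m\<in>M. lau m (x m)) m \<in> J" by (simp add: JJ_def)
  also have "Poly_Mapping.lookup (\<Sum>m\<in>M. lau m (x m)) m = x m"
    using assms(1,4) by (simp add: lookup_sum lookup_single when_def)
  finally show ?thesis
    using x[OF assms(4)] cl_eq_iff[of "x m" 0] by (simp add: cl_zero)
qed

end

text \<open>Scalars are left out because every set to which it is applied is already closed under
  them.\<close>

inductive_set add_span :: "('a, 'b) ring_scheme \<Rightarrow> 'a set \<Rightarrow> 'a set" for R S where
  zero: "\<zero>\<^bsub>R\<^esub> \<in> add_span R S"
| incl: "x \<in> S \<Longrightarrow> x \<in> add_span R S"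
| add: "x \<in> add_span R S \<Longrightarrow> y \<in> add_span R S \<Longrightarrow> x \<oplus>\<^bsub>R\<^esub> y \<in> add_span R S"

lemma (in ring) add_span_closed: "S \<subseteq> carrier R \<Longrightarrow> x \<in> add_span R S \<Longrightarrow> x \<in> carrier R"
  by (rotate_tac, induction rule: add_span.induct) auto

lemma (in ring) add_span_mult:
  assumes S: "S \<subseteq> carrier R" and "\<And>x y. x \<in> S \<Longrightarrow> y \<in> S \<Longrightarrow> x \<otimes> y \<in> add_span R S"
    and x: "x \<in> add_span R S" and y: "y \<in> add_span R S"
  shows "x \<otimes> y \<in> add_span R S"
proof -
  have *: "s \<otimes> y \<in> add_span R S" if "s \<in> S" for s
    using y
  proof (induction rule: add_span.induct)
    case zero
    have "s \<in> carrier R" using that S by auto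
    then show ?case by (simp add: add_span.zero)
  next
    case (add y1 y2)
    then show ?case
      using that S add_span_closed[OF S] by (subst r_distr) (auto intro: add_span.add)
  qed (use that S assms(2) add_span.zero in auto)
  show ?thesis using x
  proof (induction rule: add_span.induct)
    case zero
    then show ?case using y add_span_closed[OF S] by (simp add: add_span.zero)
  next
    case (add x1 x2)
    then show ?case
      using y add_span_closed[OF S] by (subst l_distr) (auto intro: add_span.add)
  qed (use * in auto)
qed

section \<open>Spanning of a block by its homogeneous elements\<close>

context qh_data
begin

lemma add_span_sum:
  assumes "finite T" "\<And>i. i \<in> T \<Longrightarrow> f i \<in> carrier A \<and> cl (f i) \<in> add_span Q S"
  shows "cl (sum f T) \<in> add_span Q S"
  using assms
  by (induction T rule: finite_induct) (auto simp: cl_zero cl_add intro: add_span.intros)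

text \<open>Writing 1 as the sum of the e(k) on the right turns each generator, \<psi>_a included,
  into a sum of homogeneous elements; products of such sums are again such sums.\<close>

lemma homogeneous_span:
  assumes "X \<in> carrier Q"
  shows "X \<in> add_span Q {X. \<exists>m. homogeneous m X}" (is "_ \<in> add_span Q ?S")
  using assms
proof (induction rule: presented_induct)
  case (scalar c)
  have "cl (\<Sum>k\<in>K. const c * gen (QE k)) \<in> add_span Q ?S"
  proof (rule add_span_sum, simp)
    fix k assume k: "k \<in> K"
    have "homogeneous 0 (c \<odot>\<^bsub>qh_block q \<zeta> n \<Lambda> \<alpha>\<^esub> qcl q \<zeta> n \<Lambda> \<alpha> (gen (QE k)))"
      using k by (intro qh_homogeneous.intros)
    then show "const c * gen (QE k) \<in> carrier A \<and> cl (const c * gen (QE k)) \<in> add_span Q ?S"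
      using k by (auto simp: smult_cl qh_block_def qcl_def intro: add_span.incl)
  qed
  also have "(\<Sum>k\<in>K. const c * gen (QE k)) = const c * (\<Sum>k\<in>K. gen (QE k))"
    by (simp add: sum_distrib_left)
  also have "cl \<dots> = c \<odot>\<^bsub>Q\<^esub> cl (\<Sum>k\<in>K. gen (QE k))"
    by (rule smult_cl[symmetric]) simp
  also have "\<dots> = c \<odot>\<^bsub>Q\<^esub> \<one>\<^bsub>Q\<^esub>"
    by (simp add: cl_rel[OF qh_rels_intros(1)] presented_simps(2))
  finally show ?case .
next
  case (gen g)
  have "cl (gen g * gen (QE k)) \<in> add_span Q ?S" if k: "k \<in> K" for k
  proof (cases g)
    case (QE k0)
    then show ?thesis
      using k gen qh_homogeneous.product[OF qh_homogeneous.idem[of k0 q \<zeta> n \<alpha> \<Lambda>] qh_homogeneous.idem[of k q \<zeta> n \<alpha> \<Lambda>]]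
      by (auto simp: qh_block_def qcl_def cl_mult intro: add_span.incl)
  next
    case (QY a)
    then show ?thesis
      using k gen qh_homogeneous.dot[of k q \<zeta> n \<alpha> a \<Lambda>] by (auto simp: qcl_def intro: add_span.incl)
  next
    case (QPsi a)
    then show ?thesis
      using k gen qh_homogeneous.crossing[of k q \<zeta> n \<alpha> a \<Lambda>] by (auto simp: qcl_def intro: add_span.incl)
  qed
  then have "cl (\<Sum>k\<in>K. gen g * gen (QE k)) \<in> add_span Q ?S"
    using gen by (intro add_span_sum) auto
  also have "cl (\<Sum>k\<in>K. gen g * gen (QE k)) = cl (gen g) \<otimes>\<^bsub>Q\<^esub> cl (\<Sum>k\<in>K. gen (QE k))"
    using gen by (simp add: cl_mult flip: sum_distrib_left)
  also have "\<dots> = cl (gen g)"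
    using cl_rel[OF qh_rels_intros(1)[of q \<zeta> n \<alpha> \<Lambda>]] gen by (simp flip: presented_simps(2))
  finally show ?case .
next
  case (mult X Y)
  show ?case
  proof (rule add_span_mult[OF _ _ mult.IH])
    fix X Y assume "X \<in> ?S" "Y \<in> ?S"
    then obtain m m' where "homogeneous m X" "homogeneous m' Y" by blast
    then have "homogeneous (m + m') (X \<otimes>\<^bsub>Q\<^esub> Y)"
      using qh_homogeneous.product[of q \<zeta> n \<Lambda> \<alpha> m X m' Y] by (simp add: qh_block_def)
    then show "X \<otimes>\<^bsub>Q\<^esub> Y \<in> add_span Q ?S"
      by (auto intro: add_span.incl)
  qed (auto intro: homogeneous_closed)
qed (rule add_span.add)

end

section \<open>Rescaling the vertices\<close>

text \<open>A common factor of both vertices can then be cancelled in the quotient that occurs in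
  \<open>P_series\<close>. Inverses are compared through their uniqueness in a commutative
  ring.\<close>

lemma inverse_ps_const_mult:
  fixes c :: "'f::field"
  assumes "c \<noteq> 0" "w \<noteq> 0"
  shows "inverse (ps_const (c * w) * (1 - ps_v)) = ps_const (inverse c) * inverse (ps_const w * (1 - ps_v))"
proof -
  let ?g = "\<lambda>w. ps_const w * (1 - ps_v) :: 'f fps fps"
  have inv: "?g w * inverse (?g w) = 1" if "w \<noteq> 0" for w
  proof -
    \<comment> \<open>The coefficients of the outer series are themselves power series and do not
      form a field, so the invertibility of the constant coefficient has to be shown.\<close>
    have "fps_nth (?g w) 0 = fps_const w" by (simp add: ps_const_def ps_v_def)
    then show ?thesis
      using that unfolding fps_inverse_def by (intro fps_right_inverse) (simp add: fps_const_inverse)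
  qed
  have c: "ps_const (c * w) = ps_const c * ps_const w" "ps_const c * ps_const (inverse c) = 1"
    using assms by (simp_all add: ps_const_def)
  let ?y = "ps_const (inverse c) * inverse (?g w)"
  have "?g (c * w) * ?y = (ps_const c * ps_const (inverse c)) * (?g w * inverse (?g w))"
    by (simp only: c(1) mult_ac)
  also have "\<dots> = 1" using inv[OF assms(2)] c(2) by simp
  finally have y: "?g (c * w) * ?y = 1" .
  have "inverse (?g (c * w)) = (?g (c * w) * ?y) * inverse (?g (c * w))"
    unfolding y by simp
  also have "\<dots> = ?y * (?g (c * w) * inverse (?g (c * w)))"
    by (simp only: mult_ac)
  also have "?g (c * w) * inverse (?g (c * w)) = 1"
    using assms by (intro inv) simp
  finally show ?thesis by simp
qed

text \<open>Source and target blocks differ in general, since \<tau> moves the multiplicities from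
  \<alpha> to \<beta>. The locale is symmetric: it is also used for the inverse of \<tau>.\<close>

locale rescaling = dom: qh_data q \<zeta> n \<Lambda> \<alpha> + cod: qh_data q \<zeta> n \<Lambda> \<beta>
  for q \<zeta> :: "'f::field" and n \<Lambda> \<alpha> \<beta> +
  fixes \<tau> :: "vertex \<Rightarrow> vertex" and c :: 'f
  assumes \<tau>: "bij_betw \<tau> (vertices q \<zeta>) (vertices q \<zeta>)"
    and c: "c \<noteq> 0" and vval_\<tau>: "v \<in> vertices q \<zeta> \<Longrightarrow> vval q \<zeta> (\<tau> v) = c * vval q \<zeta> v"
    and weight_\<tau>: "v \<in> vertices q \<zeta> \<Longrightarrow> \<Lambda> (fst (\<tau> v)) = \<Lambda> (fst v)"
    and \<beta>_\<tau>: "v \<in> vertices q \<zeta> \<Longrightarrow> \<beta> (\<tau> v) = \<alpha> v"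
begin

abbreviation "V \<equiv> vertices q \<zeta>"

definition tmap :: "vtuple \<Rightarrow> vtuple" where
  "tmap k = (\<lambda>i\<in>{1..n}. \<tau> (k i))"

lemma tmap_apply [simp]: "a \<in> {1..n} \<Longrightarrow> tmap k a = \<tau> (k a)"
  by (simp add: tmap_def)

lemma \<tau>_V: "v \<in> V \<Longrightarrow> \<tau> v \<in> V"
  using \<tau> by (auto simp: bij_betw_def)

lemma \<tau>_eq_iff: "v \<in> V \<Longrightarrow> w \<in> V \<Longrightarrow> \<tau> v = \<tau> w \<longleftrightarrow> v = w"
  using \<tau> by (auto simp: bij_betw_def inj_on_def)

lemma tmap_tuples:
  assumes "k \<in> dom.K" shows "tmap k \<in> cod.K"
proof -
  have "card {a \<in> {1..n}. tmap k a = w} = \<beta> w" if "w \<in> V" for w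
  proof -
    obtain v where v: "w = \<tau> v" "v \<in> V"
      using \<tau> \<open>w \<in> V\<close> unfolding bij_betw_def by (metis imageE)
    then have "{a \<in> {1..n}. tmap k a = w} = {a \<in> {1..n}. k a = v}"
      using assms tuplesD[OF assms] by (auto simp: \<tau>_eq_iff)
    then show ?thesis using assms v \<beta>_\<tau>[of v] by (simp add: tuples_def)
  qed
  moreover have "tmap k \<in> {1..n} \<rightarrow>\<^sub>E V"
    using tuplesD[OF assms] by (auto simp: tmap_def intro!: \<tau>_V)
  ultimately show ?thesis by (simp add: tuples_def)
qed

lemma swap_at_tmap: "1 \<le> a \<Longrightarrow> a < n \<Longrightarrow> swap_at a (tmap k) = tmap (swap_at a k)"
  by (auto simp: swap_at_def tmap_def transpose_def fun_eq_iff)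

lemma tmap_inj: "inj_on tmap dom.K"
proof (rule inj_onI, rule ext)
  fix k k' a assume k: "k \<in> dom.K" "k' \<in> dom.K" "tmap k = tmap k'"
  show "k a = k' a"
  proof (cases "a \<in> {1..n}")
    case True
    then show ?thesis
      using fun_cong[OF k(3), of a] tuplesD[OF k(1)] tuplesD[OF k(2)] by (simp add: \<tau>_eq_iff)
  next
    case False
    then show ?thesis using k(1,2) by (auto simp: tuples_def PiE_def extensional_def)
  qed
qed

lemma edge_\<tau>: "v \<in> V \<Longrightarrow> w \<in> V \<Longrightarrow> edge q \<zeta> (\<tau> v) (\<tau> w) \<longleftrightarrow> edge q \<zeta> v w"
  using c by (simp add: edge_def vval_\<tau> mult.left_commute)

lemma edges_\<tau>:
  assumes "v \<in> V" "w \<in> V"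
  shows "no_edge q \<zeta> (\<tau> v) (\<tau> w) = no_edge q \<zeta> v w" "to_edge q \<zeta> (\<tau> v) (\<tau> w) = to_edge q \<zeta> v w"
    "from_edge q \<zeta> (\<tau> v) (\<tau> w) = from_edge q \<zeta> v w"
    "both_edges q \<zeta> (\<tau> v) (\<tau> w) = both_edges q \<zeta> v w"
  using assms
  by (simp_all add: no_edge_def to_edge_def from_edge_def both_edges_def edge_\<tau> \<tau>_eq_iff)

lemma psi_degree_\<tau>:
  "v \<in> V \<Longrightarrow> w \<in> V \<Longrightarrow> psi_degree q \<zeta> (\<tau> v) (\<tau> w) = psi_degree q \<zeta> v w"
  by (simp add: psi_degree_def edges_\<tau> \<tau>_eq_iff)

lemma P_series_\<tau>:
  assumes "v \<in> V" "w \<in> V"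
  shows "P_series q \<zeta> (\<tau> v) (\<tau> w) = P_series q \<zeta> v w"
proof -
  have w: "vval q \<zeta> w \<noteq> 0" using dom.q dom.\<zeta> by (simp add: vval_def)
  have r: "ps_const (c * x) * y * (ps_const (inverse c) * z) = ps_const x * y * z" for x y z
  proof -
    have "ps_const (c * x) * ps_const (inverse c) = ps_const x"
      using c by (simp add: ps_const_def field_simps)
    then show ?thesis by (metis mult.assoc mult.left_commute)
  qed
  show ?thesis
    using assms by (simp add: P_series_def \<tau>_eq_iff vval_\<tau> inverse_ps_const_mult[OF c w] r)
qed

text \<open>The exact quotient is determined by an equation in which the vertices occur only through
  \<open>P_series\<close>, so the invariance of the latter suffices and no division has to be
  carried out.\<close>

lemma Q_series_\<tau>:
  "v \<in> V \<Longrightarrow> w \<in> V \<Longrightarrow> Q_series \<epsilon> q \<zeta> (\<tau> v) (\<tau> w) = Q_series \<epsilon> q \<zeta> v w"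
  by (simp add: Q_series_def PQ_quotient_def P_series_\<tau> edges_\<tau> \<tau>_eq_iff)

section \<open>Renaming of the idempotents\<close>

sublocale rename: central_hom "const :: 'f \<Rightarrow> (qgen, 'f) free_algebra"
proof
  show "const a * x = x * const a" for a and x :: "(qgen, 'f) free_algebra"
    by (rule const_central)
qed (simp_all add: const_simps)

definition rename_gen :: "qgen \<Rightarrow> (qgen, 'f) free_algebra" where
  "rename_gen g = (case g of QE k \<Rightarrow> gen (QE (tmap k)) | _ \<Rightarrow> gen g)"

definition rename :: "(qgen, 'f) free_algebra \<Rightarrow> (qgen, 'f) free_algebra" where
  "rename = rename.free_lift rename_gen"

lemma rename_simps:
  "rename (x + y) = rename x + rename y" "rename (x - y) = rename x - rename y"
  "rename (x * y) = rename x * rename y"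
  "rename 0 = 0" "rename 1 = 1" "rename (sum h S) = (\<Sum>i\<in>S. rename (h i))" "rename (const b) = const b"
  "rename (gen (QE k)) = gen (QE (tmap k))" "rename (gen (QY a)) = gen (QY a)"
  "rename (gen (QPsi a)) = gen (QPsi a)"
  by (simp_all add: rename_def rename.free_lift_add rename.free_lift_diff rename.free_lift_mult
      rename.free_lift_sum rename.free_lift_const rename.free_lift_gen rename_gen_def)

lemma rename_power: "rename (x ^ m) = rename x ^ m"
  by (induction m) (simp_all add: rename_simps)

lemma rename_two: "rename 2 = 2"
  using rename_simps(1)[of 1 1] by (simp add: rename_simps)

lemma rename_closed [simp]: "x \<in> carrier dom.A \<Longrightarrow> rename x \<in> carrier cod.A"
proof (induction rule: free_alg_induct)
  case (gen g)
  then show ?case by (cases g) (auto simp: rename_simps tmap_tuples)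
qed (auto simp: rename_simps)

lemma rename_psi_square:
  assumes "k \<in> dom.K" "a \<in> {1..<n}"
  shows "rename (psi_square q \<zeta> a k) = psi_square q \<zeta> a (tmap k)"
  using assms tuplesD[OF assms(1), of a] tuplesD[OF assms(1), of "a + 1"]
  by (simp add: psi_square_def rename_simps edges_\<tau> \<tau>_eq_iff Let_def)

lemma rename_braid_error:
  assumes "k \<in> dom.K" "1 \<le> a" "a + 1 < n"
  shows "rename (braid_error q \<zeta> a k) = braid_error q \<zeta> a (tmap k)"
proof -
  have "rename (- 1) = - 1" using rename_simps(2)[of 0 1] by (simp add: rename_simps)
  then show ?thesis
    using assms tuplesD[OF assms(1), of a] tuplesD[OF assms(1), of "a + 1"] tuplesD[OF assms(1), of "a + 2"]
    by (simp add: braid_error_def rename_simps edges_\<tau> \<tau>_eq_iff rename_two)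
qed

text \<open>Surjectivity is what carries the relation that the e(k) sum to 1 to the other block, and
  what allows the sums for the images of X_a and T_a to be reindexed.\<close>

lemma tmap_bij: "bij_betw tmap dom.K cod.K"
proof -
  have "cod.K \<subseteq> tmap ` dom.K"
  proof
    fix k assume k: "k \<in> cod.K"
    let ?\<tau>' = "the_inv_into V \<tau>"
    define k' where "k' = (\<lambda>a\<in>{1..n}. ?\<tau>' (k a))"
    have \<tau>': "?\<tau>' w \<in> V" "\<tau> (?\<tau>' w) = w" if "w \<in> V" for w
      using \<tau> that by (auto simp: bij_betw_def the_inv_into_into f_the_inv_into_f)
    have "card {a \<in> {1..n}. k' a = v} = \<alpha> v" if v: "v \<in> V" for v
    proof -
      have "k' a = v \<longleftrightarrow> k a = \<tau> v" if "a \<in> {1..n}" for a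
        using \<tau>'[OF tuplesD[OF k that]] that v \<tau>
        by (auto simp: k'_def bij_betw_def the_inv_into_f_f)
      then have "{a \<in> {1..n}. k' a = v} = {a \<in> {1..n}. k a = \<tau> v}" by auto
      then show ?thesis using k v \<beta>_\<tau>[OF v] \<tau>_V[OF v] by (simp add: tuples_def)
    qed
    moreover have "k' \<in> {1..n} \<rightarrow>\<^sub>E V"
      using tuplesD[OF k] by (auto simp: k'_def intro!: \<tau>')
    ultimately have "k' \<in> dom.K" by (simp add: tuples_def)
    moreover have "tmap k' = k"
    proof
      fix a show "tmap k' a = k a"
        using k \<tau>'[OF tuplesD[OF k, of a]]
        by (cases "a \<in> {1..n}") (auto simp: k'_def tmap_def tuples_def PiE_def extensional_def)
    qed
    ultimately show "k \<in> tmap ` dom.K" by blast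
  qed
  then show ?thesis using tmap_inj tmap_tuples by (auto simp: bij_betw_def)
qed

text \<open>The relations see vertices only through equality, edges and the weight, all of which
  \<tau> preserves. So each relation becomes literally a relation of the same family.\<close>

lemma rename_rel:
  assumes "(l, r) \<in> qh_rels q \<zeta> n \<Lambda> \<alpha>"
  shows "(rename l, rename r) \<in> qh_rels q \<zeta> n \<Lambda> \<beta>"
  using assms
proof (cases rule: qh_rels_cases)
  case unit
  have "(\<Sum>k\<in>dom.K. gen (QE (tmap k))) = (\<Sum>k\<in>cod.K. gen (QE k) :: (qgen, 'f) free_algebra)"
    by (rule sum.reindex_bij_betw[OF tmap_bij])
  with unit show ?thesis using qh_rels_intros(1)[of q \<zeta> n \<beta> \<Lambda>] by (simp add: rename_simps)
next
  case (orthogonal k k')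
  then have "tmap k = tmap k' \<longleftrightarrow> k = k'" using tmap_inj by (auto simp: inj_on_def)
  then show ?thesis
    using orthogonal qh_rels_intros(2)[of "tmap k" q \<zeta> n \<beta> "tmap k'" \<Lambda>]
    by (simp add: rename_simps tmap_tuples if_distrib[of rename] cong: if_cong)
next
  case (dot_idem a k)
  then show ?thesis by (simp add: rename_simps qh_rels_intros(3) tmap_tuples)
next
  case (crossing_idem a k)
  then show ?thesis
    using qh_rels_intros(4)[of a n "tmap k" q \<zeta> \<beta> \<Lambda>] by (simp add: rename_simps swap_at_tmap tmap_tuples)
next
  case (dots a b)
  then show ?thesis by (simp add: rename_simps qh_rels_intros(5))
next
  case (crossing_dot a b)
  then show ?thesis using qh_rels_intros(6)[of a n b] by (simp add: rename_simps)
next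
  case (crossings a b)
  then show ?thesis using qh_rels_intros(7)[of a n b] by (simp add: rename_simps)
next
  case (crossing_dot_right a k)
  then have "tmap k a = tmap k (a + 1) \<longleftrightarrow> k a = k (a + 1)" by (simp add: \<tau>_eq_iff tuplesD)
  then show ?thesis
    using crossing_dot_right qh_rels_intros(8)[of a n "tmap k" q \<zeta> \<beta> \<Lambda>]
    by (simp add: rename_simps tmap_tuples if_distrib[of rename] cong: if_cong)
next
  case (dot_crossing_right a k)
  then have "tmap k a = tmap k (a + 1) \<longleftrightarrow> k a = k (a + 1)" by (simp add: \<tau>_eq_iff tuplesD)
  then show ?thesis
    using dot_crossing_right qh_rels_intros(9)[of a n "tmap k" q \<zeta> \<beta> \<Lambda>]
    by (simp add: rename_simps tmap_tuples if_distrib[of rename] cong: if_cong)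
next
  case (quadratic a k)
  then show ?thesis
    using qh_rels_intros(10)[of a n "tmap k" q \<zeta> \<beta> \<Lambda>]
    by (simp add: rename_simps rename_power tmap_tuples rename_psi_square)
next
  case (braid a k)
  then show ?thesis
    using qh_rels_intros(11)[of a n "tmap k" q \<zeta> \<beta> \<Lambda>]
    by (simp add: rename_simps tmap_tuples rename_braid_error)
next
  case (cyclotomic k)
  then have "\<Lambda> (fst (tmap k 1)) = \<Lambda> (fst (k 1))"
    using dom.n_pos by (simp add: weight_\<tau> tuplesD)
  then show ?thesis
    using cyclotomic qh_rels_intros(12)[of "tmap k" q \<zeta> n \<beta> \<Lambda>]
    by (simp add: rename_simps rename_power tmap_tuples)
qed

lemma rename_ideal: "x \<in> dom.J \<Longrightarrow> rename x \<in> cod.J"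
proof (induction rule: dom.rel_ideal_induct)
  case (rel l r)
  then show ?case using cod.rels_in_ideal[OF rename_rel] by (simp add: rename_simps)
next
  case (minus x)
  then show ?case using rename_simps(2)[of 0 x] by (simp add: rename_simps cod.rel_ideal_closed)
qed (simp_all add: rename_simps cod.rel_ideal_closed)

section \<open>The induced isomorphisms between blocks\<close>

definition block_map :: "(qgen, 'f) free_algebra set \<Rightarrow> (qgen, 'f) free_algebra set" where
  "block_map X = cod.cl (rename (SOME x. x \<in> carrier dom.A \<and> dom.cl x = X))"

text \<open>The chosen representative does not matter: two of them differ by an element of the
  relation ideal, which renaming maps into the other ideal.\<close>

lemma block_map_cl:
  assumes "x \<in> carrier dom.A"
  shows "block_map (dom.cl x) = cod.cl (rename x)"
proof -
  let ?y = "SOME y. y \<in> carrier dom.A \<and> dom.cl y = dom.cl x"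
  have y: "?y \<in> carrier dom.A \<and> dom.cl ?y = dom.cl x"
    by (rule someI) (use assms in auto)
  then have "rename (?y - x) \<in> cod.J"
    using assms dom.cl_eq_iff by (intro rename_ideal) auto
  then show ?thesis
    using y assms by (simp add: block_map_def cod.cl_eq_iff rename_simps)
qed

lemma block_map_hom:
  "X \<in> carrier dom.Q \<Longrightarrow> block_map X \<in> carrier cod.Q"
  "X \<in> carrier dom.Q \<Longrightarrow> Y \<in> carrier dom.Q \<Longrightarrow> block_map (X \<oplus>\<^bsub>dom.Q\<^esub> Y) = block_map X \<oplus>\<^bsub>cod.Q\<^esub> block_map Y"
  "X \<in> carrier dom.Q \<Longrightarrow> Y \<in> carrier dom.Q \<Longrightarrow> block_map (X \<otimes>\<^bsub>dom.Q\<^esub> Y) = block_map X \<otimes>\<^bsub>cod.Q\<^esub> block_map Y"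
  "block_map \<one>\<^bsub>dom.Q\<^esub> = \<one>\<^bsub>cod.Q\<^esub>"
  "X \<in> carrier dom.Q \<Longrightarrow> block_map (a \<odot>\<^bsub>dom.Q\<^esub> X) = a \<odot>\<^bsub>cod.Q\<^esub> block_map X"
  by (auto simp: dom.presented_simps(1,2) cod.presented_simps(2) block_map_cl dom.smult_cl cod.smult_cl rename_simps
      simp flip: dom.cl_add dom.cl_mult cod.cl_add cod.cl_mult)

lemma block_map_ring_hom: "ring_hom_ring dom.Q cod.Q block_map"
  by (intro ring_hom_ringI2 dom.ring_presented cod.ring_presented ring_hom_memI)
     (simp_all add: block_map_hom)

sublocale block_map: ring_hom_ring dom.Q cod.Q block_map
  by (rule block_map_ring_hom)

lemma block_map_homogeneous: "dom.homogeneous m X \<Longrightarrow> cod.homogeneous m (block_map X)"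
proof (induction rule: qh_homogeneous.induct)
  case (idem k)
  then show ?case
    using qh_homogeneous.idem[OF tmap_tuples[OF idem], of \<Lambda>]
    by (simp add: qcl_def block_map_cl rename_simps)
next
  case (dot k a)
  then show ?case
    using qh_homogeneous.dot[OF tmap_tuples[of k], of a \<Lambda>]
    by (simp add: qcl_def block_map_cl rename_simps)
next
  case (crossing k a)
  then show ?case
    using qh_homogeneous.crossing[OF tmap_tuples[of k], of a \<Lambda>]
    by (simp add: qcl_def block_map_cl rename_simps psi_degree_\<tau> tuplesD)
next
  case (product m X m' X')
  then show ?case
    using qh_homogeneous.product[OF product.IH] dom.homogeneous_closed
    by (simp add: qh_block_def block_map_hom)
next
  case (zero m)
  then show ?case using qh_homogeneous.zero[of q \<zeta> n \<Lambda> \<beta> m] by (simp add: qh_block_def)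
next
  case (sum m X X')
  then show ?case
    using qh_homogeneous.sum[OF sum.IH] dom.homogeneous_closed by (simp add: qh_block_def block_map_hom)
next
  case (scalar m X a)
  then show ?case
    using qh_homogeneous.scalar[OF scalar.IH, of a] dom.homogeneous_closed
    by (simp add: qh_block_def block_map_hom)
qed

lemma inverse_rescaling:
  "rescaling q \<zeta> n \<Lambda> \<beta> \<alpha> (the_inv_into (vertices q \<zeta>) \<tau>) (inverse c)"
proof -
  have i: "the_inv_into V \<tau> w \<in> V" "\<tau> (the_inv_into V \<tau> w) = w" if "w \<in> V" for w
    using \<tau> that by (auto simp: bij_betw_def the_inv_into_into f_the_inv_into_f)
  show ?thesis
  proof (unfold_locales)
    show "bij_betw (the_inv_into V \<tau>) V V" by (rule bij_betw_the_inv_into[OF \<tau>])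
    fix w assume w: "w \<in> V"
    show "vval q \<zeta> (the_inv_into V \<tau> w) = inverse c * vval q \<zeta> w"
      using vval_\<tau>[OF i(1)[OF w]] i(2)[OF w] c by (simp add: field_simps)
    show "\<Lambda> (fst (the_inv_into V \<tau> w)) = \<Lambda> (fst w)"
      using weight_\<tau>[OF i(1)[OF w]] i(2)[OF w] by simp
    show "\<alpha> (the_inv_into V \<tau> w) = \<beta> w"
      using \<beta>_\<tau>[OF i(1)[OF w]] i(2)[OF w] by simp
  qed (use c in simp)
qed

text \<open>Renaming by the inverse of \<tau> undoes the map on generators. Injectivity is wanted
  for \<open>ps_eval\<close>, whose sum runs over the nonzero monomials only: none of them may be
  killed.\<close>

lemma block_map_inj: "inj_on block_map (carrier dom.Q)"
proof -
  interpret inv: rescaling q \<zeta> n \<Lambda> \<beta> \<alpha> "the_inv_into V \<tau>" "inverse c"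
    by (rule inverse_rescaling)
  have "inv.block_map (block_map X) = X" if "X \<in> carrier dom.Q" for X
    using that
  proof (induction rule: dom.presented_induct)
    case (gen g)
    have "inv.tmap (tmap k) = k" if k: "k \<in> dom.K" for k
    proof
      fix a show "inv.tmap (tmap k) a = k a"
      proof (cases "a \<in> {1..n}")
        case True
        then show ?thesis
          using tuplesD[OF k True] \<tau> by (simp add: the_inv_into_f_f bij_betw_def)
      next
        case False
        then show ?thesis using k unfolding inv.tmap_def by (auto simp: tuples_def PiE_def extensional_def)
      qed
    qed
    then have "inv.rename (rename (gen g)) = gen g"
      using gen by (cases g) (auto simp: rename_simps inv.rename_simps)
    moreover have g: "gen g \<in> carrier dom.A" using gen by simp
    ultimately show ?case
      by (simp add: block_map_cl[OF g] inv.block_map_cl[OF rename_closed[OF g]])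
  qed (simp_all add: block_map_hom inv.block_map_hom)
  then show ?thesis by (rule inj_on_inverseI)
qed

lemma block_map_ps_eval:
  assumes x: "x \<in> carrier dom.Q" and y: "y \<in> carrier dom.Q"
  shows "block_map (ps_eval dom.Q x y g) = ps_eval cod.Q (block_map x) (block_map y) g"
proof -
  let ?D = "{(l, m). x [^]\<^bsub>dom.Q\<^esub> (l::nat) \<otimes>\<^bsub>dom.Q\<^esub> y [^]\<^bsub>dom.Q\<^esub> (m::nat) \<noteq> \<zero>\<^bsub>dom.Q\<^esub>}"
  let ?C = "{(l, m). block_map x [^]\<^bsub>cod.Q\<^esub> (l::nat) \<otimes>\<^bsub>cod.Q\<^esub> block_map y [^]\<^bsub>cod.Q\<^esub> (m::nat) \<noteq> \<zero>\<^bsub>cod.Q\<^esub>}"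
  have pow: "block_map (x [^]\<^bsub>dom.Q\<^esub> (l::nat) \<otimes>\<^bsub>dom.Q\<^esub> y [^]\<^bsub>dom.Q\<^esub> (m::nat)) =
      block_map x [^]\<^bsub>cod.Q\<^esub> l \<otimes>\<^bsub>cod.Q\<^esub> block_map y [^]\<^bsub>cod.Q\<^esub> m" for l m
    using x y by (simp add: block_map.hom_nat_pow)
  have "block_map z = \<zero>\<^bsub>cod.Q\<^esub> \<longleftrightarrow> z = \<zero>\<^bsub>dom.Q\<^esub>" if "z \<in> carrier dom.Q" for z
    using inj_onD[OF block_map_inj, of z "\<zero>\<^bsub>dom.Q\<^esub>"] that by auto
  from this[OF dom.m_closed[OF dom.nat_pow_closed[OF x] dom.nat_pow_closed[OF y]]]
  \<comment> \<open>Equality of the index sets also covers the infinite case, where both sums are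
    zero by convention.\<close>
  have "?D = ?C" unfolding pow by (simp only:)
  have "block_map (ps_eval dom.Q x y g) = (\<Oplus>\<^bsub>cod.Q\<^esub>lm\<in>?D. block_map
      (fps_nth (fps_nth g (snd lm)) (fst lm) \<odot>\<^bsub>dom.Q\<^esub> (x [^]\<^bsub>dom.Q\<^esub> fst lm \<otimes>\<^bsub>dom.Q\<^esub> y [^]\<^bsub>dom.Q\<^esub> snd lm)))"
    unfolding ps_eval_def using x y by (subst block_map.hom_finsum) (auto simp: comp_def)
  also have "\<dots> = ps_eval cod.Q (block_map x) (block_map y) g"
    unfolding ps_eval_def \<open>?D = ?C\<close> using x y
    by (intro cod.finsum_cong') (auto simp: block_map_hom(5) pow simp del: block_map.hom_mult)
  finally show ?thesis .
qed

lemma ps_eval_closed: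
  assumes "x \<in> carrier dom.Q" "y \<in> carrier dom.Q"
  shows "ps_eval dom.Q x y g \<in> carrier dom.Q"
  unfolding ps_eval_def using assms by (intro dom.finsum_closed) auto

lemma block_map_image_T:
  assumes "a \<in> {1..<n}"
  shows "block_map (image_T \<epsilon> q \<zeta> n \<Lambda> a \<alpha>) = image_T \<epsilon> q \<zeta> n \<Lambda> a \<beta>"
proof -
  define D where "D k = (dom.cl (gen (QPsi a)) \<otimes>\<^bsub>dom.Q\<^esub>
      ps_eval dom.Q (dom.cl (gen (QY a))) (dom.cl (gen (QY (a + 1)))) (Q_series \<epsilon> q \<zeta> (k a) (k (a + 1)))
    \<ominus>\<^bsub>dom.Q\<^esub> ps_eval dom.Q (dom.cl (gen (QY a))) (dom.cl (gen (QY (a + 1)))) (P_series q \<zeta> (k a) (k (a + 1))))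
    \<otimes>\<^bsub>dom.Q\<^esub> dom.cl (gen (QE k))" for k
  define C where "C k = (cod.cl (gen (QPsi a)) \<otimes>\<^bsub>cod.Q\<^esub>
      ps_eval cod.Q (cod.cl (gen (QY a))) (cod.cl (gen (QY (a + 1)))) (Q_series \<epsilon> q \<zeta> (k a) (k (a + 1)))
    \<ominus>\<^bsub>cod.Q\<^esub> ps_eval cod.Q (cod.cl (gen (QY a))) (cod.cl (gen (QY (a + 1)))) (P_series q \<zeta> (k a) (k (a + 1))))
    \<otimes>\<^bsub>cod.Q\<^esub> cod.cl (gen (QE k))" for k
  have gens: "gen (QPsi a) \<in> carrier dom.A" "gen (QY a) \<in> carrier dom.A" "gen (QY (a + 1)) \<in> carrier dom.A"
    "k \<in> dom.K \<Longrightarrow> gen (QE k) \<in> carrier dom.A" for k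
    using assms by auto
  have D: "D k \<in> carrier dom.Q" if "k \<in> dom.K" for k
    unfolding D_def using gens that
    by (intro dom.m_closed dom.minus_closed ps_eval_closed dom.cl_closed) auto
  have DC: "block_map (D k) = C (tmap k)" if k: "k \<in> dom.K" for k
  proof -
    have V: "k a \<in> V" "k (a + 1) \<in> V" "a \<in> {1..n}" "a + 1 \<in> {1..n}"
      using assms tuplesD[OF k] by auto
    show ?thesis
      unfolding D_def C_def using gens k V
      by (simp add: a_minus_def block_map_ps_eval ps_eval_closed block_map_cl rename_simps
          Q_series_\<tau> P_series_\<tau>)
  qed
  have "block_map (image_T \<epsilon> q \<zeta> n \<Lambda> a \<alpha>) = block_map (\<Oplus>\<^bsub>dom.Q\<^esub>k\<in>dom.K. D k)"
    using dom.comp by (simp add: image_T_def D_def qh_block_def qcl_def Let_def)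
  also have "\<dots> = (\<Oplus>\<^bsub>cod.Q\<^esub>k\<in>dom.K. block_map (D k))"
    using D by (subst block_map.hom_finsum) (auto simp: comp_def)
  also have "\<dots> = (\<Oplus>\<^bsub>cod.Q\<^esub>k\<in>dom.K. C (tmap k))"
    using D by (intro cod.finsum_cong') (auto simp: DC simp flip: DC)
  also have "\<dots> = (\<Oplus>\<^bsub>cod.Q\<^esub>k\<in>tmap ` dom.K. C k)"
    using D by (intro cod.finsum_reindex[symmetric] tmap_inj) (auto simp flip: DC)
  also have "tmap ` dom.K = cod.K" using tmap_bij by (simp add: bij_betw_def)
  also have "(\<Oplus>\<^bsub>cod.Q\<^esub>k\<in>cod.K. C k) = image_T \<epsilon> q \<zeta> n \<Lambda> a \<beta>"
    using cod.comp by (simp add: image_T_def C_def qh_block_def qcl_def Let_def)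
  finally show ?thesis .
qed

text \<open>Renaming changes e(k) but keeps its coefficient, the value of the vertex k_a; the factor
  c turns this into the value of \<tau> k_a, which belongs to the new idempotent.\<close>

lemma block_map_image_X:
  assumes "a \<in> {1..n}"
  shows "c \<odot>\<^bsub>cod.Q\<^esub> block_map (image_X q \<zeta> n \<Lambda> a \<alpha>) = image_X q \<zeta> n \<Lambda> a \<beta>"
proof -
  define D where "D k = const (vval q \<zeta> (k a)) * (1 - gen (QY a)) * gen (QE k)" for k
  have D: "D k \<in> carrier dom.A" if "k \<in> dom.K" for k
    using that assms by (auto simp: D_def)
  have D': "D k \<in> carrier cod.A" if "k \<in> cod.K" for k
    using that assms by (auto simp: D_def)
  have "image_X q \<zeta> n \<Lambda> a \<alpha> = dom.cl (\<Sum>k\<in>dom.K. D k)"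
    using dom.comp D by (subst dom.cl_sum) (auto simp: image_X_def D_def qh_block_def qcl_def)
  then have "c \<odot>\<^bsub>cod.Q\<^esub> block_map (image_X q \<zeta> n \<Lambda> a \<alpha>) = cod.cl (\<Sum>k\<in>dom.K. const c * rename (D k))"
    using D by (simp add: block_map_cl cod.smult_cl sum_distrib_left rename_simps(6))
  also have "(\<Sum>k\<in>dom.K. const c * rename (D k)) = (\<Sum>k\<in>dom.K. D (tmap k))"
    using assms by (intro sum.cong) (auto simp: D_def rename_simps tuplesD vval_\<tau> const_simps mult.assoc)
  also have "\<dots> = (\<Sum>k\<in>cod.K. D k)"
    by (rule sum.reindex_bij_betw[OF tmap_bij])
  also have "cod.cl \<dots> = image_X q \<zeta> n \<Lambda> a \<beta>"
    using cod.comp D' by (subst cod.cl_sum) (auto simp: image_X_def D_def qh_block_def qcl_def)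
  finally show ?thesis .
qed

end

section \<open>The rotation of the quiver\<close>

text \<open>For infinite order \<open>mult_order\<close> is 0, and the claim is the trivial q^0 =
  1.\<close>

lemma pow_mult_order:
  fixes q :: "'f::field"
  shows "q ^ mult_order q = 1"
proof (cases "\<exists>m>0. q ^ m = 1")
  case True
  from LeastI_ex[OF True] True show ?thesis by (simp add: mult_order_def)
next
  case False
  then show ?thesis unfolding mult_order_def by (simp only: if_False power_0)
qed

lemma powi_mod_mult_order:
  fixes q :: "'f::field"
  assumes "q \<noteq> 0"
  shows "q powi (i mod int (mult_order q)) = q powi i"
proof -
  let ?e = "int (mult_order q)"
  have "q powi i = q powi (i mod ?e + ?e * (i div ?e))" by simp
  also have "\<dots> = q powi (i mod ?e) * (q powi ?e) powi (i div ?e)"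
    using assms by (subst power_int_add) (simp_all only: power_int_mult simp_thms)
  finally show ?thesis by (simp add: pow_mult_order)
qed

lemma mod_mult_order_index [simp]: "i mod int (mult_order q) \<in> index_set q"
  by (simp add: index_set_def)

text \<open>If i < j gave the same power, then q^(j-i) = 1 would make the order e finite; both
  indices would lie in {0..<e}, and j - i < e would contradict the minimality of e.\<close>

lemma powi_inj_index_set:
  fixes q :: "'f::field"
  assumes "q \<noteq> 0" "i \<in> index_set q" "j \<in> index_set q" "q powi i = q powi j"
  shows "i = j"
proof -
  have False if "i \<in> index_set q" "j \<in> index_set q" "q powi i = q powi j" "i < j" for i j
  proof -
    define m where "m = nat (j - i)"
    have m: "m > 0" "int m = j - i" using that(4) by (simp_all add: m_def)
    have "q powi int m = q powi j / q powi i"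
      using m assms(1) by (simp add: power_int_diff del: power_int_of_nat)
    then have "q ^ m = 1" using that(3) assms(1) by simp
    then have *: "\<exists>m>0. q ^ m = 1" using m by blast
    have "(LEAST m. m > 0 \<and> q ^ m = 1) > 0" using LeastI_ex[OF *] by blast
    moreover have "mult_order q = (LEAST m. m > 0 \<and> q ^ m = 1)" unfolding mult_order_def if_P[OF *] ..
    moreover have "(LEAST m. m > 0 \<and> q ^ m = 1) \<le> m" by (rule Least_le) (use m \<open>q ^ m = 1\<close> in auto)
    ultimately have e: "0 < mult_order q" "mult_order q \<le> m" by simp_all
    have "i \<ge> 0" "j < int (mult_order q)"
      using that(1,2) e(1) pos_mod_sign[of "int (mult_order q)" i] pos_mod_bound[of "int (mult_order q)" j]
      by (simp_all add: index_set_def)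
    then show False using e m by linarith
  qed
  then show ?thesis using assms by (metis linorder_neqE)
qed

locale shift_data =
  fixes q \<zeta> :: "'f::field" and p n :: nat and \<Lambda> :: "int \<Rightarrow> nat"
  assumes root: "primitive_root_of_unity p \<zeta>" and q: "q \<noteq> 0" "q \<noteq> 1" and n: "n \<ge> 2"
    and weight: "i \<in> index_set q \<Longrightarrow> \<Lambda> i = \<Lambda> ((i + eta q \<zeta>) mod int (mult_order q))"
begin

abbreviation "e \<equiv> int (mult_order q)"
abbreviation "\<eta> \<equiv> eta q \<zeta>"
abbreviation "p' \<equiv> p_prime q \<zeta>"
abbreviation "V \<equiv> vertices q \<zeta>"

lemma \<zeta>: "\<zeta> \<noteq> 0"
  using root by (auto simp: primitive_root_of_unity_def power_0_left)

lemma p_prime: "p' \<ge> 1" "\<zeta> ^ p' \<in> range (\<lambda>i::int. q powi i)"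
proof -
  \<comment> \<open>The exponent p itself is admissible, as its power of \<zeta> is q^0.\<close>
  have "p \<ge> 1 \<and> \<zeta> ^ p \<in> range (\<lambda>i::int. q powi i)"
    using root rangeI[of "\<lambda>i::int. q powi i" 0] by (auto simp: primitive_root_of_unity_def)
  from LeastI[of "\<lambda>m. m \<ge> 1 \<and> \<zeta> ^ m \<in> range (\<lambda>i::int. q powi i)", OF this]
  show "p' \<ge> 1" "\<zeta> ^ p' \<in> range (\<lambda>i::int. q powi i)" by (auto simp: p_prime_def)
qed

lemma eta: "\<eta> \<in> index_set q" "\<zeta> ^ p' = q powi \<eta>"
proof -
  obtain i :: int where "\<zeta> ^ p' = q powi i" using p_prime by blast
  then have "i mod e \<in> index_set q \<and> \<zeta> ^ p' = q powi (i mod e)"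
    using q by (simp add: powi_mod_mult_order)
  then have "\<exists>!i. i \<in> index_set q \<and> \<zeta> ^ p' = q powi i"
    using powi_inj_index_set[OF q(1)] by (intro ex1I[of _ "i mod e"]) auto
  from theI'[OF this] show "\<eta> \<in> index_set q" "\<zeta> ^ p' = q powi \<eta>" by (auto simp: eta_def)
qed

text \<open>Multiplication by \<zeta>^-1 in coordinates. For j = 1 the exponent of \<zeta> would
  drop to 0, which is outside {1..p'}; there q^i is rewritten as \<zeta>^p' q^(i-\<eta>), using
  \<zeta>^p' = q^\<eta>.\<close>

definition rotate :: "vertex \<Rightarrow> vertex" where
  "rotate = (\<lambda>(i, j). if j > 1 then (i, j - 1) else ((i - \<eta>) mod e, p'))"

lemma rotate_bij: "bij_betw rotate V V"
proof (rule bij_betw_byWitness)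
  let ?r = "\<lambda>(i, j). if j < p' then (i, j + 1) else ((i + \<eta>) mod e, 1)"
  show "\<forall>v\<in>V. ?r (rotate v) = v"
    by (auto simp: vertices_def rotate_def mod_simps index_set_def)
  show "\<forall>v\<in>V. rotate (?r v) = v"
    by (auto simp: vertices_def rotate_def mod_simps index_set_def)
  show "rotate ` V \<subseteq> V" "?r ` V \<subseteq> V"
    using p_prime(1) by (auto simp: vertices_def rotate_def split: if_splits)
qed

lemma vval_rotate: "v \<in> V \<Longrightarrow> vval q \<zeta> (rotate v) = inverse \<zeta> * vval q \<zeta> v"
proof -
  assume v: "v \<in> V"
  obtain i j where ij: "v = (i, j)" by force
  show ?thesis
  proof (cases "j > 1")
    case True
    then obtain j' where "j = Suc j'" by (cases j) auto
    with True ij \<zeta> show ?thesis by (simp add: rotate_def vval_def)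
  next
    case False
    then have "j = 1" using v ij by (auto simp: vertices_def)
    have "\<zeta> ^ p' * q powi ((i - \<eta>) mod e) = q powi \<eta> * q powi (i - \<eta>)"
      using q by (simp add: eta powi_mod_mult_order)
    also have "\<dots> = q powi i" using q by (simp flip: power_int_add)
    finally show ?thesis using \<zeta> ij \<open>j = 1\<close> by (simp add: rotate_def vval_def)
  qed
qed

text \<open>The first coordinate changes only at the wrap-around from j = 1, where the invariance of
  the weight is applied at the index i - \<eta>.\<close>

lemma weight_rotate: "v \<in> V \<Longrightarrow> \<Lambda> (fst (rotate v)) = \<Lambda> (fst v)"
  using weight[of "(fst v - \<eta>) mod e"]
  by (auto simp: rotate_def vertices_def mod_simps index_set_def split: prod.splits)

text \<open>The target block is prescribed and the source is found by pulling back, because the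
  coordinate at \<beta> of the image of a shifted element is what has to be computed.\<close>

lemma rescaling_rotate:
  assumes \<beta>: "\<beta> \<in> compositions q \<zeta> n"
  defines "\<alpha> \<equiv> (\<lambda>v. if v \<in> V then \<beta> (rotate v) else 0)"
  shows "\<alpha> \<in> compositions q \<zeta> n" "rescaling q \<zeta> n \<Lambda> \<alpha> \<beta> rotate (inverse \<zeta>)"
proof -
  have V: "{w. \<beta> w \<noteq> 0} \<subseteq> V" using \<beta> by (auto simp: compositions_def)
  have inj: "inj_on rotate {v. \<alpha> v \<noteq> 0}"
    using rotate_bij by (rule inj_on_subset[OF bij_betw_imp_inj_on]) (auto simp: \<alpha>_def split: if_splits)
  have img: "rotate ` {v. \<alpha> v \<noteq> 0} = {w. \<beta> w \<noteq> 0}"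
  proof (intro subset_antisym subsetI)
    fix w assume "w \<in> {w. \<beta> w \<noteq> 0}"
    moreover then obtain v where "v \<in> V" "w = rotate v"
      using V rotate_bij unfolding bij_betw_def by blast
    ultimately show "w \<in> rotate ` {v. \<alpha> v \<noteq> 0}" by (auto simp: \<alpha>_def)
  qed (auto simp: \<alpha>_def split: if_splits)
  have "finite {v. \<alpha> v \<noteq> 0}"
    using \<beta> finite_imageD[OF _ inj] unfolding img by (simp add: compositions_def)
  moreover have "(\<Sum>v | \<alpha> v \<noteq> 0. \<alpha> v) = (\<Sum>w | \<beta> w \<noteq> 0. \<beta> w)"
    unfolding img[symmetric] sum.reindex[OF inj]
    by (rule sum.cong) (auto simp: \<alpha>_def split: if_splits)
  ultimately show *: "\<alpha> \<in> compositions q \<zeta> n"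
    using \<beta> by (auto simp: compositions_def \<alpha>_def split: if_splits)
  show "rescaling q \<zeta> n \<Lambda> \<alpha> \<beta> rotate (inverse \<zeta>)"
    by unfold_locales
       (use * \<beta> n q \<zeta> rotate_bij vval_rotate weight_rotate in \<open>auto simp: \<alpha>_def\<close>)
qed

end

section \<open>Fixed points of a cyclic extension\<close>

text \<open>
  If the algebra is \<open>\<Sum>\<^sub>i S\<^sup>i B\<close>, where \<open>B\<close> is fixed by \<open>\<sigma>\<close> and \<open>\<sigma> S = z S\<close>, then the
  fixed points of \<open>\<sigma>\<close> are \<open>B\<close>: they are unchanged by the product of the operators
  \<open>(\<sigma> - z\<^sup>j) / (1 - z\<^sup>j)\<close> for \<open>0 < j < p\<close>, and this product annihilates \<open>S\<^sup>j B\<close>.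
\<close>
locale cyclic_extension = assoc_algebra R for R :: "('f::field, 'a) module" (structure) +
  fixes \<sigma> :: "'a \<Rightarrow> 'a" and S S' :: 'a and B :: "'a set" and z :: 'f and p :: nat
  assumes \<sigma>: "alg_hom R R \<sigma>"
    and S: "S \<in> carrier R" "S' \<in> carrier R" "S \<otimes> S' = \<one>" "S' \<otimes> S = \<one>"
    and B: "subring B R" and B_smult: "b \<in> B \<Longrightarrow> c \<odot> b \<in> B"
    and \<sigma>_B: "b \<in> B \<Longrightarrow> \<sigma> b = b" and \<sigma>_S: "\<sigma> S = z \<odot> S"
    and p: "p \<ge> 1" and S_p: "S [^] p \<in> B" and conj: "b \<in> B \<Longrightarrow> S' \<otimes> b \<otimes> S \<in> B"
    and z: "0 < i \<Longrightarrow> i < p \<Longrightarrow> z ^ i \<noteq> 1"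
begin

lemmas B_zero = subringE(2)[OF B] and B_one = subringE(3)[OF B]
  and B_mult = subringE(6)[OF B] and B_add = subringE(7)[OF B]

lemma B_closed [simp]: "b \<in> B \<Longrightarrow> b \<in> carrier R"
  using subringE(1)[OF B] by blast

definition W :: "'a set" where
  "W = add_span R {S [^] i \<otimes> b | i b. i < p \<and> b \<in> B}"

lemma \<sigma>_hom:
  "x \<in> carrier R \<Longrightarrow> \<sigma> x \<in> carrier R"
  "x \<in> carrier R \<Longrightarrow> y \<in> carrier R \<Longrightarrow> \<sigma> (x \<oplus> y) = \<sigma> x \<oplus> \<sigma> y"
  "x \<in> carrier R \<Longrightarrow> y \<in> carrier R \<Longrightarrow> \<sigma> (x \<otimes> y) = \<sigma> x \<otimes> \<sigma> y"
  "x \<in> carrier R \<Longrightarrow> \<sigma> (c \<odot> x) = c \<odot> \<sigma> x" "\<sigma> \<one> = \<one>"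
  using \<sigma> by (auto simp: alg_hom_def ring_hom_def)

lemma W_closed: "x \<in> W \<Longrightarrow> x \<in> carrier R"
  unfolding W_def by (rule add_span_closed) (use S in auto)

lemma S_power_B: "i \<le> p \<Longrightarrow> b \<in> B \<Longrightarrow> S [^] i \<otimes> b \<in> W"
proof (cases "i = p")
  case True
  assume "b \<in> B"
  then have "\<one> \<otimes> (S [^] p \<otimes> b) = S [^] (0::nat) \<otimes> (S [^] p \<otimes> b) \<and> 0 < p \<and> S [^] p \<otimes> b \<in> B"
    using p B_mult[OF S_p] by simp
  then have "\<one> \<otimes> (S [^] p \<otimes> b) \<in> W"
    unfolding W_def by (intro add_span.incl) blast
  then show ?thesis using True S \<open>b \<in> B\<close> by simp
next
  case False
  assume "i \<le> p" "b \<in> B"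
  then have "i < p" using False by simp
  with \<open>b \<in> B\<close> show ?thesis unfolding W_def by (intro add_span.incl) blast
qed

lemma one_W: "\<one> \<in> W"
  using S_power_B[of 0 \<one>] B_one by simp

lemma W_mult_S: "x \<in> W \<Longrightarrow> S \<otimes> x \<in> W"
  unfolding W_def
proof (induction rule: add_span.induct)
  case zero
  then show ?case using S by (simp add: add_span.zero)
next
  case (incl x)
  then obtain i b where ib: "x = S [^] i \<otimes> b" "i < p" "b \<in> B" by blast
  then have "S \<otimes> x = S [^] Suc i \<otimes> b"
    using S by (subst nat_pow_Suc2) (simp_all add: m_assoc)
  also have "\<dots> \<in> W" using ib by (intro S_power_B) auto
  finally show ?case by (simp add: W_def)
next
  case (add x y)
  then show ?case
    using S W_closed by (subst r_distr) (auto simp: W_def intro: add_span.add)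
qed

text \<open>An element b passes one factor at a time: b S = S (S' b S), and conjugation stays in
  B.\<close>

lemma B_mult_S_power: "b \<in> B \<Longrightarrow> \<exists>b'\<in>B. b \<otimes> S [^] (i::nat) = S [^] i \<otimes> b'"
proof (induction i arbitrary: b)
  case 0
  then show ?case by (intro bexI[of _ b]) auto
next
  case (Suc i)
  then obtain b' where b': "b' \<in> B" "b \<otimes> S [^] i = S [^] i \<otimes> b'" by blast
  have "b \<otimes> S [^] Suc i = (b \<otimes> S [^] i) \<otimes> S"
    using Suc.prems S by (simp add: m_assoc)
  also have "\<dots> = S [^] i \<otimes> ((S \<otimes> S') \<otimes> b' \<otimes> S)"
    unfolding b'(2) using b'(1) S by (simp add: m_assoc)
  also have "\<dots> = S [^] Suc i \<otimes> (S' \<otimes> b' \<otimes> S)"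
    using b'(1) S(1,2) by (simp add: m_assoc)
  finally show ?case using conj[OF b'(1)] by blast
qed

lemma W_mult_B:
  assumes b: "b \<in> B" shows "x \<in> W \<Longrightarrow> b \<otimes> x \<in> W"
  unfolding W_def
proof (induction rule: add_span.induct)
  case zero
  then show ?case using b by (simp add: add_span.zero)
next
  case (incl x)
  then obtain i b' where x: "x = S [^] i \<otimes> b'" "i < p" "b' \<in> B" by blast
  obtain b'' where b'': "b'' \<in> B" "b \<otimes> S [^] i = S [^] i \<otimes> b''" using B_mult_S_power[OF b] by blast
  have "b \<otimes> x = (b \<otimes> S [^] i) \<otimes> b'" using x b S by (simp add: m_assoc)
  also have "\<dots> = S [^] i \<otimes> (b'' \<otimes> b')" unfolding b''(2) using x b''(1) S by (simp add: m_assoc)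
  also have "\<dots> \<in> W" using x b'' by (intro S_power_B B_mult) auto
  finally show ?case by (simp add: W_def)
next
  case (add x y)
  then show ?case
    using b W_closed by (subst r_distr) (auto simp: W_def intro: add_span.add)
qed

primrec proj :: "nat \<Rightarrow> 'a \<Rightarrow> 'a" where
  "proj 0 x = x"
| "proj (Suc m) x = inverse (1 - z ^ Suc m) \<odot> (\<sigma> (proj m x) \<oplus> (- (z ^ Suc m)) \<odot> proj m x)"

lemma proj_closed: "x \<in> carrier R \<Longrightarrow> proj m x \<in> carrier R"
  by (induction m) (simp_all add: \<sigma>_hom)

lemma proj_add:
  "x \<in> carrier R \<Longrightarrow> y \<in> carrier R \<Longrightarrow> proj m (x \<oplus> y) = proj m x \<oplus> proj m y"
  by (induction m) (simp_all add: \<sigma>_hom proj_closed smult_add_right a_ac)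

lemma proj_eigen:
  assumes "v \<in> carrier R" "\<sigma> v = c \<odot> v"
  shows "proj m v = (\<Prod>j=1..m. (c - z ^ j) / (1 - z ^ j)) \<odot> v"
proof (induction m)
  case (Suc m)
  let ?a = "\<Prod>j=1..m. (c - z ^ j) / (1 - z ^ j)"
  have "proj (Suc m) v = inverse (1 - z ^ Suc m) \<odot> (\<sigma> (?a \<odot> v) \<oplus> (- (z ^ Suc m)) \<odot> (?a \<odot> v))"
    by (simp only: proj.simps Suc)
  also have "\<dots> = (inverse (1 - z ^ Suc m) * (?a * c + - (z ^ Suc m) * ?a)) \<odot> v"
    using assms by (simp only: \<sigma>_hom smult_smult smult_closed smult_add_left[symmetric])
  also have "inverse (1 - z ^ Suc m) * (?a * c + - (z ^ Suc m) * ?a) = ?a * ((c - z ^ Suc m) / (1 - z ^ Suc m))"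
    by (simp only: divide_inverse) (simp add: algebra_simps)
  also have "\<dots> = (\<Prod>j=1..Suc m. (c - z ^ j) / (1 - z ^ j))"
    by simp
  finally show ?case .
qed (use assms in simp)

lemma proj_fixed:
  assumes "v \<in> carrier R" "\<sigma> v = v" "m < p"
  shows "proj m v = v"
proof -
  have "(\<Prod>j=1..m. (1 - z ^ j) / (1 - z ^ j)) = 1"
    using z assms(3) by (intro prod.neutral) auto
  then show ?thesis using proj_eigen[of v 1 m] assms by simp
qed

lemma proj_W: "x \<in> W \<Longrightarrow> proj (p - 1) x \<in> B"
  unfolding W_def
proof (induction rule: add_span.induct)
  case zero
  have "\<sigma> \<zero> = \<zero>" using \<sigma>_hom(4)[of \<zero> 0] \<sigma>_hom(1)[of \<zero>] by simp
  then show ?case using p B_zero by (simp add: proj_fixed)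
next
  case (incl x)
  then obtain i b where x: "x = S [^] i \<otimes> b" "i < p" "b \<in> B" by blast
  have pow: "\<sigma> (S [^] j) = z ^ j \<odot> S [^] j" for j :: nat
    by (induction j) (use S in \<open>simp_all add: \<sigma>_hom \<sigma>_S smult_mult_left smult_mult_right smult_smult mult.commute\<close>)
  have x': "x \<in> carrier R" "\<sigma> x = z ^ i \<odot> x"
    using x S by (simp_all add: \<sigma>_hom \<sigma>_B pow smult_mult_left)
  show ?case
  proof (cases "i = 0")
    case True
    then show ?thesis using x p by (simp add: proj_fixed \<sigma>_B)
  next
    case False
    \<comment> \<open>The eigenvalue is z^i with 0 < i \<le> p - 1, so the factor with j = i occurs
      in the product and vanishes.\<close>
    then have P0: "(\<Prod>j=1..p - 1. (z ^ i - z ^ j) / (1 - z ^ j)) = 0"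
      using x(2) by (intro prod_zero) (auto intro!: bexI[of _ i])
    show ?thesis unfolding proj_eigen[OF x'] P0 using x'(1) B_zero by simp
  qed
next
  case (add x y)
  then show ?case using W_closed by (simp add: W_def proj_add B_add)
qed

lemma fixed_in_B: "x \<in> W \<Longrightarrow> \<sigma> x = x \<Longrightarrow> x \<in> B"
  using proj_W[of x] proj_fixed[of x "p - 1"] p W_closed by auto

end

text \<open>Let u = S' t S. Then u t = S' S' T S T S, which the braid relation turns into S' T S T =
  t T. The quadratic relation, conjugated by S, makes q^-1 (t - (q - 1)) the inverse of t. In this
  polynomial form u visibly lies in every subalgebra containing t and T.\<close>

lemma (in assoc_algebra) conjugate_relation:
  assumes S: "S \<in> carrier R" "S' \<in> carrier R" "S \<otimes> S' = \<one>" "S' \<otimes> S = \<one>" and T: "T \<in> carrier R"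
    and braid: "S \<otimes> T \<otimes> S \<otimes> T = T \<otimes> S \<otimes> T \<otimes> S"
    and quadratic: "T \<otimes> (T \<ominus> (q - 1) \<odot> \<one>) = q \<odot> \<one>" and q: "q \<noteq> 0"
    and t: "t = S' \<otimes> T \<otimes> S"
  shows "S' \<otimes> t \<otimes> S = inverse q \<odot> (t \<otimes> T \<otimes> (t \<ominus> (q - 1) \<odot> \<one>))"
proof -
  have tc: "t \<in> carrier R" unfolding t using S T by simp
  let ?u = "S' \<otimes> t \<otimes> S" and ?v = "t \<ominus> (q - 1) \<odot> \<one>" and ?w = "T \<ominus> (q - 1) \<odot> \<one>"
  have v: "?v \<in> carrier R" "?u \<in> carrier R" "?w \<in> carrier R" using tc S T by auto
  have SS: "S \<otimes> (S' \<otimes> x) = x" "S' \<otimes> (S \<otimes> x) = x" if "x \<in> carrier R" for x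
    using S that by (simp_all flip: m_assoc)
  have "?v = S' \<otimes> ?w \<otimes> S"
    unfolding t using S T
    by (simp add: a_minus_def l_distr r_distr l_minus r_minus smult_mult_left smult_mult_right)
  then have "t \<otimes> ?v = S' \<otimes> (T \<otimes> ?w) \<otimes> S"
    unfolding t using S(1,2) T v(3) by (simp add: m_assoc SS)
  also have "\<dots> = q \<odot> \<one>"
    unfolding quadratic using S by (simp add: smult_mult_left smult_mult_right)
  finally have tv: "t \<otimes> ?v = q \<odot> \<one>" .
  have "?u \<otimes> t = S' \<otimes> (S' \<otimes> (T \<otimes> S \<otimes> T \<otimes> S))"
    unfolding t using S(1,2) T by (simp add: m_assoc SS)
  also have "\<dots> = t \<otimes> T"
    unfolding braid[symmetric] t using S(1,2) T by (simp add: m_assoc SS)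
  finally have ut: "?u \<otimes> t = t \<otimes> T" .
  have "q \<odot> ?u = ?u \<otimes> (q \<odot> \<one>)" using v by (simp add: smult_mult_right)
  also have "\<dots> = (?u \<otimes> t) \<otimes> ?v" unfolding tv[symmetric] using v tc by (simp add: m_assoc)
  finally have "inverse q \<odot> (q \<odot> ?u) = inverse q \<odot> (t \<otimes> T \<otimes> ?v)" unfolding ut by simp
  then show ?thesis using v q by (simp add: smult_smult)
qed

lemma (in assoc_algebra) smult_nat_pow:
  "x \<in> carrier R \<Longrightarrow> (c \<odot> x) [^] (m::nat) = c ^ m \<odot> x [^] m"
  by (induction m) (simp_all add: smult_mult_left smult_mult_right smult_smult mult.commute)

section \<open>The Hecke algebras\<close>

lemma poly_at_closed [simp]: "x \<in> carrier (free_alg G) \<Longrightarrow> poly_at P x \<in> carrier (free_alg G)"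
  by (simp add: poly_at_def)

text \<open>Splitting off the constant term is what yields an inverse of S from the cyclotomic
  relation.\<close>

lemma poly_at_pCons:
  fixes x :: "('g, 'f::field) free_algebra"
  shows "poly_at (pCons a P) x = const a + x * poly_at P x" "poly_at P x * x = x * poly_at P x"
proof -
  have superset: "poly_at R x = (\<Sum>m\<le>N. const (coeff R m) * x ^ m)" if "degree R \<le> N" for R N
    unfolding poly_at_def using that
    by (intro sum.mono_neutral_left) (auto simp: coeff_eq_0 const_simps)
  have swap: "const c * (x * x ^ m) = x * (const c * x ^ m)" for c m
    by (simp only: mult.assoc[symmetric] const_central[of c x])
  have "poly_at (pCons a P) x = (\<Sum>m\<le>Suc (degree P). const (coeff (pCons a P) m) * x ^ m)"
    by (rule superset) (rule degree_pCons_le)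
  also have "\<dots> = const a + (\<Sum>m\<le>degree P. x * (const (coeff P m) * x ^ m))"
    by (simp add: sum.atMost_Suc_shift swap del: sum.atMost_Suc)
  finally show "poly_at (pCons a P) x = const a + x * poly_at P x"
    by (simp add: poly_at_def sum_distrib_left)
  show "poly_at P x * x = x * poly_at P x"
    by (simp add: poly_at_def sum_distrib_left sum_distrib_right mult.assoc power_commutes swap)
qed

lemma alt_prod_closed [simp]:
  "x \<in> carrier (free_alg G) \<Longrightarrow> y \<in> carrier (free_alg G) \<Longrightarrow> alt_prod m x y \<in> carrier (free_alg G)"
  by (induction m arbitrary: x y) auto

lemma presentation_hecke:
  fixes q \<zeta> :: "'f::field"
  assumes "n \<ge> 2"
  shows "presentation (hecke_gens n) (hecke_rels q \<zeta> n \<Lambda>)"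
  by standard
     (use assms in \<open>auto simp: hecke_rels_def hecke_gens_def Let_def simp del: mult_eq_0_iff\<close>)

lemma presentation_phecke:
  fixes q :: "'f::field"
  assumes "n \<ge> 2"
  shows "presentation (phecke_gens n) (phecke_rels q p n L)"
  by standard
     (use assms in \<open>auto simp: phecke_rels_def phecke_gens_def Let_def\<close>)

locale hecke_data = shift_data q \<zeta> p n \<Lambda> for q \<zeta> :: "'f::field" and p n \<Lambda> +
  fixes L :: "int \<Rightarrow> nat" and \<epsilon> :: 'f
    and \<sigma> :: "(hgen, 'f) free_algebra set \<Rightarrow> (hgen, 'f) free_algebra set"
    and \<phi> :: "(pgen, 'f) free_algebra set \<Rightarrow> (hgen, 'f) free_algebra set"
    and f :: "(hgen, 'f) free_algebra set \<Rightarrow> (vertex \<Rightarrow> nat) \<Rightarrow> (qgen, 'f) free_algebra set"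
  assumes bk: "is_bk_isomorphism \<epsilon> q \<zeta> n \<Lambda> f" and shift: "is_shift q \<zeta> n \<Lambda> \<sigma>"
    and ariki: "is_ariki_embedding q \<zeta> p n \<Lambda> L \<phi>"
begin

sublocale H: presentation "hecke_gens n" "hecke_rels q \<zeta> n \<Lambda>"
  by (rule presentation_hecke[OF n])

sublocale P: presentation "phecke_gens n" "phecke_rels q p n L"
  by (rule presentation_phecke[OF n])

abbreviation "S \<equiv> H.cl (gen HS)"
abbreviation "T a \<equiv> H.cl (gen (HT a))"

lemma hecke_gens_simps [simp]: "HS \<in> hecke_gens n" "HT a \<in> hecke_gens n \<longleftrightarrow> a \<in> {1..<n}"
  by (auto simp: hecke_gens_def)

lemma phecke_gens_simps [simp]: "PS \<in> phecke_gens n" "PT' \<in> phecke_gens n" "PT a \<in> phecke_gens n \<longleftrightarrow> a \<in> {1..<n}"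
  by (auto simp: phecke_gens_def)

lemma S_T_closed [simp]: "S \<in> carrier H.Q" "a \<in> {1..<n} \<Longrightarrow> T a \<in> carrier H.Q" "T 1 \<in> carrier H.Q" "T (Suc 0) \<in> carrier H.Q"
  using n by auto

lemma \<sigma>_alg_hom: "alg_hom H.Q H.Q \<sigma>"
  using shift by (simp add: is_shift_def alg_iso_def hecke_def Let_def)

lemma \<sigma>_hom:
  "x \<in> carrier H.Q \<Longrightarrow> \<sigma> x \<in> carrier H.Q"
  "x \<in> carrier H.Q \<Longrightarrow> y \<in> carrier H.Q \<Longrightarrow> \<sigma> (x \<oplus>\<^bsub>H.Q\<^esub> y) = \<sigma> x \<oplus>\<^bsub>H.Q\<^esub> \<sigma> y"
  "x \<in> carrier H.Q \<Longrightarrow> y \<in> carrier H.Q \<Longrightarrow> \<sigma> (x \<otimes>\<^bsub>H.Q\<^esub> y) = \<sigma> x \<otimes>\<^bsub>H.Q\<^esub> \<sigma> y"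
  "x \<in> carrier H.Q \<Longrightarrow> \<sigma> (c \<odot>\<^bsub>H.Q\<^esub> x) = c \<odot>\<^bsub>H.Q\<^esub> \<sigma> x" "\<sigma> \<one>\<^bsub>H.Q\<^esub> = \<one>\<^bsub>H.Q\<^esub>"
  using \<sigma>_alg_hom by (auto simp: alg_hom_def ring_hom_def)

lemma \<sigma>_gens: "\<sigma> S = \<zeta> \<odot>\<^bsub>H.Q\<^esub> S" "a \<in> {1..<n} \<Longrightarrow> \<sigma> (T a) = T a"
  using shift by (simp_all add: is_shift_def hecke_def hcl_def Let_def)

sublocale \<sigma>: ring_hom_ring H.Q H.Q \<sigma>
  using \<sigma>_alg_hom by (intro ring_hom_ringI2 H.ring_presented) (simp add: alg_hom_def)

lemma \<phi>_alg_hom: "alg_hom P.Q H.Q \<phi>"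
  using ariki by (simp add: is_ariki_embedding_def hecke_def phecke_def Let_def)

lemma \<phi>_smult: "y \<in> carrier P.Q \<Longrightarrow> \<phi> (c \<odot>\<^bsub>P.Q\<^esub> y) = c \<odot>\<^bsub>H.Q\<^esub> \<phi> y"
  using \<phi>_alg_hom by (simp add: alg_hom_def)

sublocale \<phi>: ring_hom_ring P.Q H.Q \<phi>
  using \<phi>_alg_hom by (intro ring_hom_ringI2 H.ring_presented P.ring_presented) (simp add: alg_hom_def)

lemma \<phi>_gens:
  "\<phi> (P.cl (gen PS)) = S [^]\<^bsub>H.Q\<^esub> p"
  "\<phi> (P.cl (gen PT')) = inv\<^bsub>H.Q\<^esub> S \<otimes>\<^bsub>H.Q\<^esub> T 1 \<otimes>\<^bsub>H.Q\<^esub> S"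
  "a \<in> {1..<n} \<Longrightarrow> \<phi> (P.cl (gen (PT a))) = T a"
  using ariki by (simp_all add: is_ariki_embedding_def hecke_def phecke_def hcl_def pcl_def Let_def)

text \<open>The roots \<zeta>^j q^i are nonzero, so the cyclotomic polynomial is a + X R with a
  nonzero constant a, and -a^-1 R(S) is the inverse.\<close>

lemma S_unit: "S \<in> Units H.Q"
proof -
  define Pol where "Pol = (\<Prod>i\<in>weight_supp q \<Lambda>. \<Prod>j\<in>{1..p'}. [:- (\<zeta> ^ j * q powi i), 1:] ^ \<Lambda> i)"
  obtain a R where aR: "Pol = pCons a R" by (cases Pol)
  \<comment> \<open>Over an infinite support the product would be 1 by convention, whose value at 0
    is nonzero too.\<close>
  have "poly Pol 0 \<noteq> 0"
    using q \<zeta> by (cases "finite (weight_supp q \<Lambda>)") (auto simp: Pol_def poly_prod)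
  then have a: "a \<noteq> 0" using aR by simp
  have J: "poly_at Pol (gen HS) - 0 \<in> H.J"
    by (rule H.rels_in_ideal) (simp add: hecke_rels_def Pol_def Let_def)
  let ?y = "const (- inverse a) * poly_at R (gen HS)"
  have y: "?y \<in> carrier H.A" by simp
  have R: "gen HS * poly_at R (gen HS) = poly_at Pol (gen HS) - const a"
    "poly_at R (gen HS) * gen HS = poly_at Pol (gen HS) - const a"
    by (simp_all add: aR poly_at_pCons)
  have one: "const (- inverse a) * (- const a) = 1"
    using a by (simp add: const_simps flip: const_simps(4))
  have "gen HS * ?y - 1 = const (- inverse a) * (poly_at Pol (gen HS) - const a) - 1"
    unfolding R(1)[symmetric] by (metis const_central mult.assoc)
  also have "\<dots> = const (- inverse a) * poly_at Pol (gen HS)"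
    using one by (simp add: right_diff_distrib)
  also have "\<dots> \<in> H.J" using J by (auto intro: H.rel_ideal_closed(6))
  finally have 1: "S \<otimes>\<^bsub>H.Q\<^esub> H.cl ?y = \<one>\<^bsub>H.Q\<^esub>"
    using y by (simp add: H.presented_simps(2) H.cl_eq_iff flip: H.cl_mult)
  have "?y * gen HS - 1 = const (- inverse a) * (poly_at Pol (gen HS) - const a) - 1"
    unfolding R(2)[symmetric] by (simp only: mult.assoc)
  also have "\<dots> = const (- inverse a) * poly_at Pol (gen HS)"
    using one by (simp add: right_diff_distrib)
  also have "\<dots> \<in> H.J" using J by (auto intro: H.rel_ideal_closed(6))
  finally have 2: "H.cl ?y \<otimes>\<^bsub>H.Q\<^esub> S = \<one>\<^bsub>H.Q\<^esub>"
    using y by (simp add: H.presented_simps(2) H.cl_eq_iff flip: H.cl_mult)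
  have "H.cl ?y \<in> carrier H.Q" using y by (rule H.cl_closed)
  then show ?thesis unfolding Units_def using 1 2 by auto
qed

section \<open>The image of \<phi> under conjugation by S and under the shift\<close>

abbreviation "S' \<equiv> inv\<^bsub>H.Q\<^esub> S"
abbreviation "B \<equiv> \<phi> ` carrier P.Q"
abbreviation "T' \<equiv> S' \<otimes>\<^bsub>H.Q\<^esub> T 1 \<otimes>\<^bsub>H.Q\<^esub> S"

lemma S': "S' \<in> carrier H.Q" "S \<otimes>\<^bsub>H.Q\<^esub> S' = \<one>\<^bsub>H.Q\<^esub>" "S' \<otimes>\<^bsub>H.Q\<^esub> S = \<one>\<^bsub>H.Q\<^esub>"
  using S_unit by auto

lemma subring_B: "subring B H.Q"
  by (rule \<phi>.img_is_subring) (rule ring.carrier_is_subring[OF P.ring_presented])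

lemma B_smult: "b \<in> B \<Longrightarrow> c \<odot>\<^bsub>H.Q\<^esub> b \<in> B"
  by (auto simp flip: \<phi>_smult)

lemma B_gens: "S [^]\<^bsub>H.Q\<^esub> p \<in> B" "T' \<in> B" "a \<in> {1..<n} \<Longrightarrow> T a \<in> B"
  unfolding \<phi>_gens(1,2)[symmetric] by (simp_all add: \<phi>_gens(3)[symmetric])

lemma hecke_relations:
  "S \<otimes>\<^bsub>H.Q\<^esub> T 1 \<otimes>\<^bsub>H.Q\<^esub> S \<otimes>\<^bsub>H.Q\<^esub> T 1 = T 1 \<otimes>\<^bsub>H.Q\<^esub> S \<otimes>\<^bsub>H.Q\<^esub> T 1 \<otimes>\<^bsub>H.Q\<^esub> S"
  "1 < a \<Longrightarrow> a < n \<Longrightarrow> S \<otimes>\<^bsub>H.Q\<^esub> T a = T a \<otimes>\<^bsub>H.Q\<^esub> S"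
  "T 1 \<otimes>\<^bsub>H.Q\<^esub> (T 1 \<ominus>\<^bsub>H.Q\<^esub> (q - 1) \<odot>\<^bsub>H.Q\<^esub> \<one>\<^bsub>H.Q\<^esub>) = q \<odot>\<^bsub>H.Q\<^esub> \<one>\<^bsub>H.Q\<^esub>"
proof -
  have g: "gen HS \<in> carrier H.A" "gen (HT 1) \<in> carrier H.A" using n by auto
  have "H.cl (gen HS * gen (HT 1) * gen HS * gen (HT 1)) = H.cl (gen (HT 1) * gen HS * gen (HT 1) * gen HS)"
    by (rule H.cl_rel) (simp add: hecke_rels_def Let_def)
  moreover have "H.cl (x * y * x * y) = H.cl x \<otimes>\<^bsub>H.Q\<^esub> H.cl y \<otimes>\<^bsub>H.Q\<^esub> H.cl x \<otimes>\<^bsub>H.Q\<^esub> H.cl y"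
    if "x \<in> carrier H.A" "y \<in> carrier H.A" for x y
    using that by (simp add: H.cl_mult)
  ultimately show "S \<otimes>\<^bsub>H.Q\<^esub> T 1 \<otimes>\<^bsub>H.Q\<^esub> S \<otimes>\<^bsub>H.Q\<^esub> T 1 = T 1 \<otimes>\<^bsub>H.Q\<^esub> S \<otimes>\<^bsub>H.Q\<^esub> T 1 \<otimes>\<^bsub>H.Q\<^esub> S"
    using g by metis
  show "S \<otimes>\<^bsub>H.Q\<^esub> T a = T a \<otimes>\<^bsub>H.Q\<^esub> S" if "1 < a" "a < n"
  proof -
    have "H.cl (gen HS * gen (HT a)) = H.cl (gen (HT a) * gen HS)"
      by (rule H.cl_rel) (use that in \<open>auto simp: hecke_rels_def Let_def\<close>)
    then show ?thesis using g(1) that by (simp add: H.cl_mult)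
  qed
  let ?t = "gen (HT 1) :: (hgen, 'f) free_algebra"
  have "(?t + 1) * (?t - const q) - 0 \<in> H.J"
    by (rule H.rels_in_ideal) (use n in \<open>auto simp: hecke_rels_def Let_def\<close>)
  also have "(?t + 1) * (?t - const q) - 0 = ?t * (?t - const (q - 1) * 1) - const q * 1"
    by (simp add: algebra_simps const_simps)
  finally have "H.cl (?t * (?t - const (q - 1) * 1)) = H.cl (const q * 1)"
    using g by (subst H.cl_eq_iff) auto
  then show "T 1 \<otimes>\<^bsub>H.Q\<^esub> (T 1 \<ominus>\<^bsub>H.Q\<^esub> (q - 1) \<odot>\<^bsub>H.Q\<^esub> \<one>\<^bsub>H.Q\<^esub>) = q \<odot>\<^bsub>H.Q\<^esub> \<one>\<^bsub>H.Q\<^esub>"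
    using g by (simp only: H.presented_simps(2) H.smult_cl free_alg_closed H.cl_mult H.cl_diff
        free_alg_mult_closed free_alg_diff_closed)
qed

lemma S_mult_S' [simp]:
  assumes "x \<in> carrier H.Q"
  shows "S \<otimes>\<^bsub>H.Q\<^esub> (S' \<otimes>\<^bsub>H.Q\<^esub> x) = x" "S' \<otimes>\<^bsub>H.Q\<^esub> (S \<otimes>\<^bsub>H.Q\<^esub> x) = x"
  using S' assms S_T_closed by (simp_all flip: H.m_assoc)

text \<open>On generators: S commutes with S^p and with T_a for a > 1, and it conjugates T_1 to T'.
  Only T' needs the braid and quadratic relations.\<close>

lemma conj_B: "b \<in> B \<Longrightarrow> S' \<otimes>\<^bsub>H.Q\<^esub> b \<otimes>\<^bsub>H.Q\<^esub> S \<in> B"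
proof -
  note B = subringE(1)[OF subring_B] subringE(3,6,7)[OF subring_B]
  have B_closed: "b \<in> B \<Longrightarrow> b \<in> carrier H.Q" for b using B(1) by blast
  have "S' \<otimes>\<^bsub>H.Q\<^esub> \<phi> y \<otimes>\<^bsub>H.Q\<^esub> S \<in> B" if "y \<in> carrier P.Q" for y
    using that
  proof (induction rule: P.presented_induct)
    case (scalar c)
    have "S' \<otimes>\<^bsub>H.Q\<^esub> \<phi> (c \<odot>\<^bsub>P.Q\<^esub> \<one>\<^bsub>P.Q\<^esub>) \<otimes>\<^bsub>H.Q\<^esub> S = c \<odot>\<^bsub>H.Q\<^esub> \<one>\<^bsub>H.Q\<^esub>"
      using S' by (simp add: \<phi>_smult H.smult_mult_left H.smult_mult_right)
    then show ?case using B_smult B(2) by simp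
  next
    case (gen g)
    consider "g = PS" | "g = PT'" | a where "g = PT a" "a \<in> {1..<n}"
      using gen by (auto simp: phecke_gens_def)
    then show ?case
    proof cases
      case 1
      have "S [^]\<^bsub>H.Q\<^esub> p \<otimes>\<^bsub>H.Q\<^esub> S = S \<otimes>\<^bsub>H.Q\<^esub> S [^]\<^bsub>H.Q\<^esub> p"
        using H.nat_pow_Suc2[OF S_T_closed(1), of p] by simp
      then have "S' \<otimes>\<^bsub>H.Q\<^esub> S [^]\<^bsub>H.Q\<^esub> p \<otimes>\<^bsub>H.Q\<^esub> S = S [^]\<^bsub>H.Q\<^esub> p"
        using S' by (simp add: H.m_assoc)
      then show ?thesis using 1 B_gens by (simp add: \<phi>_gens)
    next
      case 2
      have "T' \<ominus>\<^bsub>H.Q\<^esub> (q - 1) \<odot>\<^bsub>H.Q\<^esub> \<one>\<^bsub>H.Q\<^esub> = T' \<oplus>\<^bsub>H.Q\<^esub> (- (q - 1)) \<odot>\<^bsub>H.Q\<^esub> \<one>\<^bsub>H.Q\<^esub>"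
        by (simp only: a_minus_def H.smult_minus_left H.one_closed)
      then have "T' \<ominus>\<^bsub>H.Q\<^esub> (q - 1) \<odot>\<^bsub>H.Q\<^esub> \<one>\<^bsub>H.Q\<^esub> \<in> B"
        using B_gens(2) B(4) B_smult[OF B(2), of "- (q - 1)"] by simp
      then have "inverse q \<odot>\<^bsub>H.Q\<^esub> (T' \<otimes>\<^bsub>H.Q\<^esub> T 1 \<otimes>\<^bsub>H.Q\<^esub> (T' \<ominus>\<^bsub>H.Q\<^esub> (q - 1) \<odot>\<^bsub>H.Q\<^esub> \<one>\<^bsub>H.Q\<^esub>)) \<in> B"
        using B_gens(3)[of 1] n by (intro B_smult B(3)[OF B(3)[OF B_gens(2)]]) auto
      moreover have "S' \<otimes>\<^bsub>H.Q\<^esub> T' \<otimes>\<^bsub>H.Q\<^esub> S =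
          inverse q \<odot>\<^bsub>H.Q\<^esub> (T' \<otimes>\<^bsub>H.Q\<^esub> T 1 \<otimes>\<^bsub>H.Q\<^esub> (T' \<ominus>\<^bsub>H.Q\<^esub> (q - 1) \<odot>\<^bsub>H.Q\<^esub> \<one>\<^bsub>H.Q\<^esub>))"
        using S' q hecke_relations by (intro H.conjugate_relation) auto
      ultimately show ?thesis using 2 by (simp add: \<phi>_gens del: One_nat_def)
    next
      case (3 a)
      show ?thesis
      proof (cases "a = 1")
        case True
        then show ?thesis using 3 B_gens(2) by (simp add: \<phi>_gens)
      next
        case False
        then have "S' \<otimes>\<^bsub>H.Q\<^esub> T a \<otimes>\<^bsub>H.Q\<^esub> S = S' \<otimes>\<^bsub>H.Q\<^esub> (S \<otimes>\<^bsub>H.Q\<^esub> T a)"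
          using 3 S' by (simp add: H.m_assoc hecke_relations(2))
        then show ?thesis using 3 B_gens(3) by (simp add: \<phi>_gens)
      qed
    qed
  next
    case (add x y)
    then show ?case using S' B by (simp add: H.l_distr H.r_distr)
  next
    case (mult x y)
    then have "S' \<otimes>\<^bsub>H.Q\<^esub> \<phi> (x \<otimes>\<^bsub>P.Q\<^esub> y) \<otimes>\<^bsub>H.Q\<^esub> S =
      (S' \<otimes>\<^bsub>H.Q\<^esub> \<phi> x \<otimes>\<^bsub>H.Q\<^esub> S) \<otimes>\<^bsub>H.Q\<^esub> (S' \<otimes>\<^bsub>H.Q\<^esub> \<phi> y \<otimes>\<^bsub>H.Q\<^esub> S)"
      using S' by (simp add: H.m_assoc)
    then show ?case using mult B(3) by simp
  qed
  then show "b \<in> B \<Longrightarrow> S' \<otimes>\<^bsub>H.Q\<^esub> b \<otimes>\<^bsub>H.Q\<^esub> S \<in> B" by auto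
qed

text \<open>S^p is fixed because \<zeta>^p = 1, and in T' the factors \<zeta>^-1 from S' and \<zeta>
  from S cancel.\<close>

lemma \<sigma>_B: "b \<in> B \<Longrightarrow> \<sigma> b = b"
proof -
  have "\<sigma> S' = \<sigma> S' \<otimes>\<^bsub>H.Q\<^esub> (S \<otimes>\<^bsub>H.Q\<^esub> S')" using S' by simp
  also have "\<dots> = inverse \<zeta> \<odot>\<^bsub>H.Q\<^esub> (\<sigma> S' \<otimes>\<^bsub>H.Q\<^esub> \<sigma> S) \<otimes>\<^bsub>H.Q\<^esub> S'"
    using S' \<zeta> unfolding \<sigma>_gens
    by (simp add: H.m_assoc H.smult_mult_left H.smult_mult_right H.smult_smult)
  also have "\<sigma> S' \<otimes>\<^bsub>H.Q\<^esub> \<sigma> S = \<one>\<^bsub>H.Q\<^esub>" using S' by (simp flip: \<sigma>_hom(3) add: \<sigma>_hom(5))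
  finally have \<sigma>S': "\<sigma> S' = inverse \<zeta> \<odot>\<^bsub>H.Q\<^esub> S'" using S' by (simp add: H.smult_mult_left)
  have "\<sigma> (\<phi> y) = \<phi> y" if "y \<in> carrier P.Q" for y
    using that
  proof (induction rule: P.presented_induct)
    case (scalar c)
    then show ?case by (simp add: \<phi>_smult \<sigma>_hom)
  next
    case (gen g)
    consider "g = PS" | "g = PT'" | a where "g = PT a" "a \<in> {1..<n}"
      using gen by (auto simp: phecke_gens_def)
    then show ?case
    proof cases
      case 1
      have "\<sigma> (S [^]\<^bsub>H.Q\<^esub> p) = \<zeta> ^ p \<odot>\<^bsub>H.Q\<^esub> S [^]\<^bsub>H.Q\<^esub> p"
        by (simp add: \<sigma>.hom_nat_pow \<sigma>_gens H.smult_nat_pow)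
      then show ?thesis using 1 root by (simp add: \<phi>_gens primitive_root_of_unity_def)
    next
      case 2
      then show ?thesis using S' \<zeta> n
        by (simp add: \<phi>_gens \<sigma>S' \<sigma>_gens H.smult_mult_left H.smult_mult_right H.smult_smult)
    qed (simp add: \<phi>_gens \<sigma>_gens)
  qed (simp_all add: \<sigma>_hom)
  then show "b \<in> B \<Longrightarrow> \<sigma> b = b" by auto
qed

sublocale cyc: cyclic_extension H.Q \<sigma> S S' B \<zeta> p
proof (intro cyclic_extension.intro H.assoc_algebra_presented cyclic_extension_axioms.intro)
  show "\<zeta> ^ i \<noteq> 1" if "0 < i" "i < p" for i
    using root that by (simp add: primitive_root_of_unity_def)
qed (use \<sigma>_alg_hom S' subring_B B_smult \<sigma>_B \<sigma>_gens root B_gens(1) conj_B in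
    \<open>auto simp: primitive_root_of_unity_def\<close>)

text \<open>The span W contains 1 and is stable under left multiplication by S and all T_a, so it is
  a left ideal containing 1.\<close>

lemma hecke_eq_W: "x \<in> carrier H.Q \<Longrightarrow> x \<in> cyc.W"
proof -
  have "x \<otimes>\<^bsub>H.Q\<^esub> w \<in> cyc.W" if "x \<in> carrier H.Q" "w \<in> cyc.W" for x w
    using that
  proof (induction arbitrary: w rule: H.presented_induct)
    case (scalar c)
    have "c \<odot>\<^bsub>H.Q\<^esub> \<one>\<^bsub>H.Q\<^esub> \<in> B" using subringE(3)[OF subring_B] by (rule B_smult)
    then show ?case using scalar by (rule cyc.W_mult_B)
  next
    case (gen g)
    then show ?case
      by (cases g) (auto intro: cyc.W_mult_S cyc.W_mult_B[OF B_gens(3)])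
  next
    case (add x y)
    then show ?case
      using cyc.W_closed by (subst H.l_distr) (auto simp: cyc.W_def intro: add_span.add)
  next
    case (mult x y)
    then show ?case using cyc.W_closed by (subst H.m_assoc) auto
  qed
  from this[OF _ cyc.one_W] show "x \<in> carrier H.Q \<Longrightarrow> x \<in> cyc.W" by auto
qed

lemma fixed_points: "x \<in> carrier H.Q \<Longrightarrow> \<sigma> x = x \<Longrightarrow> x \<in> B"
  by (rule cyc.fixed_in_B[OF hecke_eq_W])

end

section \<open>The grading of the Hecke algebra\<close>

context hecke_data
begin

abbreviation "comps \<equiv> compositions q \<zeta> n"
abbreviation "R \<equiv> qh_block q \<zeta> n \<Lambda>"
abbreviation "C \<equiv> hecke_component q \<zeta> n \<Lambda> f"

lemma qh_data: "\<alpha> \<in> comps \<Longrightarrow> qh_data q \<zeta> n \<alpha>"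
  using n q \<zeta> by unfold_locales auto

lemma block_algebra: "\<alpha> \<in> comps \<Longrightarrow> assoc_algebra (R \<alpha>)"
proof -
  assume "\<alpha> \<in> comps"
  then interpret qh_data q \<zeta> n \<Lambda> \<alpha> by (rule qh_data)
  show ?thesis unfolding qh_block_def by (rule assoc_algebra_presented)
qed

lemma f_iso: "alg_iso H.Q (quiver_hecke q \<zeta> n \<Lambda>) f"
  using bk by (simp add: is_bk_isomorphism_def hecke_def)

lemma f_closed: "x \<in> carrier H.Q \<Longrightarrow> f x \<in> carrier (quiver_hecke q \<zeta> n \<Lambda>)"
  using f_iso by (auto simp: alg_iso_def alg_hom_def ring_hom_def)

lemma f_block:
  assumes "\<alpha> \<in> comps"
  shows "x \<in> carrier H.Q \<Longrightarrow> f x \<alpha> \<in> carrier (R \<alpha>)"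
    "x \<in> carrier H.Q \<Longrightarrow> y \<in> carrier H.Q \<Longrightarrow> f (x \<oplus>\<^bsub>H.Q\<^esub> y) \<alpha> = f x \<alpha> \<oplus>\<^bsub>R \<alpha>\<^esub> f y \<alpha>"
    "x \<in> carrier H.Q \<Longrightarrow> y \<in> carrier H.Q \<Longrightarrow> f (x \<otimes>\<^bsub>H.Q\<^esub> y) \<alpha> = f x \<alpha> \<otimes>\<^bsub>R \<alpha>\<^esub> f y \<alpha>"
    "f \<one>\<^bsub>H.Q\<^esub> \<alpha> = \<one>\<^bsub>R \<alpha>\<^esub>"
    "x \<in> carrier H.Q \<Longrightarrow> f (c \<odot>\<^bsub>H.Q\<^esub> x) \<alpha> = c \<odot>\<^bsub>R \<alpha>\<^esub> f x \<alpha>"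
  using f_iso f_closed[of x] assms
  by (auto simp: alg_iso_def alg_hom_def ring_hom_def quiver_hecke_def direct_sum_alg_def PiE_def Pi_def)

lemma f_block_hom:
  assumes "\<alpha> \<in> comps"
  shows "ring_hom_ring H.Q (R \<alpha>) (\<lambda>x. f x \<alpha>)"
proof -
  interpret assoc_algebra "R \<alpha>" by (rule block_algebra[OF assms])
  show ?thesis
    by (intro ring_hom_ringI2 H.ring_presented ring_hom_memI) (use f_block[OF assms] in \<open>auto intro: ring_axioms\<close>)
qed

lemma f_inj: "x \<in> carrier H.Q \<Longrightarrow> y \<in> carrier H.Q \<Longrightarrow> (\<And>\<alpha>. \<alpha> \<in> comps \<Longrightarrow> f x \<alpha> = f y \<alpha>) \<Longrightarrow> x = y"
proof -
  assume xy: "x \<in> carrier H.Q" "y \<in> carrier H.Q" "\<And>\<alpha>. \<alpha> \<in> comps \<Longrightarrow> f x \<alpha> = f y \<alpha>"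
  have "f x = f y"
    using f_closed[OF xy(1)] f_closed[OF xy(2)] xy(3)
    by (auto simp: quiver_hecke_def direct_sum_alg_def intro: PiE_ext)
  then show "x = y"
    using f_iso xy by (auto simp: alg_iso_def bij_betw_def inj_on_def)
qed

lemma f_surj: "z \<in> carrier (quiver_hecke q \<zeta> n \<Lambda>) \<Longrightarrow> \<exists>x\<in>carrier H.Q. f x = z"
proof -
  assume "z \<in> carrier (quiver_hecke q \<zeta> n \<Lambda>)"
  then have "z \<in> f ` carrier H.Q"
    using f_iso by (simp add: alg_iso_def bij_betw_def)
  then show ?thesis by blast
qed

lemma component_iff:
  "x \<in> C m \<longleftrightarrow> x \<in> carrier H.Q \<and> (\<forall>\<alpha>\<in>comps. qh_homogeneous q \<zeta> n \<Lambda> \<alpha> m (f x \<alpha>))"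
  using f_closed by (auto simp: hecke_component_def quiver_hecke_component_def hecke_def)

lemma f_gens:
  "f S = image_X q \<zeta> n \<Lambda> 1" "a \<in> {1..<n} \<Longrightarrow> f (T a) = image_T \<epsilon> q \<zeta> n \<Lambda> a"
  using bk n unfolding is_bk_isomorphism_def hcl_def
  by (auto dest: bspec[of _ _ 1] bspec[of _ _ a])

text \<open>Shifting and then taking the \<beta>-coordinate, and applying the block map to the
  \<alpha>-coordinate, are two homomorphisms to the same block, so S and the T_a decide. At S the
  factor \<zeta> of the shift cancels the \<zeta>^-1 of the rotation.\<close>

lemma shift_homogeneous:
  assumes "x \<in> C m" shows "\<sigma> x \<in> C m"
  unfolding component_iff
proof (intro conjI ballI)
  show "\<sigma> x \<in> carrier H.Q" using assms by (simp add: component_iff)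
  fix \<beta> assume \<beta>: "\<beta> \<in> comps"
  define \<alpha> where "\<alpha> = (\<lambda>v. if v \<in> V then \<beta> (rotate v) else 0)"
  have \<alpha>: "\<alpha> \<in> comps" using rescaling_rotate(1)[OF \<beta>] by (simp add: \<alpha>_def)
  interpret rs: rescaling q \<zeta> n \<Lambda> \<alpha> \<beta> rotate "inverse \<zeta>"
    using rescaling_rotate(2)[OF \<beta>] by (simp add: \<alpha>_def)
  note f_dom = f_block[OF \<alpha>, unfolded qh_block_def] and f_cod = f_block[OF \<beta>, unfolded qh_block_def]
  have "f (\<sigma> y) \<beta> = rs.block_map (f y \<alpha>)" if "y \<in> carrier H.Q" for y
    using that
  proof (induction rule: H.presented_induct)
    case (scalar c)
    show ?case by (simp add: \<sigma>_hom f_dom f_cod rs.block_map_hom)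
  next
    case (gen g)
    then consider "g = HS" | a where "g = HT a" "a \<in> {1..<n}" by (auto simp: hecke_gens_def)
    then show ?case
    proof cases
      case 1
      have "f (\<sigma> S) \<beta> = \<zeta> \<odot>\<^bsub>rs.cod.Q\<^esub> f S \<beta>" by (simp add: \<sigma>_gens f_cod)
      also have "\<dots> = \<zeta> \<odot>\<^bsub>rs.cod.Q\<^esub> (inverse \<zeta> \<odot>\<^bsub>rs.cod.Q\<^esub> rs.block_map (f S \<alpha>))"
        using n rs.block_map_image_X[of 1] by (simp add: f_gens)
      also have "\<dots> = rs.block_map (f S \<alpha>)"
        using \<zeta> f_dom(1)[of S] by (simp add: rs.cod.smult_smult rs.block_map_hom)
      finally show ?thesis using 1 by simp
    next
      case (2 a)
      then show ?thesis by (simp add: \<sigma>_gens f_gens rs.block_map_image_T)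
    qed
  qed (simp_all add: \<sigma>_hom f_dom f_cod rs.block_map_hom)
  then show "qh_homogeneous q \<zeta> n \<Lambda> \<beta> m (f (\<sigma> x) \<beta>)"
    using assms \<alpha> by (simp add: component_iff rs.block_map_homogeneous)
qed

lemma component_zero: "\<zero>\<^bsub>H.Q\<^esub> \<in> C m"
  unfolding component_iff
proof (intro conjI ballI)
  fix \<alpha> assume "\<alpha> \<in> comps"
  then interpret ring_hom_ring H.Q "R \<alpha>" "\<lambda>x. f x \<alpha>" by (rule f_block_hom)
  show "qh_homogeneous q \<zeta> n \<Lambda> \<alpha> m (f \<zero>\<^bsub>H.Q\<^esub> \<alpha>)" by (simp add: qh_homogeneous.zero)
qed simp

lemma component_add: "x \<in> C m \<Longrightarrow> y \<in> C m \<Longrightarrow> x \<oplus>\<^bsub>H.Q\<^esub> y \<in> C m"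
  by (simp add: component_iff f_block qh_homogeneous.sum)

lemma component_diff:
  assumes "x \<in> C m" "y \<in> C m"
  shows "x \<ominus>\<^bsub>H.Q\<^esub> y \<in> C m"
proof -
  have "(- 1) \<odot>\<^bsub>H.Q\<^esub> y \<in> C m"
    using assms(2) by (simp add: component_iff f_block qh_homogeneous.scalar)
  then have "\<ominus>\<^bsub>H.Q\<^esub> y \<in> C m"
    using assms(2) by (simp add: component_iff H.smult_minus_left)
  then show ?thesis unfolding a_minus_def using assms(1) by (intro component_add)
qed

lemma component_closed: "x \<in> C m \<Longrightarrow> x \<in> carrier H.Q"
  by (simp add: component_iff)

section \<open>Spanning of the Hecke algebra by its homogeneous components\<close>

definition inject :: "(vertex \<Rightarrow> nat) \<Rightarrow> (qgen, 'f) free_algebra set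
    \<Rightarrow> (vertex \<Rightarrow> nat) \<Rightarrow> (qgen, 'f) free_algebra set" where
  "inject \<alpha> z = (\<lambda>\<beta>\<in>comps. if \<beta> = \<alpha> then z else \<zero>\<^bsub>R \<beta>\<^esub>)"

lemma inject_apply [simp]: "\<beta> \<in> comps \<Longrightarrow> inject \<alpha> z \<beta> = (if \<beta> = \<alpha> then z else \<zero>\<^bsub>R \<beta>\<^esub>)"
  by (simp add: inject_def)

lemma zero_block: "\<beta> \<in> comps \<Longrightarrow> \<zero>\<^bsub>R \<beta>\<^esub> \<in> carrier (R \<beta>)"
proof -
  assume "\<beta> \<in> comps"
  then interpret assoc_algebra "R \<beta>" by (rule block_algebra)
  show ?thesis by simp
qed

lemma inject_preimage:
  assumes "\<alpha> \<in> comps" "z \<in> carrier (R \<alpha>)"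
  obtains x where "x \<in> carrier H.Q" "f x = inject \<alpha> z"
proof -
  have "finite {\<beta> \<in> comps. inject \<alpha> z \<beta> \<noteq> \<zero>\<^bsub>R \<beta>\<^esub>}"
    by (rule finite_subset[of _ "{\<alpha>}"]) auto
  then have "inject \<alpha> z \<in> carrier (quiver_hecke q \<zeta> n \<Lambda>)"
    using assms zero_block by (auto simp: quiver_hecke_def direct_sum_alg_def inject_def)
  then show ?thesis using f_surj that by blast
qed

text \<open>An element of a block extended by zero to the other blocks stays homogeneous, since 0
  has every degree. So a sum of homogeneous elements of the block lifts term by term through the
  inverse of f.\<close>

lemma inject_span:
  assumes \<alpha>: "\<alpha> \<in> comps" and z: "z \<in> carrier (R \<alpha>)" and x: "x \<in> carrier H.Q" "f x = inject \<alpha> z"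
  shows "x \<in> add_span H.Q {x. \<exists>m. x \<in> C m}"
proof -
  interpret qh_data q \<zeta> n \<Lambda> \<alpha> by (rule qh_data[OF \<alpha>])
  have hom: "x \<in> C m" if "x \<in> carrier H.Q" "f x = inject \<alpha> z" "homogeneous m z" for x m z
    using that by (auto simp: component_iff qh_homogeneous.zero)
  have "z \<in> add_span Q {X. \<exists>m. homogeneous m X}"
    using homogeneous_span z by (simp add: qh_block_def)
  then show ?thesis using x
  proof (induction arbitrary: x rule: add_span.induct)
    case zero
    have "homogeneous 0 \<zero>\<^bsub>Q\<^esub>" using qh_homogeneous.zero by (simp add: qh_block_def)
    from hom[OF zero this] show ?case by (auto intro: add_span.incl)
  next
    case (incl z)
    then show ?case using hom by (auto intro!: add_span.incl)
  next
    case (add z1 z2)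
    have closed: "z1 \<in> carrier Q" "z2 \<in> carrier Q"
      using add.hyps add_span_closed[of "{X. \<exists>m. homogeneous m X}"] homogeneous_closed by auto
    obtain x1 x2 where x12: "x1 \<in> carrier H.Q" "f x1 = inject \<alpha> z1" "x2 \<in> carrier H.Q" "f x2 = inject \<alpha> z2"
      using inject_preimage[OF \<alpha>] closed unfolding qh_block_def by metis
    have "x = x1 \<oplus>\<^bsub>H.Q\<^esub> x2"
    proof (rule f_inj)
      fix \<beta> assume \<beta>: "\<beta> \<in> comps"
      interpret \<beta>: assoc_algebra "R \<beta>" by (rule block_algebra[OF \<beta>])
      show "f x \<beta> = f (x1 \<oplus>\<^bsub>H.Q\<^esub> x2) \<beta>"
        using \<beta> x12 add.prems
        by (cases "\<beta> = \<alpha>") (simp_all add: f_block(2) qh_block_def[symmetric])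
    qed (use add.prems x12 in auto)
    then show ?case using add.IH x12 by (simp add: add_span.add)
  qed
qed

text \<open>Elements of the direct sum have finite support, so the parts in single blocks can be
  split off one after the other; F bounds the blocks that are still to be treated.\<close>

lemma hecke_span:
  assumes "x \<in> carrier H.Q"
  shows "x \<in> add_span H.Q {x. \<exists>m. x \<in> C m}"
proof -
  have "finite {\<alpha> \<in> comps. f x \<alpha> \<noteq> \<zero>\<^bsub>R \<alpha>\<^esub>}"
    using f_closed[OF assms] by (simp add: quiver_hecke_def direct_sum_alg_def)
  moreover have "x \<in> add_span H.Q {x. \<exists>m. x \<in> C m}"
    if "finite F" "F \<subseteq> comps" "x \<in> carrier H.Q" "{\<alpha> \<in> comps. f x \<alpha> \<noteq> \<zero>\<^bsub>R \<alpha>\<^esub>} \<subseteq> F" for x F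
    using that
  proof (induction F arbitrary: x rule: finite_induct)
    case empty
    then have "x \<in> C 0" by (auto simp: component_iff qh_homogeneous.zero)
    then show ?case by (auto intro: add_span.incl)
  next
    case (insert \<alpha> F)
    have \<alpha>: "\<alpha> \<in> comps" using insert.prems by auto
    obtain y where y: "y \<in> carrier H.Q" "f y = inject \<alpha> (f x \<alpha>)"
      using inject_preimage[OF \<alpha> f_block(1)[OF \<alpha> insert.prems(2)]] .
    have "y \<in> add_span H.Q {x. \<exists>m. x \<in> C m}"
      using inject_span[OF \<alpha> f_block(1)[OF \<alpha> insert.prems(2)] y] .
    moreover have "x \<ominus>\<^bsub>H.Q\<^esub> y \<in> add_span H.Q {x. \<exists>m. x \<in> C m}"
    proof (rule insert.IH)
      show "{\<beta> \<in> comps. f (x \<ominus>\<^bsub>H.Q\<^esub> y) \<beta> \<noteq> \<zero>\<^bsub>R \<beta>\<^esub>} \<subseteq> F"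
      proof (rule subsetI)
        fix \<beta> assume "\<beta> \<in> {\<beta> \<in> comps. f (x \<ominus>\<^bsub>H.Q\<^esub> y) \<beta> \<noteq> \<zero>\<^bsub>R \<beta>\<^esub>}"
        then have \<beta>: "\<beta> \<in> comps" "f (x \<ominus>\<^bsub>H.Q\<^esub> y) \<beta> \<noteq> \<zero>\<^bsub>R \<beta>\<^esub>" by auto
        interpret assoc_algebra "R \<beta>" by (rule block_algebra[OF \<beta>(1)])
        interpret f: ring_hom_ring H.Q "R \<beta>" "\<lambda>x. f x \<beta>" by (rule f_block_hom[OF \<beta>(1)])
        have "f (x \<ominus>\<^bsub>H.Q\<^esub> y) \<beta> = f x \<beta> \<ominus>\<^bsub>R \<beta>\<^esub> f y \<beta>"
          using insert.prems y by (simp add: a_minus_def)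
        moreover have "f x \<beta> \<in> carrier (R \<beta>)"
          using f_block(1)[OF \<beta>(1) insert.prems(2)] .
        ultimately have ne: "f x \<beta> \<noteq> f y \<beta>"
          using \<beta>(2) by (auto simp: a_minus_def r_neg)
        have "\<beta> \<noteq> \<alpha>"
          using ne y(2) \<beta>(1) by auto
        moreover from this have "f y \<beta> = \<zero>\<^bsub>R \<beta>\<^esub>"
          using y(2) \<beta>(1) by simp
        ultimately have "\<beta> \<noteq> \<alpha>" "f x \<beta> \<noteq> \<zero>\<^bsub>R \<beta>\<^esub>"
          using ne by simp_all
        then show "\<beta> \<in> F" using insert.prems(3) \<beta>(1) by auto
      qed
    qed (use insert.prems y in auto)
    ultimately have "(x \<ominus>\<^bsub>H.Q\<^esub> y) \<oplus>\<^bsub>H.Q\<^esub> y \<in> add_span H.Q {x. \<exists>m. x \<in> C m}"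
      by (intro add_span.add)
    then show ?case using insert.prems y by (simp add: a_minus_def H.a_assoc H.l_neg)
  qed
  ultimately show ?thesis using assms by blast
qed

section \<open>Existence and uniqueness of homogeneous decompositions\<close>

definition decomposes :: "(hgen, 'f) free_algebra set \<Rightarrow> (int \<Rightarrow> (hgen, 'f) free_algebra set) \<Rightarrow> bool" where
  "decomposes x h \<longleftrightarrow> (\<forall>m. h m \<in> C m) \<and> finite {m. h m \<noteq> \<zero>\<^bsub>H.Q\<^esub>} \<and>
     x = (\<Oplus>\<^bsub>H.Q\<^esub>m\<in>{m. h m \<noteq> \<zero>\<^bsub>H.Q\<^esub>}. h m)"

text \<open>Cancellation can make the support of a sum smaller than the union of the supports; this
  allows all sums to be compared over one common finite set.\<close>

lemma finsum_support:
  assumes "\<And>m. h m \<in> carrier H.Q" "finite M" "{m. h m \<noteq> \<zero>\<^bsub>H.Q\<^esub>} \<subseteq> M"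
  shows "(\<Oplus>\<^bsub>H.Q\<^esub>m\<in>{m. h m \<noteq> \<zero>\<^bsub>H.Q\<^esub>}. h m) = (\<Oplus>\<^bsub>H.Q\<^esub>m\<in>M. h m)"
  using assms by (intro H.add.finprod_mono_neutral_cong_left) auto

lemma decomposesI:
  assumes "\<And>m. h m \<in> C m" "finite M" "\<And>m. m \<notin> M \<Longrightarrow> h m = \<zero>\<^bsub>H.Q\<^esub>" "x = (\<Oplus>\<^bsub>H.Q\<^esub>m\<in>M. h m)"
  shows "decomposes x h"
proof -
  have M: "{m. h m \<noteq> \<zero>\<^bsub>H.Q\<^esub>} \<subseteq> M" using assms(3) by auto
  then show ?thesis
    using assms finsum_support[OF component_closed[OF assms(1)] assms(2) M]
    by (simp add: decomposes_def finite_subset)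
qed

lemma decomposesD:
  assumes "decomposes x h"
  shows "h m \<in> C m" "h m \<in> carrier H.Q" "finite {m. h m \<noteq> \<zero>\<^bsub>H.Q\<^esub>}"
    "finite M \<Longrightarrow> {m. h m \<noteq> \<zero>\<^bsub>H.Q\<^esub>} \<subseteq> M \<Longrightarrow> x = (\<Oplus>\<^bsub>H.Q\<^esub>m\<in>M. h m)"
proof -
  show 1: "h m \<in> C m" "h m \<in> carrier H.Q" for m
    using assms component_closed by (auto simp: decomposes_def)
  show "finite {m. h m \<noteq> \<zero>\<^bsub>H.Q\<^esub>}" using assms by (simp add: decomposes_def)
  show "x = (\<Oplus>\<^bsub>H.Q\<^esub>m\<in>M. h m)" if "finite M" "{m. h m \<noteq> \<zero>\<^bsub>H.Q\<^esub>} \<subseteq> M"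
    using assms finsum_support[OF 1(2) that] by (simp add: decomposes_def)
qed

lemma decomposes_ex: "x \<in> carrier H.Q \<Longrightarrow> \<exists>h. decomposes x h"
proof -
  have "\<exists>h. decomposes x h" if "x \<in> add_span H.Q {x. \<exists>m. x \<in> C m}"
    using that
  proof (induction rule: add_span.induct)
    case zero
    show ?case
      by (intro exI[of _ "\<lambda>_. \<zero>\<^bsub>H.Q\<^esub>"] decomposesI[of _ "{}"]) (auto simp: component_zero)
  next
    case (incl x)
    then obtain m where "x \<in> C m" by blast
    then show ?case
      by (intro exI[of _ "\<lambda>i. if i = m then x else \<zero>\<^bsub>H.Q\<^esub>"] decomposesI[of _ "{m}"])
         (auto simp: component_zero component_closed)
  next
    case (add x1 x2)
    then obtain h1 h2 where h: "decomposes x1 h1" "decomposes x2 h2" by blast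
    let ?M = "{m. h1 m \<noteq> \<zero>\<^bsub>H.Q\<^esub>} \<union> {m. h2 m \<noteq> \<zero>\<^bsub>H.Q\<^esub>}"
    have M: "finite ?M" using decomposesD(3)[OF h(1)] decomposesD(3)[OF h(2)] by simp
    have "x1 = (\<Oplus>\<^bsub>H.Q\<^esub>m\<in>?M. h1 m)" by (rule decomposesD(4)[OF h(1) M]) blast
    moreover have "x2 = (\<Oplus>\<^bsub>H.Q\<^esub>m\<in>?M. h2 m)" by (rule decomposesD(4)[OF h(2) M]) blast
    ultimately have "x1 \<oplus>\<^bsub>H.Q\<^esub> x2 = (\<Oplus>\<^bsub>H.Q\<^esub>m\<in>?M. h1 m \<oplus>\<^bsub>H.Q\<^esub> h2 m)"
      using decomposesD(2)[OF h(1)] decomposesD(2)[OF h(2)] by (simp only: H.finsum_addf Pi_I)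
    then have "decomposes (x1 \<oplus>\<^bsub>H.Q\<^esub> x2) (\<lambda>m. h1 m \<oplus>\<^bsub>H.Q\<^esub> h2 m)"
      using decomposesD(1)[OF h(1)] decomposesD(1)[OF h(2)] M
      by (intro decomposesI[of _ ?M]) (simp_all add: component_add)
    then show ?case by blast
  qed
  then show "x \<in> carrier H.Q \<Longrightarrow> \<exists>h. decomposes x h" using hecke_span by blast
qed

text \<open>The differences h m - h' m are homogeneous of degree m with sum 0; in every block they
  vanish by independence, and f is injective.\<close>

lemma decomposes_unique:
  assumes "decomposes x h" "decomposes x h'"
  shows "h = h'"
proof
  fix m
  \<comment> \<open>The degree m is added so that independence can be applied at m even if it lies
    in neither support.\<close>
  let ?M = "insert m ({m. h m \<noteq> \<zero>\<^bsub>H.Q\<^esub>} \<union> {m. h' m \<noteq> \<zero>\<^bsub>H.Q\<^esub>})"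
  have M1: "finite ?M" using decomposesD(3)[OF assms(1)] decomposesD(3)[OF assms(2)] by simp
  have M2: "x = (\<Oplus>\<^bsub>H.Q\<^esub>m\<in>?M. h m)" by (rule decomposesD(4)[OF assms(1) M1]) blast
  have M3: "x = (\<Oplus>\<^bsub>H.Q\<^esub>m\<in>?M. h' m)" by (rule decomposesD(4)[OF assms(2) M1]) blast
  note closed = decomposesD(2)[OF assms(1)] decomposesD(2)[OF assms(2)]
  show "h m = h' m"
  proof (rule f_inj[OF closed])
    fix \<alpha> assume \<alpha>: "\<alpha> \<in> comps"
    interpret qh_data q \<zeta> n \<Lambda> \<alpha> by (rule qh_data[OF \<alpha>])
    interpret f: ring_hom_ring H.Q Q "\<lambda>x. f x \<alpha>" using f_block_hom[OF \<alpha>] by (simp add: qh_block_def)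
    let ?d = "\<lambda>m. h m \<ominus>\<^bsub>H.Q\<^esub> h' m"
    have d: "?d m \<in> C m" for m
      using decomposesD(1)[OF assms(1)] decomposesD(1)[OF assms(2)] by (rule component_diff)
    have x: "x \<in> carrier H.Q" unfolding M2 using closed by (intro H.finsum_closed) auto
    have dc: "(\<Oplus>\<^bsub>H.Q\<^esub>m\<in>?M. ?d m) \<in> carrier H.Q" using closed by (intro H.finsum_closed) auto
    have "(\<Oplus>\<^bsub>H.Q\<^esub>m\<in>?M. ?d m) \<oplus>\<^bsub>H.Q\<^esub> (\<Oplus>\<^bsub>H.Q\<^esub>m\<in>?M. h' m) = (\<Oplus>\<^bsub>H.Q\<^esub>m\<in>?M. ?d m \<oplus>\<^bsub>H.Q\<^esub> h' m)"
      using closed by (intro H.finsum_addf[symmetric]) auto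
    also have "\<dots> = (\<Oplus>\<^bsub>H.Q\<^esub>m\<in>?M. h m)"
      using closed by (intro H.finsum_cong') (simp_all add: a_minus_def H.a_assoc H.l_neg)
    finally have "(\<Oplus>\<^bsub>H.Q\<^esub>m\<in>?M. ?d m) \<oplus>\<^bsub>H.Q\<^esub> x = x"
      unfolding M2[symmetric] M3[symmetric] .
    then have "(\<Oplus>\<^bsub>H.Q\<^esub>m\<in>?M. ?d m) = \<zero>\<^bsub>H.Q\<^esub>"
      using H.add.r_cancel_one[OF x dc] x dc by simp
    then have "(\<Oplus>\<^bsub>Q\<^esub>m\<in>?M. f (?d m) \<alpha>) = \<zero>\<^bsub>Q\<^esub>"
      using f.hom_finsum[of ?d ?M] closed by (simp add: comp_def)
    then have "f (?d m) \<alpha> = \<zero>\<^bsub>Q\<^esub>"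
      using homogeneous_independent[OF M1, of "\<lambda>m. f (?d m) \<alpha>" m] d \<alpha> by (auto simp: component_iff)
    moreover have "h m = ?d m \<oplus>\<^bsub>H.Q\<^esub> h' m" using closed by (simp add: a_minus_def H.a_assoc H.l_neg)
    ultimately show "f (h m) \<alpha> = f (h' m) \<alpha>"
      using closed f.hom_add[of "?d m" "h' m"] by simp
  qed
qed

lemma decomposes_shift:
  assumes "decomposes x h" shows "decomposes (\<sigma> x) (\<lambda>m. \<sigma> (h m))"
proof (rule decomposesI)
  let ?M = "{m. h m \<noteq> \<zero>\<^bsub>H.Q\<^esub>}"
  show "\<sigma> x = (\<Oplus>\<^bsub>H.Q\<^esub>m\<in>?M. \<sigma> (h m))"
    using decomposesD(2,3)[OF assms] decomposesD(4)[OF assms, of ?M]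
    by (simp add: comp_def)
qed (use decomposesD[OF assms] shift_homogeneous in auto)

lemma graded: "graded_subalgebra H.Q C B"
  unfolding graded_subalgebra_def
proof (intro conjI ballI allI)
  show "subring B H.Q" by (rule subring_B)
  show "c \<odot>\<^bsub>H.Q\<^esub> b \<in> B" if "b \<in> B" for c b using that by (rule B_smult)
  fix x assume x: "x \<in> B"
  then have closed: "x \<in> carrier H.Q" using subringE(1)[OF subring_B] by blast
  obtain h where h: "decomposes x h" using decomposes_ex[OF closed] by blast
  \<comment> \<open>Applying \<sigma> to the components decomposes \<sigma> x = x again, and
    uniqueness makes each component a fixed point.\<close>
  have "(\<lambda>m. \<sigma> (h m)) = h"
    using decomposes_unique[OF decomposes_shift[OF h]] h \<sigma>_B[OF x] by simp
  then have h_B: "h m \<in> B" for m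
    using fixed_points decomposesD(2)[OF h] by metis
  show "\<exists>!h. (\<forall>m. h m \<in> B \<inter> C m) \<and> finite {m. h m \<noteq> \<zero>\<^bsub>H.Q\<^esub>} \<and>
      x = (\<Oplus>\<^bsub>H.Q\<^esub>m\<in>{m. h m \<noteq> \<zero>\<^bsub>H.Q\<^esub>}. h m)"
  proof (rule ex1I[of _ h])
    show "(\<forall>m. h m \<in> B \<inter> C m) \<and> finite {m. h m \<noteq> \<zero>\<^bsub>H.Q\<^esub>} \<and>
      x = (\<Oplus>\<^bsub>H.Q\<^esub>m\<in>{m. h m \<noteq> \<zero>\<^bsub>H.Q\<^esub>}. h m)"
      using h h_B unfolding decomposes_def by blast
  next
    fix h'
    assume "(\<forall>m. h' m \<in> B \<inter> C m) \<and> finite {m. h' m \<noteq> \<zero>\<^bsub>H.Q\<^esub>} \<and>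
      x = (\<Oplus>\<^bsub>H.Q\<^esub>m\<in>{m. h' m \<noteq> \<zero>\<^bsub>H.Q\<^esub>}. h' m)"
    then have "decomposes x h'" unfolding decomposes_def by blast
    then show "h' = h" using h by (rule decomposes_unique)
  qed
qed

lemma shift_homogeneous_graded:
  "(\<forall>m. \<sigma> ` C m \<subseteq> C m) \<and>
    graded_subalgebra (hecke q \<zeta> n \<Lambda>) C (\<phi> ` carrier (phecke q p n L))"
  using shift_homogeneous graded by (simp add: hecke_def phecke_def image_subset_iff)

end

theorem corollary4p17:
  fixes q \<zeta> \<epsilon> :: "'f::field"
    and d p n :: nat
    and \<Lambda> L :: "int \<Rightarrow> nat"
    and \<sigma> :: "(hgen, 'f) free_algebra set \<Rightarrow> (hgen, 'f) free_algebra set"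
    and \<phi> :: "(pgen, 'f) free_algebra set \<Rightarrow> (hgen, 'f) free_algebra set"
    and f :: "(hgen, 'f) free_algebra set \<Rightarrow> (vertex \<Rightarrow> nat) \<Rightarrow> (qgen, 'f) free_algebra set"
  assumes "d \<ge> 1" and "p \<ge> 1" and "n \<ge> 2"
    and "primitive_root_of_unity p \<zeta>"
    and "q \<noteq> 0" and "q \<noteq> 1"
    and "shift_invariant_weight q \<zeta> p d \<Lambda>"
    and "weight_lift q \<zeta> d \<Lambda> L"
    and "\<epsilon> = 1 \<or> \<epsilon> = - 1"
    and "is_bk_isomorphism \<epsilon> q \<zeta> n \<Lambda> f"
    and "is_shift q \<zeta> n \<Lambda> \<sigma>"
    and "is_ariki_embedding q \<zeta> p n \<Lambda> L \<phi>"
  shows "(\<forall>m. \<sigma> ` hecke_component q \<zeta> n \<Lambda> f m \<subseteq> hecke_component q \<zeta> n \<Lambda> f m) \<and>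
    graded_subalgebra (hecke q \<zeta> n \<Lambda>) (hecke_component q \<zeta> n \<Lambda> f) (\<phi> ` carrier (phecke q p n L))"
proof -
  have weight: "\<Lambda> i = \<Lambda> ((i + eta q \<zeta>) mod int (mult_order q))" if "i \<in> index_set q" for i
    using assms(7) that unfolding shift_invariant_weight_def by blast
  have sd: "shift_data q \<zeta> p n \<Lambda>"
    using assms(4,5,6,3) weight by (rule shift_data.intro)
  have "hecke_data q \<zeta> p n \<Lambda> L \<epsilon> \<sigma> \<phi> f"
    using sd hecke_data_axioms.intro[OF assms(10-12)] by (rule hecke_data.intro)
  then show ?thesis
    by (rule hecke_data.shift_homogeneous_graded)
qed

end
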